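(* Let $\mathbf{k}$ be a field, let $U$ be a $3$-dimensional $\mathbf{k}$-vector space with basis $x,y,z$, let $U_0$ be the subspace spanned by $y$ and $z$, and let $R=\operatorname{Sym}_\bullet U=\mathbf{k}[x,y,z]$ (standard graded). Let $n$ be a positive integer, let $\Phi_{2n-1}\in D_{2n-1}U^*$, and let $I=\operatorname{ann}_{\operatorname{Sym}U}(x(\Phi_{2n-1}))=\{\mu\in R\mid \mu(x(\Phi_{2n-1}))=0\}$. Let $N=\binom{n+1}{2}$, let $m_1,\dots,m_N$ be the ordered basis of $\operatorname{Sym}_{n-1}U$ and $m_{0,1},\dots,m_{0,n+1}$ the ordered basis of $\operatorname{Sym}_nU_0$ described in the context. Let $\mathbf{p}$ be the $N\times N$ matrix with $(i,j)$ entry $\Phi_{2n-1}(xm_im_j)$ and $\mathbf{r}$ the $N\times(n+1)$ matrix with $(i,j)$ entry $\Phi_{2n-1}(m_im_{0,j})$. Then: (a) $I$ is linearly presented if and only if $\mathbf{p}$ is invertible. (b) If $\mathbf{p}$ is invertible, define: $A_0$ = the $(n+1)\times(n+1)$ matrix $\mathbf{r}^{\rm T}\mathbf{p}^{-1}\mathbf{r}$ with row $n+1$ and column $1$ deleted; $A'=A_0-A_0^{\rm T}$; $A=xA'$; $B_0$ = the right-most $n$ columns of the $(n+1)\times N$ matrix $\mathbf{r}^{\rm T}\mathbf{p}^{-1}$; $B_1=\left[\,0_{n\times 1}\mid B_0\text{ with row } n+1 \text{ deleted}\,\right]-\left[\,B_0\text{ with row }1\text{ deleted}\mid 0_{n\times1}\,\right]$;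 $B_2=\left[\,zI_n\mid 0_{n\times1}\,\right]-\left[\,0_{n\times1}\mid yI_n\,\right]$; $B=xB_1+B_2$; $D_0$ = the $(n+1)\times(n+1)$ matrix $\begin{bmatrix}0_{n\times1}& Q\\ 0_{1\times1}&0_{1\times n}\end{bmatrix}$ where $Q$ is the bottom-right $n\times n$ submatrix of $\mathbf{p}^{-1}$; $D=x(D_0-D_0^{\rm T})$; and $$b_2=\begin{bmatrix}A&B\\ -B^{\rm T}&D\end{bmatrix}.$$ Let $b_1$ be the row vector of signed maximal order Pfaffians of $b_2$ and $b_3=b_1^{\rm T}$. Then the minimal homogeneous resolution of $R/I$ by free $R$-modules is $$0\to R(-2n-1)\xrightarrow{b_3}R(-n-1)^{2n+1}\xrightarrow{b_2}R(-n)^{2n+1}\xrightarrow{b_1}R.$$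
   Context: For a finite-dimensional $\mathbf{k}$-vector space $V$, $D_iV^*=\operatorname{Hom}_{\mathbf{k}}(\operatorname{Sym}_iV,\mathbf{k})$ and $D_\bullet V^*=\bigoplus_{i\ge0}D_iV^*$. The ring $\operatorname{Sym}_\bullet U$ acts on $D_\bullet U^*$: for $u\in\operatorname{Sym}_iU$ and $w\in D_jU^*$, $u(w)\in D_{j-i}U^*$ is defined by $u(w)(v)=w(vu)$ for $v\in\operatorname{Sym}_{j-i}U$ (and $u(w)=0$ if $i>j$); for $u\in \operatorname{Sym}_jU$ and $w\in D_jU^*$, $u(w)=w(u)\in\mathbf{k}$. Ordered bases: the basis of $\operatorname{Sym}_iU$ consists of the monomials $x^ay^bz^c$ with $a+b+c=i$, where $x^ay^bz^c$ precedes $x^\alpha y^\beta z^\gamma$ iff $\alpha<a$, or $\alpha=a$ and $\beta<b$ (so the order is $x^i,x^{i-1}y,x^{i-1}z,x^{i-2}y^2,x^{i-2}yz,x^{i-2}z^2,\dots,y^i,y^{i-1}z,\dots,z^i$); the basis of $\operatorname{Sym}_iU_0$ is $y^i,y^{i-1}z,\dots,yz^{i-1},z^i$. $I_a$ is the $a\times a$ identity matrix and $0_{a\times b}$ the $a\times b$ zero matrix. For an $m\times m$ alternating matrix $M$ ($M^{\rm T}=-M$, zero diagonal) with $m$ odd, the row vector of signed maximal order Pfaffians is $[M_1,\dots,M_m]$ where $M_j=(-1)^{j+1}$ times the Pfaffian of $M$ with row and column $j$ deleted. A homogeneous ideal $I$ is linearly presented if, in the minimal homogeneous free resolution $\cdots\to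 F_2\xrightarrow{d_2}F_1\xrightarrow{d_1}F_0$ of $R/I$, all entries of $d_2$ are linear forms. *)

theory Defs
  imports "HOL-Library.Poly_Mapping" "Jordan_Normal_Form.Matrix"
begin

datatype var = X | Y | Z

type_synonym mono = "var \<Rightarrow>\<^sub>0 nat"
type_synonym 'k poly3 = "mono \<Rightarrow>\<^sub>0 'k"

definition mdeg :: "mono \<Rightarrow> nat" where
  "mdeg m = Poly_Mapping.lookup m X + Poly_Mapping.lookup m Y + Poly_Mapping.lookup m Z"

definition mon :: "nat \<Rightarrow> nat \<Rightarrow> nat \<Rightarrow> mono" where
  "mon a b c = Poly_Mapping.single X a + Poly_Mapping.single Y b + Poly_Mapping.single Z c"

definition pvar :: "var \<Rightarrow> 'k::comm_ring_1 poly3" where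
  "pvar v = Poly_Mapping.single (Poly_Mapping.single v 1) 1"

definition pconst :: "'k::comm_ring_1 \<Rightarrow> 'k poly3" where
  "pconst c = Poly_Mapping.single 0 c"

text \<open>homogeneous of (integer) degree e; the zero polynomial is homogeneous of every degree\<close>
definition homog :: "'k::comm_ring_1 poly3 \<Rightarrow> int \<Rightarrow> bool" where
  "homog f e \<longleftrightarrow> (\<forall>m \<in> Poly_Mapping.keys f. int (mdeg m) = e)"

definition in_max_ideal :: "'k::comm_ring_1 poly3 \<Rightarrow> bool" where
  "in_max_ideal f \<longleftrightarrow> Poly_Mapping.lookup f 0 = 0"

definition sym_basis :: "nat \<Rightarrow> mono list" where
  "sym_basis i = concat (map (\<lambda>a. map (\<lambda>b. mon a b (i - a - b)) (rev [0..<i - a + 1])) (rev [0..<i + 1]))"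

definition sym0_basis :: "nat \<Rightarrow> mono list" where
  "sym0_basis i = map (\<lambda>j. mon 0 (i - j) j) [0..<i + 1]"

text \<open>An element of D_bullet U^* = (+)_i Hom(Sym_i U, k) is represented by its values on the
  monomial basis of Sym_bullet U; it lies in D_d U^* iff it vanishes on monomials of degree \<noteq> d.\<close>
definition in_D :: "nat \<Rightarrow> (mono \<Rightarrow> 'k::zero) \<Rightarrow> bool" where
  "in_D d w \<longleftrightarrow> (\<forall>m. mdeg m \<noteq> d \<longrightarrow> w m = 0)"

definition contract :: "'k::comm_ring_1 poly3 \<Rightarrow> (mono \<Rightarrow> 'k) \<Rightarrow> (mono \<Rightarrow> 'k)" where
  "contract u w = (\<lambda>m. \<Sum>m' \<in> Poly_Mapping.keys u. Poly_Mapping.lookup u m' * w (m + m'))"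

definition ann :: "(mono \<Rightarrow> 'k::comm_ring_1) \<Rightarrow> 'k poly3 set" where
  "ann w = {\<mu>. contract \<mu> w = (\<lambda>_. 0)}"

text \<open>ds = [d_1, ..., d_L] with d_k : F_k \<rightarrow> F_(k-1) (matrices acting on column vectors);
  tw ! k lists the twists of F_k, i.e. F_k = (+)_j R(-(tw!k!j)); F_0 = R.
  This is a minimal homogeneous free resolution of R/I.\<close>
definition min_hom_res :: "'k::comm_ring_1 poly3 set \<Rightarrow> 'k poly3 mat list \<Rightarrow> nat list list \<Rightarrow> bool" where
  "min_hom_res I ds tw \<longleftrightarrow>
     length ds \<ge> 1 \<and> length tw = length ds + 1 \<and> tw ! 0 = [0] \<and>
     (\<forall>k < length ds. ds ! k \<in> carrier_mat (length (tw ! k)) (length (tw ! (k+1)))) \<and>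
     (\<forall>k < length ds. \<forall>i < length (tw ! k). \<forall>j < length (tw ! (k+1)).
        homog ((ds ! k) $$ (i,j)) (int (tw ! (k+1) ! j) - int (tw ! k ! i)) \<and>
        in_max_ideal ((ds ! k) $$ (i,j))) \<and>
     I = {(ds ! 0 *\<^sub>v v) $ 0 | v. v \<in> carrier_vec (length (tw ! 1))} \<and>
     (\<forall>k. k + 1 < length ds \<longrightarrow>
        (\<forall>v \<in> carrier_vec (length (tw ! (k+1))).
           ds ! k *\<^sub>v v = 0\<^sub>v (length (tw ! k)) \<longleftrightarrow>
           (\<exists>w \<in> carrier_vec (length (tw ! (k+2))). v = ds ! (k+1) *\<^sub>v w))) \<and>
     (\<forall>v \<in> carrier_vec (length (tw ! length ds)).
        ds ! (length ds - 1) *\<^sub>v v = 0\<^sub>v (length (tw ! (length ds - 1))) \<longrightarrow>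
        v = 0\<^sub>v (length (tw ! length ds)))"

text \<open>I is linearly presented: in the minimal homogeneous free resolution of R/I all entries of
  d_2 are linear forms (if there is no F_2, d_2 = 0 and the condition is vacuous).\<close>
definition linearly_presented :: "'k::comm_ring_1 poly3 set \<Rightarrow> bool" where
  "linearly_presented I \<longleftrightarrow> (\<exists>ds tw. min_hom_res I ds tw \<and>
     (length ds \<ge> 2 \<longrightarrow> (\<forall>i < dim_row (ds ! 1). \<forall>j < dim_col (ds ! 1). homog ((ds ! 1) $$ (i,j)) 1)))"

text \<open>Pfaffian of the principal submatrix on the index list l (expansion along the first index).\<close>
function pf :: "'a::comm_ring_1 mat \<Rightarrow> nat list \<Rightarrow> 'a" where
  "pf A [] = 1"
| "pf A (i # rest) = (\<Sum>k < length rest. (-1) ^ k * A $$ (i, rest ! k) * pf A (take k rest @ drop (Suc k) rest))"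
  by pat_completeness auto
termination
  by (relation "measure (\<lambda>(A, l). length l)") auto

definition pfaff_row :: "'a::comm_ring_1 mat \<Rightarrow> 'a mat" where
  "pfaff_row M = mat 1 (dim_row M) (\<lambda>(_, j). (-1) ^ j * pf M (filter (\<lambda>i. i \<noteq> j) [0..<dim_row M]))"

definition mat_inv :: "'a::field mat \<Rightarrow> 'a mat" where
  "mat_inv P = (THE Q. Q \<in> carrier_mat (dim_row P) (dim_row P) \<and> P * Q = 1\<^sub>m (dim_row P) \<and> Q * P = 1\<^sub>m (dim_row P))"

definition xmul :: "'k::comm_ring_1 mat \<Rightarrow> 'k poly3 mat" where
  "xmul M = map_mat (\<lambda>c. pconst c * pvar X) M"

definition Pmat :: "nat \<Rightarrow> (mono \<Rightarrow> 'k) \<Rightarrow> 'k mat" where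
  "Pmat n \<Phi> = (let ms = sym_basis (n - 1) in
     mat (length ms) (length ms) (\<lambda>(i,j). \<Phi> (Poly_Mapping.single X 1 + ms ! i + ms ! j)))"

definition Rmat :: "nat \<Rightarrow> (mono \<Rightarrow> 'k) \<Rightarrow> 'k mat" where
  "Rmat n \<Phi> = (let ms = sym_basis (n - 1); m0 = sym0_basis n in
     mat (length ms) (n + 1) (\<lambda>(i,j). \<Phi> (ms ! i + m0 ! j)))"

definition b2mat :: "nat \<Rightarrow> (mono \<Rightarrow> 'k::field) \<Rightarrow> 'k poly3 mat" where
  "b2mat n \<Phi> = (let p = Pmat n \<Phi>; r = Rmat n \<Phi>; N = dim_row p; pinv = mat_inv p;
     M = transpose_mat r * pinv * r;
     A0 = mat n n (\<lambda>(i,j). M $$ (i, j + 1));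
     A = xmul (A0 - transpose_mat A0);
     T = transpose_mat r * pinv;
     B0 = mat (n + 1) n (\<lambda>(i,j). T $$ (i, N - n + j));
     B1 = mat n (n + 1) (\<lambda>(i,j). (if j = 0 then 0 else B0 $$ (i, j - 1))
                                 - (if j = n then 0 else B0 $$ (i + 1, j)));
     B2 = mat n (n + 1) (\<lambda>(i,j). (if j = i then pvar Z else 0) - (if j = i + 1 then pvar Y else 0));
     B = xmul B1 + B2;
     Q = mat n n (\<lambda>(i,j). pinv $$ (N - n + i, N - n + j));
     D0 = mat (n + 1) (n + 1) (\<lambda>(i,j). if i < n \<and> 1 \<le> j then Q $$ (i, j - 1) else 0);
     D = xmul (D0 - transpose_mat D0)
   in four_block_mat A B (- transpose_mat B) D)"

end

theory Submission
  imports Defs "Jordan_Normal_Form.Determinant"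
begin

text \<open>
Write \<open>\<Psi> = x(\<Phi>)\<close> and suppose that \<open>p\<close> is invertible. Let \<open>E\<^sub>k\<close> be the forms of degree \<open>n - 1\<close>
that are dual, for the pairing \<open>(u, v) \<mapsto> \<Psi>(uv)\<close>, to the monomials \<open>y\<^bsup>n-1-k\<^esup> z\<^bsup>k\<^esup>\<close>, let \<open>h\<^sub>j\<close> be
the forms representing \<open>u \<mapsto> \<Phi>(y\<^bsup>n-j\<^esup> z\<^bsup>j\<^esup> u)\<close>, and put \<open>G\<^sub>j = y\<^bsup>n-j\<^esup> z\<^bsup>j\<^esup> - x h\<^sub>j\<close>.
Then \<open>(x E\<^sub>k | G\<^sub>j)\<close> is a basis of \<open>I\<^sub>n\<close>, and the columns of \<open>b\<^sub>2\<close> are obtained by expanding the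
elements \<open>z h\<^sub>i - y h\<^sub>i\<^sub>+\<^sub>1\<close> and \<open>z E\<^sub>j - y E\<^sub>j\<^sub>-\<^sub>1\<close> of \<open>I\<^sub>n\<close> in this basis.
Modulo \<open>x\<close> the off-diagonal block of \<open>b\<^sub>2\<close> becomes the Hilbert--Burch matrix of \<open>(y, z)\<^sup>n\<close>, so that
exactness follows by subtracting an element of the image, dividing by \<open>x\<close> and descending on the degree.
Since \<open>b\<^sub>2\<close> is alternating, its Pfaffians also span its kernel, hence agree with the generators up to
a unit.

Conversely, a linearly presented \<open>I\<close> is generated in one degree \<open>a\<close>. If \<open>a < n\<close>, duality turns a generator
into a Koszul cycle modulo \<open>I\<close> of degree \<open>2n - 1 - a\<close> that is not a boundary, and this gives a minimal syzygy of
degree \<open>2n + 1 - a > a + 1\<close>, which is not linear.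
\<close>

text \<open>The two families of generators have different origins. An element of \<open>I\<close> of
  degree \<open>n\<close> divisible by x is x times a form orthogonal to all multiples of x, and
  these forms are spanned by the \<open>E k\<close>. The \<open>G j\<close> lift the x-free
  monomials; they kill \<Phi> itself and not only x(\<Phi>), which is what lets x be divided out of
  the relation between \<open>G i\<close> and \<open>G (i + 1)\<close>. Exactness concerns arbitrary
  vectors, not only homogeneous ones, so the descent runs on degree bounds. Modulo x it meets two
  different problems: one block sees the syzygies of the monomials of degree \<open>n\<close> in y,
  z; once that block is divisible by x, the other sees the relations between the \<open>E k\<close>,
  which are governed by the ideal generated by the n-th powers of y and z. Congruence modulo x is
  always written as divisibility by x. In the converse the Koszul cycle has its boundary in degree
  \<open>2 * n - a\<close>, which exceeds \<open>a\<close> because \<open>a < n\<close>. This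
  inequality removes the constant terms from the coefficients, and linearity of the second map then
  removes those of the syzygy coefficients.\<close>

text \<open>The order on the variables only serves to make the polynomial ring an instance of \<open>idom\<close>.\<close>

instantiation var :: linorder
begin

primrec var_rank :: "var \<Rightarrow> nat" where
  "var_rank X = 0" | "var_rank Y = 1" | "var_rank Z = 2"

definition less_eq_var :: "var \<Rightarrow> var \<Rightarrow> bool" where
  "u \<le> v \<longleftrightarrow> var_rank u \<le> var_rank v"

definition less_var :: "var \<Rightarrow> var \<Rightarrow> bool" where
  "u < v \<longleftrightarrow> var_rank u < var_rank v"

instance
proof
  fix u v :: var
  show "u \<le> v \<Longrightarrow> v \<le> u \<Longrightarrow> u = v"
    by (cases u; cases v) (simp_all add: less_eq_var_def)
qed (auto simp: less_eq_var_def less_var_def)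

end

abbreviation coef :: "('a \<Rightarrow>\<^sub>0 'b::zero) \<Rightarrow> 'a \<Rightarrow> 'b" where
  "coef \<equiv> Poly_Mapping.lookup"

abbreviation mono_poly :: "mono \<Rightarrow> 'k::comm_ring_1 poly3" where
  "mono_poly m \<equiv> Poly_Mapping.single m 1"

abbreviation px :: "'k::comm_ring_1 poly3" where "px \<equiv> pvar X"
abbreviation py :: "'k::comm_ring_1 poly3" where "py \<equiv> pvar Y"
abbreviation pz :: "'k::comm_ring_1 poly3" where "pz \<equiv> pvar Z"

subsection \<open>Monomials\<close>

lemma mono_eqI:
  assumes "coef m X = coef m' X" "coef m Y = coef m' Y" "coef m Z = coef m' Z"
  shows "m = (m' :: mono)"
proof (rule poly_mapping_eqI)
  fix v show "coef m v = coef m' v" using assms by (cases v) auto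
qed

lemma coef_mon [simp]:
  "coef (mon a b c) X = a" "coef (mon a b c) Y = b" "coef (mon a b c) Z = c"
  by (simp_all add: mon_def lookup_add lookup_single)

lemma mon_coef [simp]: "mon (coef m X) (coef m Y) (coef m Z) = m"
  by (rule mono_eqI) auto

lemma mon_eq_iff [simp]: "mon a b c = mon a' b' c' \<longleftrightarrow> a = a' \<and> b = b' \<and> c = c'"
  by (metis coef_mon)

lemma mon_add: "mon a b c + mon a' b' c' = mon (a + a') (b + b') (c + c')"
  by (rule mono_eqI) (simp_all add: lookup_add)

lemma single_eq_mon:
  "Poly_Mapping.single X i = mon i 0 0" "Poly_Mapping.single Y i = mon 0 i 0"
  "Poly_Mapping.single Z i = mon 0 0 i"
  by (rule mono_eqI; simp add: lookup_single)+

lemma mdeg_add: "mdeg (m + m') = mdeg m + mdeg m'"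
  by (simp add: mdeg_def lookup_add)

lemma mdeg_mon [simp]: "mdeg (mon a b c) = a + b + c"
  by (simp add: mdeg_def)

lemma mdeg_single [simp]: "mdeg (Poly_Mapping.single v i) = i"
  by (cases v) (simp_all add: single_eq_mon)

lemma mdeg_zero [simp]: "mdeg 0 = 0"
  by (simp add: mdeg_def)

lemma mdeg_eq_0_iff: "mdeg m = 0 \<longleftrightarrow> m = 0"
  by (auto simp: mdeg_def intro: mono_eqI)

lemma mono_minus_single:
  assumes "i \<le> coef m v"
  shows "Poly_Mapping.single v i + (m - Poly_Mapping.single v i) = (m :: mono)"
  by (rule poly_mapping_eqI) (use assms in \<open>auto simp: lookup_add lookup_minus lookup_single when_def\<close>)

subsection \<open>Coefficients of products with monomials\<close>

lemma coef_single_mult: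
  fixes f :: "'k::comm_ring_1 poly3"
  shows "coef (Poly_Mapping.single t c * f) m = (\<Sum>q\<in>Poly_Mapping.keys f. c * coef f q when m = t + q)"
proof -
  have "coef (Poly_Mapping.single t c * f) m
      = (\<Sum>l. coef (Poly_Mapping.single t c) l * (\<Sum>q. coef f q when m = l + q))"
    by (simp add: lookup_mult)
  also have "\<dots> = (\<Sum>l. (c * (\<Sum>q. coef f q when m = l + q)) when l = t)"
    by (rule Sum_any.cong) (auto simp: lookup_single when_def)
  also have "\<dots> = c * (\<Sum>q. coef f q when m = t + q)" by simp
  also have "(\<Sum>q. coef f q when m = t + q) = (\<Sum>q\<in>Poly_Mapping.keys f. coef f q when m = t + q)"
    by (rule Sum_any.expand_superset) (auto simp: in_keys_iff when_def split: if_splits)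
  finally show ?thesis by (simp add: sum_distrib_left mult_when)
qed

lemma coef_single_mult_add [simp]:
  fixes f :: "'k::comm_ring_1 poly3"
  shows "coef (Poly_Mapping.single t c * f) (t + m) = c * coef f m"
proof -
  have "coef (Poly_Mapping.single t c * f) (t + m)
      = (\<Sum>q\<in>Poly_Mapping.keys f. if q = m then c * coef f q else 0)"
    unfolding coef_single_mult by (rule sum.cong) (auto simp: when_def)
  then show ?thesis by (auto simp: in_keys_iff)
qed

lemma coef_single_mult_eq_0:
  fixes f :: "'k::comm_ring_1 poly3"
  assumes "coef m v < coef t v"
  shows "coef (Poly_Mapping.single t c * f) m = 0"
  unfolding coef_single_mult
  by (rule sum.neutral) (use assms in \<open>auto simp: when_def lookup_add\<close>)

lemma pvar_power: "pvar v ^ i = (mono_poly (Poly_Mapping.single v i) :: 'k::comm_ring_1 poly3)"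
proof (induction i)
  case (Suc i)
  have "pvar v ^ Suc i = mono_poly (Poly_Mapping.single v 1) * (mono_poly (Poly_Mapping.single v i) :: 'k poly3)"
    using Suc by (simp add: pvar_def)
  also have "\<dots> = mono_poly (Poly_Mapping.single v 1 + Poly_Mapping.single v i)"
    by (simp add: mult_single)
  also have "\<dots> = mono_poly (Poly_Mapping.single v (Suc i))"
    by (simp add: single_add [symmetric])
  finally show ?case .
qed simp

lemma pvar_eq: "pvar v = (mono_poly (Poly_Mapping.single v 1) :: 'k::comm_ring_1 poly3)"
  by (simp add: pvar_def)

lemma mono_poly_mon: "(mono_poly (mon a b c) :: 'k::comm_ring_1 poly3) = px ^ a * py ^ b * pz ^ c"
  by (simp add: pvar_power mult_single mon_def)

lemma pvar_nonzero [simp]: "pvar v \<noteq> (0 :: 'k::field poly3)"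
  by (metis pvar_def lookup_single_eq lookup_zero one_neq_zero)

lemma coef_pconst_mult [simp]:
  fixes f :: "'k::comm_ring_1 poly3"
  shows "coef (pconst c * f) m = c * coef f m"
  using coef_single_mult_add [of 0 c f m] by (simp add: pconst_def)

lemma pconst_simps [simp]:
  "pconst 0 = 0" "pconst 1 = 1" "pconst (- c) = - pconst c"
  "pconst (c + d) = pconst c + pconst d" "pconst (c - d) = pconst c - pconst d"
  "pconst (c * d) = pconst c * pconst d"
  by (simp_all add: pconst_def single_add single_diff single_uminus mult_single)

section \<open>Division by monomials, and congruence modulo a variable\<close>

text \<open>Quotient by the monomial \<open>t\<close> that discards the terms not divisible by
  \<open>t\<close>. It is total, and it keeps degree bounds and homogeneity under control where a
  quotient obtained from \<open>dvd\<close> alone would not.\<close>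

definition mquo :: "mono \<Rightarrow> 'k::comm_ring_1 poly3 \<Rightarrow> 'k poly3" where
  "mquo t f = Poly_Mapping.map_key ((+) t) f"

lemma coef_mquo [simp]: "coef (mquo t f) m = coef f (t + m)"
  by (simp add: mquo_def map_key.rep_eq)

lemma coef_pvar_power_mult_mquo:
  fixes f :: "'k::comm_ring_1 poly3"
  shows "coef (pvar v ^ i * mquo (Poly_Mapping.single v i) f) m = (if i \<le> coef m v then coef f m else 0)"
proof (cases "i \<le> coef m v")
  case True
  then show ?thesis
    by (metis coef_single_mult_add coef_mquo mono_minus_single mult_1 pvar_power)
next
  case False
  then show ?thesis by (simp add: pvar_power coef_single_mult_eq_0 [of m v])
qed

lemma pvar_power_dvd_iff:
  fixes f :: "'k::comm_ring_1 poly3"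
  shows "pvar v ^ i dvd f \<longleftrightarrow> (\<forall>m. coef m v < i \<longrightarrow> coef f m = 0)"
proof
  assume "pvar v ^ i dvd f"
  then obtain g where "f = pvar v ^ i * g" by blast
  then show "\<forall>m. coef m v < i \<longrightarrow> coef f m = 0"
    by (auto simp: pvar_power intro: coef_single_mult_eq_0 [of _ v])
next
  assume a: "\<forall>m. coef m v < i \<longrightarrow> coef f m = 0"
  have "f = pvar v ^ i * mquo (Poly_Mapping.single v i) f"
    by (rule poly_mapping_eqI) (use a in \<open>auto simp: coef_pvar_power_mult_mquo\<close>)
  then show "pvar v ^ i dvd f" by (metis dvd_triv_left)
qed

lemma pvar_dvd_iff:
  fixes f :: "'k::comm_ring_1 poly3"
  shows "pvar v dvd f \<longleftrightarrow> (\<forall>m. coef m v = 0 \<longrightarrow> coef f m = 0)"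
  using pvar_power_dvd_iff [of v 1 f] by simp

lemma pvar_dvd_mono_mult_cancel:
  fixes f :: "'k::comm_ring_1 poly3"
  assumes "pvar u dvd mono_poly t * f" "coef t u = 0"
  shows "pvar u dvd f"
  unfolding pvar_dvd_iff
proof (intro allI impI)
  fix m :: mono assume "coef m u = 0"
  then have "coef (mono_poly t * f) (t + m) = 0"
    using assms by (simp add: pvar_dvd_iff lookup_add del: coef_single_mult_add)
  then show "coef f m = 0" by simp
qed

lemma pvar_dvd_power_mult_cancel:
  fixes f :: "'k::comm_ring_1 poly3"
  assumes "pvar u dvd pvar v ^ i * f" "u \<noteq> v"
  shows "pvar u dvd f"
  by (rule pvar_dvd_mono_mult_cancel [of u "Poly_Mapping.single v i"])
    (use assms in \<open>simp_all add: pvar_power lookup_single\<close>)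

text \<open>Powers of two distinct variables are coprime modulo x. At a monomial \<open>m\<close>
  whose exponent of \<open>u\<close> is below \<open>i\<close>, compare coefficients at
  \<open>m\<close> times the j-th power of \<open>v\<close>: the first summand contributes nothing
  there. The quotient is the explicit \<open>mquo\<close>, so that degree bounds carry over.\<close>

lemma pvar_dvd_coprime:
  fixes p q :: "'k::comm_ring_1 poly3"
  assumes "px dvd pvar u ^ i * p + pvar v ^ j * q" "v \<noteq> X" "u \<noteq> v"
  shows "px dvd q - pvar u ^ i * mquo (Poly_Mapping.single u i) q"
  unfolding pvar_dvd_iff
proof (intro allI impI)
  fix m :: mono assume m: "coef m X = 0"
  show "coef (q - pvar u ^ i * mquo (Poly_Mapping.single u i) q) m = 0"
  proof (cases "i \<le> coef m u")
    case False
    let ?m = "Poly_Mapping.single v j + m"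
    have "coef (pvar u ^ i * p + pvar v ^ j * q) ?m = 0"
      using assms m by (simp add: pvar_dvd_iff lookup_add lookup_single)
    moreover have "coef (pvar u ^ i * p) ?m = 0"
      unfolding pvar_power using False assms
      by (intro coef_single_mult_eq_0 [of _ u]) (simp add: lookup_add lookup_single)
    moreover have "coef (pvar v ^ j * q) ?m = coef q m"
      by (simp add: pvar_power)
    ultimately show ?thesis
      using False by (simp add: lookup_add lookup_minus coef_pvar_power_mult_mquo)
  qed (simp add: lookup_minus coef_pvar_power_mult_mquo)
qed

subsection \<open>Degree bounds\<close>

text \<open>The bound is an integer, so that polynomials of negative degree vanish and no case distinctions
  arise when degrees are shifted.\<close>

definition dle :: "'k::comm_ring_1 poly3 \<Rightarrow> int \<Rightarrow> bool" where
  "dle f e \<longleftrightarrow> (\<forall>m\<in>Poly_Mapping.keys f. int (mdeg m) \<le> e)"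

lemma dle_zero [simp]: "dle 0 e"
  by (simp add: dle_def)

lemma dle_neg: "dle f e \<Longrightarrow> e < 0 \<Longrightarrow> f = 0"
  by (metis dle_def equals0I keys_eq_empty of_nat_less_0_iff order_le_less_trans)

lemma dle_mono: "dle f e \<Longrightarrow> e \<le> e' \<Longrightarrow> dle f e'"
  by (force simp: dle_def)

lemma dle_add: "dle f e \<Longrightarrow> dle g e \<Longrightarrow> dle (f + g) e"
  using keys_add [of f g] by (auto simp: dle_def)

lemma dle_uminus: "dle f e \<Longrightarrow> dle (- f) e"
  by (simp add: dle_def in_keys_iff)

lemma dle_diff: "dle f e \<Longrightarrow> dle g e \<Longrightarrow> dle (f - g) e"
  using dle_add [of f e "- g"] dle_uminus [of g e] by simp

lemma dle_sum: "(\<And>i. i \<in> S \<Longrightarrow> dle (f i) e) \<Longrightarrow> dle (sum f S) e"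
  by (induction S rule: infinite_finite_induct) (auto intro: dle_add)

lemma dle_mult: "dle f a \<Longrightarrow> dle g b \<Longrightarrow> a + b \<le> e \<Longrightarrow> dle (f * g) e"
  using keys_mult [of f g] by (force simp: dle_def mdeg_add)

lemma dle_pconst_mult: "dle f e \<Longrightarrow> dle (pconst c * f) e"
  by (auto simp: dle_def in_keys_iff)

lemma dle_single: "int (mdeg m) \<le> e \<Longrightarrow> dle (Poly_Mapping.single m c) e"
  by (auto simp: dle_def)

lemma dle_pvar_mult: "dle f (e - 1) \<Longrightarrow> dle (pvar v * f) e"
  by (rule dle_mult [of _ 1 _ "e - 1"]) (auto simp: pvar_def intro: dle_single)

lemma dle_pvar_power: "dle (pvar v ^ i) (int i)"
  by (auto simp: pvar_power intro: dle_single)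

lemma dle_mquo: "dle f e \<Longrightarrow> e - int (mdeg t) \<le> e' \<Longrightarrow> dle (mquo t f) e'"
  by (force simp: dle_def in_keys_iff mdeg_add)

lemma dle_exists: "\<exists>e::nat. dle f (int e)"
proof
  show "dle f (int (\<Sum>m\<in>Poly_Mapping.keys f. mdeg m))"
    unfolding dle_def by (auto intro: member_le_sum)
qed

lemma dle_exists_finite:
  assumes "finite S"
  shows "\<exists>e::nat. \<forall>i\<in>S. dle (f i) (int e)"
  using assms
proof (induction S)
  case (insert i S)
  then obtain e where e: "\<forall>i\<in>S. dle (f i) (int e)" by blast
  obtain e' where e': "dle (f i) (int e')" using dle_exists by blast
  show ?case
  proof (intro exI ballI)
    fix j assume "j \<in> insert i S"
    then show "dle (f j) (int (max e e'))"
      using e e' by (auto intro: dle_mono)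
  qed
qed simp

lemma dle_pvar_mult_iff:
  fixes f :: "'k::comm_ring_1 poly3"
  shows "dle (pvar v * f) e \<longleftrightarrow> dle f (e - 1)"
proof
  assume "dle (pvar v * f) e"
  moreover have "f = mquo (Poly_Mapping.single v 1) (pvar v * f)"
    by (rule poly_mapping_eqI) (simp add: pvar_def)
  ultimately show "dle f (e - 1)"
    using dle_mquo [of "pvar v * f" e "Poly_Mapping.single v 1" "e - 1"] by simp
qed (rule dle_pvar_mult)

subsection \<open>Homogeneous polynomials\<close>

lemma homog_zero [simp]: "homog 0 e"
  by (simp add: homog_def)

lemma homog_coef: "homog f e \<Longrightarrow> int (mdeg m) \<noteq> e \<Longrightarrow> coef f m = 0"
  by (auto simp: homog_def in_keys_iff)

lemma homog_add: "homog f e \<Longrightarrow> homog g e \<Longrightarrow> homog (f + g) e"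
  using keys_add [of f g] by (auto simp: homog_def)

lemma homog_uminus: "homog f e \<Longrightarrow> homog (- f) e"
  by (simp add: homog_def in_keys_iff)

lemma homog_diff: "homog f e \<Longrightarrow> homog g e \<Longrightarrow> homog (f - g) e"
  using homog_add [of f e "- g"] homog_uminus [of g e] by simp

lemma homog_sum: "(\<And>i. i \<in> S \<Longrightarrow> homog (f i) e) \<Longrightarrow> homog (sum f S) e"
  by (induction S rule: infinite_finite_induct) (auto intro: homog_add)

lemma homog_mult: "homog f a \<Longrightarrow> homog g b \<Longrightarrow> e = a + b \<Longrightarrow> homog (f * g) e"
  using keys_mult [of f g] by (force simp: homog_def mdeg_add)

lemma homog_pconst_mult: "homog f e \<Longrightarrow> homog (pconst c * f) e"
  by (auto simp: homog_def in_keys_iff)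

lemma homog_single: "e = int (mdeg m) \<Longrightarrow> homog (Poly_Mapping.single m c) e"
  by (auto simp: homog_def)

lemma homog_pvar: "homog (pvar v) 1"
  by (auto simp: pvar_def intro: homog_single)

lemma homog_pvar_mult: "homog f (e - 1) \<Longrightarrow> homog (pvar v * f) e"
  by (rule homog_mult [OF homog_pvar]) auto

lemma homog_mquo: "homog f e \<Longrightarrow> e' = e - int (mdeg t) \<Longrightarrow> homog (mquo t f) e'"
  by (force simp: homog_def in_keys_iff mdeg_add)

lemma homog_in_max_ideal: "homog f e \<Longrightarrow> e > 0 \<Longrightarrow> in_max_ideal f"
  unfolding in_max_ideal_def by (rule homog_coef) auto

subsection \<open>Syzygies modulo x\<close>

lemma pvar_dvd_quo:
  fixes f :: "'k::comm_ring_1 poly3"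
  assumes "pvar v dvd f" "dle f e"
  obtains g where "f = pvar v * g" "dle g (e - 1)"
  using assms by (auto elim!: dvdE simp: dle_pvar_mult_iff)

text \<open>Hilbert--Burch for \<open>(y,z)\<^sup>n\<close>, modulo \<open>x\<close>.\<close>

lemma syz_monomials:
  fixes v :: "nat \<Rightarrow> 'k::comm_ring_1 poly3"
  assumes "\<And>j. j \<le> n \<Longrightarrow> dle (v j) e"
    and "px dvd (\<Sum>j\<le>n. v j * (py ^ (n - j) * pz ^ j))"
  shows "\<exists>a. (\<forall>i<n. dle (a i) (e - 1)) \<and>
    (\<forall>j\<le>n. px dvd v j - ((if j = 0 then 0 else py * a (j - 1)) - (if j = n then 0 else pz * a j)))"
  using assms
proof (induction n arbitrary: v)
  case (Suc n)
  \<comment> \<open>Modulo x the last coefficient is divisible by y, and \<open>?b\<close> becomes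
    the last multiplier. Subtracting \<open>?b\<close> times the last Hilbert-Burch column clears
    that coefficient and adds \<open>pz * ?b\<close> to the one before; what remains has a common
    factor y, which can be cancelled modulo x.\<close>
  let ?b = "mquo (Poly_Mapping.single Y 1) (v (Suc n))"
  let ?s = "\<lambda>v. \<Sum>j\<le>n. v j * (py ^ (n - j) * pz ^ j)"
  let ?v = "v(n := v n + pz * ?b)"
  have "(\<Sum>j\<le>Suc n. v j * (py ^ (Suc n - j) * pz ^ j)) = py ^ 1 * ?s v + pz ^ Suc n * v (Suc n)"
    by (auto simp: sum_distrib_left Suc_diff_le algebra_simps intro!: sum.cong)
  with Suc.prems(2) have tot: "px dvd py ^ 1 * ?s v + pz ^ Suc n * v (Suc n)" by (simp only:)
  then have dv: "px dvd v (Suc n) - py * ?b"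
    using pvar_dvd_coprime [OF tot] by simp
  have db: "dle ?b (e - 1)"
    by (rule dle_mquo [of _ e]) (use Suc.prems(1) in auto)
  have sv: "?s ?v = ?s v + pz * ?b * pz ^ n"
  proof -
    have "?s ?v = (\<Sum>j\<le>n. v j * (py ^ (n - j) * pz ^ j) + (if j = n then pz * ?b * pz ^ n else 0))"
      by (rule sum.cong) (auto simp: algebra_simps)
    then show ?thesis by (simp add: sum.distrib)
  qed
  have "py ^ 1 * ?s ?v = (py ^ 1 * ?s v + pz ^ Suc n * v (Suc n)) - pz ^ Suc n * (v (Suc n) - py * ?b)"
    unfolding sv by (simp add: algebra_simps)
  then have "px dvd py ^ 1 * ?s ?v"
    by (simp only:) (intro dvd_diff tot dvd_mult dv)
  then have "px dvd ?s ?v" by (rule pvar_dvd_power_mult_cancel) simp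
  moreover have "dle (?v j) e" if "j \<le> n" for j
    using that Suc.prems(1) db by (auto intro!: dle_add dle_pvar_mult)
  ultimately obtain a where a: "\<And>i. i < n \<Longrightarrow> dle (a i) (e - 1)"
    "\<And>j. j \<le> n \<Longrightarrow> px dvd ?v j - ((if j = 0 then 0 else py * a (j - 1)) - (if j = n then 0 else pz * a j))"
    using Suc.IH [of ?v] by blast
  show ?case
  proof (intro exI [of _ "a(n := ?b)"] conjI allI impI)
    fix i assume "i < Suc n"
    then show "dle ((a(n := ?b)) i) (e - 1)" using a(1) db by auto
  next
    fix j assume j: "j \<le> Suc n"
    consider "j = Suc n" | "j = n" | "j < n" using j by linarith
    then show "px dvd v j - ((if j = 0 then 0 else py * (a(n := ?b)) (j - 1))
        - (if j = Suc n then 0 else pz * (a(n := ?b)) j))"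
    proof cases
      case 1 then show ?thesis using dv by simp
    next
      case 2 then show ?thesis using a(2) [of n] by (auto simp: algebra_simps)
    next
      case 3 then show ?thesis using a(2) [of j] by auto
    qed
  qed
qed auto

text \<open>The module generated over \<open>k[y,z]\<close> by the duals of the monomials \<open>y\<^bsup>n-1-k\<^esup> z\<^bsup>k\<^esup>\<close> is isomorphic to
  \<open>(y,z)\<^bsup>n-1\<^esup> / (y\<^bsup>n\<^esup>, z\<^bsup>n\<^esup>)\<close>, which reduces its relations to those of the previous lemma.\<close>

lemma syz_dual_monomials:
  fixes v :: "nat \<Rightarrow> 'k::comm_ring_1 poly3"
  assumes n: "n \<ge> 1" and dv: "\<And>k. k < n \<Longrightarrow> dle (v k) e"
    and V: "\<And>m. \<lbrakk>coef m X = 0; coef m Y < n; coef m Z < n\<rbrakk> \<Longrightarrow>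
      coef (\<Sum>k<n. v k * (py ^ k * pz ^ (n - 1 - k))) m = 0"
  shows "\<exists>c. (\<forall>k\<le>n. dle (c k) (e - 1)) \<and> (\<forall>k<n. px dvd v k - (pz * c k - py * c (Suc k)))"
proof -
  define V where "V = (\<Sum>k<n. v k * (py ^ k * pz ^ (n - 1 - k)))"
  \<comment> \<open>Hypothesis \<open>V\<close> says that this sum lies in the ideal of x and the
    n-th powers of y and z. \<open>P\<close> collects the terms divisible by the power of z, and
    \<open>Q\<close> those among the remaining ones divisible by the power of y.\<close>
  define P where "P = mquo (Poly_Mapping.single Z n) V"
  define W where "W = V - pz ^ n * P"
  define Q where "Q = mquo (Poly_Mapping.single Y n) W"
  obtain l where l: "n = Suc l" using n by (cases n) auto
  have dV: "dle V (e + int n - 1)"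
    unfolding V_def
  proof (rule dle_sum)
    fix k assume "k \<in> {..<n}"
    then have "dle (v k) e" "int k + int (n - 1 - k) = int n - 1" by (auto intro: dv)
    then show "dle (v k * (py ^ k * pz ^ (n - 1 - k))) (e + int n - 1)"
      by (intro dle_mult [of _ e _ "int n - 1"] dle_mult [OF dle_pvar_power dle_pvar_power]) auto
  qed
  have dP: "dle P (e - 1)"
    unfolding P_def by (rule dle_mquo [OF dV]) simp
  have "dle W (e + int n - 1)"
    unfolding W_def by (intro dle_diff dV dle_mult [OF dle_pvar_power dP]) auto
  then have dQ: "dle Q (e - 1)"
    unfolding Q_def by (rule dle_mquo) simp
  have cW: "coef W m = (if coef m Z < n then coef V m else 0)" for m
    unfolding W_def P_def by (simp add: lookup_minus coef_pvar_power_mult_mquo)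
  have VPQ: "px dvd V - pz ^ n * P - py ^ n * Q"
    unfolding pvar_dvd_iff
  proof (intro allI impI)
    fix m :: mono assume m: "coef m X = 0"
    have "coef (V - pz ^ n * P - py ^ n * Q) m = coef W m - (if n \<le> coef m Y then coef W m else 0)"
      by (simp add: W_def [symmetric] Q_def lookup_minus coef_pvar_power_mult_mquo)
    also have "\<dots> = 0"
      using V [of m] m by (auto simp: cW V_def)
    finally show "coef (V - pz ^ n * P - py ^ n * Q) m = 0" .
  qed
  \<comment> \<open>The two correction terms are absorbed into the coefficients of the pure powers
    of z and y of degree \<open>l\<close>. The index is reversed because \<open>v k\<close> stands
    at the monomial with y-exponent \<open>k\<close>.\<close>
  define u where "u j = v (l - j) - (if j = l then pz * P else 0) - (if j = 0 then py * Q else 0)" for j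
  have "(\<Sum>j\<le>l. u j * (py ^ (l - j) * pz ^ j))
      = (\<Sum>j\<le>l. v (l - j) * (py ^ (l - j) * pz ^ j) - (if j = l then pz * P * pz ^ l else 0)
          - (if j = 0 then py * Q * py ^ l else 0))"
    by (rule sum.cong) (auto simp: u_def algebra_simps)
  also have "\<dots> = (\<Sum>j\<le>l. v (l - j) * (py ^ (l - j) * pz ^ j)) - pz ^ n * P - py ^ n * Q"
    by (simp add: sum_subtractf l)
  also have "(\<Sum>j\<le>l. v (l - j) * (py ^ (l - j) * pz ^ j)) = V"
    unfolding V_def l
    by (rule sum.reindex_bij_witness [of _ "\<lambda>j. l - j" "\<lambda>j. l - j"]) auto
  finally have "px dvd (\<Sum>j\<le>l. u j * (py ^ (l - j) * pz ^ j))" using VPQ by simp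
  moreover have "dle (u j) e" if "j \<le> l" for j
    unfolding u_def using dv dP dQ that l by (auto intro!: dle_diff dle_pvar_mult)
  ultimately obtain a where a: "\<And>i. i < l \<Longrightarrow> dle (a i) (e - 1)"
    "\<And>j. j \<le> l \<Longrightarrow> px dvd u j - ((if j = 0 then 0 else py * a (j - 1)) - (if j = l then 0 else pz * a j))"
    using syz_monomials [of l u e] by blast
  \<comment> \<open>The \<open>l\<close> Hilbert-Burch multipliers, with reversed index, are
    completed by \<open>P\<close> and \<open>- Q\<close> at the ends, which gives
    \<open>n + 1\<close> of them.\<close>
  define c where "c k = (if k = 0 then P else if k = n then - Q else - a (l - k))" for k
  show ?thesis
  proof (intro exI [of _ c] conjI allI impI)
    fix k assume "k \<le> n"
    then show "dle (c k) (e - 1)"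
      unfolding c_def using dP dQ a(1) [of "l - k"] l by (auto intro: dle_uminus)
  next
    fix k assume k: "k < n"
    have "v k - (pz * c k - py * c (Suc k))
        = u (l - k) - ((if l - k = 0 then 0 else py * a (l - k - 1)) - (if l - k = l then 0 else pz * a (l - k)))"
      using k l by (auto simp: u_def c_def algebra_simps)
    then show "px dvd v k - (pz * c k - py * c (Suc k))"
      using a(2) [of "l - k"] k l by simp
  qed
qed

subsection \<open>Evaluating functionals on polynomials\<close>

definition ev :: "(mono \<Rightarrow> 'k::comm_ring_1) \<Rightarrow> 'k poly3 \<Rightarrow> 'k" where
  "ev w f = (\<Sum>m\<in>Poly_Mapping.keys f. coef f m * w m)"

lemma ev_superset:
  assumes "finite S" "Poly_Mapping.keys f \<subseteq> S"
  shows "ev w f = (\<Sum>m\<in>S. coef f m * w m)"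
  unfolding ev_def using assms by (intro sum.mono_neutral_left) (auto simp: in_keys_iff)

lemma ev_zero [simp]: "ev w 0 = 0"
  by (simp add: ev_def)

lemma ev_add: "ev w (f + g) = ev w f + ev w g"
proof -
  let ?S = "Poly_Mapping.keys f \<union> Poly_Mapping.keys g"
  have "ev w (f + g) = (\<Sum>m\<in>?S. coef (f + g) m * w m)"
    by (rule ev_superset) (auto dest: subsetD [OF keys_add])
  also have "\<dots> = (\<Sum>m\<in>?S. coef f m * w m) + (\<Sum>m\<in>?S. coef g m * w m)"
    by (simp add: lookup_add distrib_right sum.distrib)
  also have "\<dots> = ev w f + ev w g"
    using ev_superset [of ?S f w] ev_superset [of ?S g w] by simp
  finally show ?thesis .
qed

lemma ev_uminus: "ev w (- f) = - ev w f"
  using ev_add [of w f "- f"] by (simp add: eq_neg_iff_add_eq_0 add.commute)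

lemma ev_diff: "ev w (f - g) = ev w f - ev w g"
  using ev_add [of w f "- g"] by (simp add: ev_uminus)

lemma ev_sum: "ev w (sum f S) = (\<Sum>i\<in>S. ev w (f i))"
  by (induction S rule: infinite_finite_induct) (auto simp: ev_add)

lemma ev_pconst_mult: "ev w (pconst c * f) = c * ev w f"
proof -
  have "ev w (pconst c * f) = (\<Sum>m\<in>Poly_Mapping.keys f. coef (pconst c * f) m * w m)"
    by (rule ev_superset) (auto simp: in_keys_iff)
  then show ?thesis by (simp add: ev_def sum_distrib_left mult.assoc)
qed

lemma ev_mono_poly [simp]: "ev w (mono_poly m) = w m"
  by (simp add: ev_def)

lemma poly_as_sum:
  fixes f :: "'k::comm_ring_1 poly3"
  shows "f = (\<Sum>m\<in>Poly_Mapping.keys f. pconst (coef f m) * mono_poly m)"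
proof (rule poly_mapping_eqI)
  fix m
  have "coef (\<Sum>m\<in>Poly_Mapping.keys f. pconst (coef f m) * mono_poly m) m
      = (\<Sum>m'\<in>Poly_Mapping.keys f. if m' = m then coef f m' else 0)"
    by (simp add: lookup_sum lookup_single when_def if_distrib [of "\<lambda>x. _ * x"] cong: if_cong)
  also have "\<dots> = coef f m" by (simp add: in_keys_iff)
  finally show "coef f m = coef (\<Sum>m\<in>Poly_Mapping.keys f. pconst (coef f m) * mono_poly m) m" by simp
qed

lemma ev_mult_sum: "ev w (f * g) = (\<Sum>m\<in>Poly_Mapping.keys g. coef g m * ev w (f * mono_poly m))"
proof -
  have "ev w (f * g) = ev w (f * (\<Sum>m\<in>Poly_Mapping.keys g. pconst (coef g m) * mono_poly m))"
    by (subst poly_as_sum [of g]) simp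
  also have "\<dots> = ev w (\<Sum>m\<in>Poly_Mapping.keys g. pconst (coef g m) * (f * mono_poly m))"
    by (simp add: sum_distrib_left algebra_simps)
  finally show ?thesis by (simp add: ev_sum ev_pconst_mult)
qed

lemma ev_mult_eq_0:
  assumes "\<And>m. m \<in> Poly_Mapping.keys g \<Longrightarrow> ev w (f * mono_poly m) = 0"
  shows "ev w (f * g) = 0"
  by (subst ev_mult_sum) (simp add: assms)

lemma ev_degree:
  assumes "in_D d w" "\<And>m. m \<in> Poly_Mapping.keys f \<Longrightarrow> mdeg m \<noteq> d"
  shows "ev w f = 0"
  using assms by (simp add: ev_def in_D_def)

lemma ev_homog_eq_0:
  assumes "in_D d w" "homog f e" "e \<noteq> int d"
  shows "ev w f = 0"
  by (rule ev_degree [OF assms(1)]) (use assms in \<open>auto simp: homog_def\<close>)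

lemma contract_eq_ev: "contract u w m = ev w (mono_poly m * u)"
proof -
  have "ev w (mono_poly m * u) = (\<Sum>m'\<in>Poly_Mapping.keys u. coef u m' * w (m + m'))"
    by (subst ev_mult_sum) (simp add: mult_single)
  then show ?thesis by (simp add: contract_def)
qed

lemma ev_contract: "ev (contract u w) f = ev w (u * f)"
  by (subst ev_mult_sum) (simp add: ev_def [of "contract u w"] contract_eq_ev mult.commute)

lemma ann_iff: "f \<in> ann w \<longleftrightarrow> (\<forall>g. ev w (f * g) = 0)"
proof -
  have "f \<in> ann w \<longleftrightarrow> (\<forall>m. ev w (f * mono_poly m) = 0)"
    by (simp add: ann_def fun_eq_iff contract_eq_ev mult.commute)
  then show ?thesis by (metis ev_mult_eq_0)
qed

text \<open>The annihilator is the radical of the symmetric bilinear form sending \<open>f\<close>,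
  \<open>g\<close> to \<open>ev w (u * f * g)\<close>; all later arguments about the ideal are in
  these terms.\<close>

lemma ann_contract_iff: "f \<in> ann (contract u w) \<longleftrightarrow> (\<forall>g. ev w (u * f * g) = 0)"
  by (simp add: ann_iff ev_contract mult.assoc)

lemma ann_add: "f \<in> ann w \<Longrightarrow> g \<in> ann w \<Longrightarrow> f + g \<in> ann w"
  by (simp add: ann_iff distrib_right ev_add)

lemma ann_diff: "f \<in> ann w \<Longrightarrow> g \<in> ann w \<Longrightarrow> f - g \<in> ann w"
  by (simp add: ann_iff left_diff_distrib ev_diff)

lemma ann_mult: "f \<in> ann w \<Longrightarrow> f * g \<in> ann w"
  by (simp add: ann_iff mult.assoc)

lemma ann_mult_left: "f \<in> ann w \<Longrightarrow> g * f \<in> ann w"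
  by (metis ann_mult mult.commute)

lemma ann_sum: "(\<And>i. i \<in> S \<Longrightarrow> f i \<in> ann w) \<Longrightarrow> sum f S \<in> ann w"
  by (simp add: ann_iff sum_distrib_right ev_sum)

lemma coef_mono_poly_mult [simp]:
  fixes f :: "'k::comm_ring_1 poly3"
  shows "coef (mono_poly t * f) (t + m) = coef f m" "coef (f * mono_poly t) (t + m) = coef f m"
  by (simp_all add: mult.commute [of f])

lemma coef_pvar_mult_mon:
  fixes f :: "'k::comm_ring_1 poly3"
  shows "coef (px * f) (mon a b c) = (if a = 0 then 0 else coef f (mon (a - 1) b c))"
    and "coef (py * f) (mon a b c) = (if b = 0 then 0 else coef f (mon a (b - 1) c))"
    and "coef (pz * f) (mon a b c) = (if c = 0 then 0 else coef f (mon a b (c - 1)))"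
proof -
  show "coef (px * f) (mon a b c) = (if a = 0 then 0 else coef f (mon (a - 1) b c))"
    using coef_single_mult_add [of "mon 1 0 0" 1 f "mon (a - 1) b c"]
      coef_single_mult_eq_0 [of "mon a b c" X "mon 1 0 0" 1 f]
    by (auto simp: pvar_eq single_eq_mon mon_add simp del: coef_single_mult_add coef_mono_poly_mult)
  show "coef (py * f) (mon a b c) = (if b = 0 then 0 else coef f (mon a (b - 1) c))"
    using coef_single_mult_add [of "mon 0 1 0" 1 f "mon a (b - 1) c"]
      coef_single_mult_eq_0 [of "mon a b c" Y "mon 0 1 0" 1 f]
    by (auto simp: pvar_eq single_eq_mon mon_add simp del: coef_single_mult_add coef_mono_poly_mult)
  show "coef (pz * f) (mon a b c) = (if c = 0 then 0 else coef f (mon a b (c - 1)))"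
    using coef_single_mult_add [of "mon 0 0 1" 1 f "mon a b (c - 1)"]
      coef_single_mult_eq_0 [of "mon a b c" Z "mon 0 0 1" 1 f]
    by (auto simp: pvar_eq single_eq_mon mon_add simp del: coef_single_mult_add coef_mono_poly_mult)
qed

abbreviation yz :: "nat \<Rightarrow> nat \<Rightarrow> mono" where "yz d k \<equiv> mon 0 (d - k) k"

lemma pz_yz: "pz * mono_poly (mon 0 b c) = (mono_poly (mon 0 b (Suc c)) :: 'k::comm_ring_1 poly3)"
  "py * mono_poly (mon 0 b c) = (mono_poly (mon 0 (Suc b) c) :: 'k::comm_ring_1 poly3)"
  by (simp_all add: mono_poly_mon algebra_simps)

subsection \<open>The resolution\<close>

text \<open>What the argument takes from an invertible \<open>p\<close>, stated without matrices:
  the pairing by x(\<Phi>) in degree \<open>n - 1\<close> is nondegenerate, and two families of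
  linear systems over it have the solutions \<open>E\<close> and \<open>h\<close>.\<close>

locale dual_basis =
  fixes n :: nat and \<Phi> :: "mono \<Rightarrow> 'k::field" and h E :: "nat \<Rightarrow> 'k poly3"
  assumes n: "n \<ge> 1" and in_D: "in_D (2 * n - 1) \<Phi>"
    and nondegenerate: "\<lbrakk>homog f (int n - 1);
      \<And>m. mdeg m = n - 1 \<Longrightarrow> ev \<Phi> (px * f * mono_poly m) = 0\<rbrakk> \<Longrightarrow> f = 0"
    and homog_E: "k < n \<Longrightarrow> homog (E k) (int n - 1)"
    and homog_h: "j \<le> n \<Longrightarrow> homog (h j) (int n - 1)"
    and E_dual: "\<lbrakk>k < n; mdeg m = n - 1\<rbrakk> \<Longrightarrow>
      ev \<Phi> (px * E k * mono_poly m) = (if m = yz (n - 1) k then 1 else 0)"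
    and h_dual: "\<lbrakk>j \<le> n; mdeg m = n - 1\<rbrakk> \<Longrightarrow>
      ev \<Phi> (px * h j * mono_poly m) = \<Phi> (yz n j + m)"
begin

definition I :: "'k poly3 set" where
  "I = ann (contract px \<Phi>)"

definition G :: "nat \<Rightarrow> 'k poly3" where
  "G j = mono_poly (yz n j) - px * h j"

lemma I_iff: "f \<in> I \<longleftrightarrow> (\<forall>g. ev \<Phi> (px * f * g) = 0)"
  by (simp add: I_def ann_contract_iff)

lemma ev_homog:
  assumes "homog f d" "d \<noteq> 2 * int n - 1"
  shows "ev \<Phi> f = 0"
  by (rule ev_homog_eq_0 [OF in_D assms(1)]) (use assms n in auto)

text \<open>Since \<Phi> lives in a single degree, only the part of \<open>f\<close> of degree
  \<open>n - 1\<close> contributes, and duality reads off one coefficient of it.\<close>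

lemma ev_E:
  assumes k: "k < n"
  shows "ev \<Phi> (px * E k * f) = coef f (yz (n - 1) k)"
proof -
  have "ev \<Phi> (px * E k * mono_poly m) = (if m = yz (n - 1) k then 1 else 0)" for m
  proof (cases "mdeg m = n - 1")
    case False
    have "homog (px * E k * mono_poly m) (int n + int (mdeg m))"
      by (rule homog_mult [OF homog_pvar_mult [OF homog_E [OF k]] homog_single]) auto
    then have "ev \<Phi> (px * E k * mono_poly m) = 0"
      by (rule ev_homog) (use False n in auto)
    moreover have "m \<noteq> yz (n - 1) k" using False k by auto
    ultimately show ?thesis by simp
  qed (simp add: E_dual [OF k])
  then have "ev \<Phi> (px * E k * f)
      = (\<Sum>m\<in>Poly_Mapping.keys f. if m = yz (n - 1) k then coef f m else 0)"
    by (subst ev_mult_sum) (simp add: if_distrib [of "\<lambda>x. _ * x"] cong: if_cong)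
  then show ?thesis by (auto simp: in_keys_iff)
qed

lemma ev_h:
  assumes j: "j \<le> n"
  shows "ev \<Phi> (px * h j * f) = ev \<Phi> (mono_poly (yz n j) * f)"
proof -
  have "ev \<Phi> (px * h j * mono_poly m) = ev \<Phi> (mono_poly (yz n j) * mono_poly m)" for m
  proof (cases "mdeg m = n - 1")
    case False
    have "homog (px * h j * mono_poly m) (int n + int (mdeg m))"
      by (rule homog_mult [OF homog_pvar_mult [OF homog_h [OF j]] homog_single]) auto
    then have "ev \<Phi> (px * h j * mono_poly m) = 0"
      by (rule ev_homog) (use False n in auto)
    moreover have "ev \<Phi> (mono_poly (yz n j) * mono_poly m) = 0"
      by (rule ev_homog [of _ "int n + int (mdeg m)"])
        (use False n j in \<open>auto simp: mult_single mdeg_add intro!: homog_single\<close>)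
    ultimately show ?thesis by simp
  qed (simp add: h_dual [OF j] mult_single)
  then show ?thesis by (simp add: ev_mult_sum [of \<Phi> _ f])
qed

text \<open>Stronger than membership in \<open>I\<close>: no factor x is present. This is used both
  to read off coordinates in \<open>degree_n_expansion\<close> and to divide a relation by x in
  \<open>h_relation\<close>.\<close>

lemma ev_G: "j \<le> n \<Longrightarrow> ev \<Phi> (G j * f) = 0"
  by (simp add: G_def left_diff_distrib ev_diff ev_h)

lemma G_in_I: "j \<le> n \<Longrightarrow> G j \<in> I"
  unfolding I_iff using ev_G [of j "px * _"] by (simp add: algebra_simps)

text \<open>\<open>E k\<close> pairs nontrivially only with an x-free monomial, so one more factor x
  kills it.\<close>

lemma xE_in_I: "k < n \<Longrightarrow> px * E k \<in> I"
proof -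
  assume k: "k < n"
  have "ev \<Phi> (px * (px * E k) * f) = ev \<Phi> (px * E k * (px * f))" for f
    by (simp add: algebra_simps)
  then show ?thesis
    by (simp add: I_iff ev_E [OF k] coef_pvar_mult_mon)
qed

lemma homog_G: "j \<le> n \<Longrightarrow> homog (G j) (int n)"
  unfolding G_def by (intro homog_diff homog_pvar_mult homog_h homog_single) auto

lemma homog_xE: "k < n \<Longrightarrow> homog (px * E k) (int n)"
  by (intro homog_pvar_mult homog_E)

section \<open>Coordinates in degree \<open>n\<close> and the relations between the
  generators\<close>

text \<open>The x-free coefficients of \<open>\<theta>\<close> are the coordinates at the
  \<open>G j\<close>; as these kill \<Phi>, the values of \<Phi> on \<open>\<theta>\<close> times
  x-free monomials are the coordinates at the \<open>px * E k\<close>. The difference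
  \<open>D\<close> has no x-free term, so \<open>D = px * \<mu>\<close>. Then \<open>\<mu>\<close>
  is orthogonal to x-free monomials by the choice of coordinates and to multiples of x because
  \<open>D\<close> lies in \<open>I\<close>; nondegeneracy gives \<open>\<mu> = 0\<close>.\<close>

lemma degree_n_expansion:
  assumes \<theta>: "\<theta> \<in> I" "homog \<theta> (int n)"
  shows "\<theta> = (\<Sum>k<n. pconst (ev \<Phi> (\<theta> * mono_poly (yz (n - 1) k))) * (px * E k))
    + (\<Sum>j\<le>n. pconst (coef \<theta> (yz n j)) * G j)"
proof -
  define S where "S = (\<Sum>k<n. pconst (ev \<Phi> (\<theta> * mono_poly (yz (n - 1) k))) * (px * E k))"
  define T where "T = (\<Sum>j\<le>n. pconst (coef \<theta> (yz n j)) * G j)"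
  define D where "D = \<theta> - (S + T)"
  have hD: "homog D (int n)"
    unfolding D_def S_def T_def
    by (intro homog_diff homog_add homog_sum homog_pconst_mult \<theta> homog_G homog_xE) auto
  have DI: "D \<in> I"
    unfolding D_def S_def T_def I_def
    using \<theta>(1) G_in_I xE_in_I unfolding I_def
    by (intro ann_diff ann_add ann_sum) (auto intro: ann_mult_left)
  have coefS: "coef S (mon 0 b c) = 0" for b c
    by (simp add: S_def lookup_sum coef_pvar_mult_mon)
  have coefG: "coef (G j) (yz n l) = (if j = l then 1 else 0)" if "l \<le> n" for j l
    by (auto simp: G_def lookup_minus lookup_single coef_pvar_mult_mon when_def)
  have D0: "coef D (yz n l) = 0" if "l \<le> n" for l
  proof -
    have "coef T (yz n l) = (\<Sum>j\<le>n. if j = l then coef \<theta> (yz n j) else 0)"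
      unfolding T_def lookup_sum by (rule sum.cong) (auto simp: coefG that)
    then have "coef T (yz n l) = coef \<theta> (yz n l)" using that by simp
    then show ?thesis by (simp add: D_def lookup_add lookup_minus coefS)
  qed
  have "px dvd D"
    unfolding pvar_dvd_iff
  proof (intro allI impI)
    fix m :: mono assume m: "coef m X = 0"
    show "coef D m = 0"
    proof (cases "mdeg m = n")
      case True
      then have "m = yz n (coef m Z)" "coef m Z \<le> n" using m by (auto simp: mdeg_def intro: mono_eqI)
      then show ?thesis using D0 by metis
    qed (use homog_coef [OF hD] in auto)
  qed
  then obtain \<mu> where \<mu>: "D = px * \<mu>" by blast
  have "\<mu> = mquo (Poly_Mapping.single X 1) D"
    by (rule poly_mapping_eqI) (simp add: \<mu> pvar_eq)
  then have "homog \<mu> (int n - 1)"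
    using homog_mquo [OF hD, of "int n - 1" "Poly_Mapping.single X 1"] by simp
  then have "\<mu> = 0"
  proof (rule nondegenerate)
    fix m assume deg: "mdeg m = n - 1"
    show "ev \<Phi> (px * \<mu> * mono_poly m) = 0"
    proof (cases "coef m X = 0")
      case True
      then obtain l where l: "m = yz (n - 1) l" "l < n"
        using deg n by (intro that [of "coef m Z"] mono_eqI) (auto simp: mdeg_def)
      have "ev \<Phi> (S * mono_poly m)
          = (\<Sum>k<n. ev \<Phi> (\<theta> * mono_poly (yz (n - 1) k)) * ev \<Phi> (px * E k * mono_poly m))"
        by (simp add: S_def sum_distrib_right ev_sum mult.assoc ev_pconst_mult)
      also have "\<dots> = (\<Sum>k<n. if k = l then ev \<Phi> (\<theta> * mono_poly (yz (n - 1) k)) else 0)"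
        by (rule sum.cong) (use l in \<open>auto simp: ev_E lookup_single when_def\<close>)
      also have "\<dots> = ev \<Phi> (\<theta> * mono_poly m)" using l by simp
      finally have "ev \<Phi> (S * mono_poly m) = ev \<Phi> (\<theta> * mono_poly m)" .
      moreover have "ev \<Phi> (T * mono_poly m) = 0"
        by (simp add: T_def sum_distrib_right ev_sum mult.assoc ev_pconst_mult ev_G)
      ultimately have "ev \<Phi> (D * mono_poly m) = 0"
        by (simp add: D_def algebra_simps ev_diff ev_add)
      then show ?thesis using \<mu> by simp
    next
      case False
      then obtain m' where m': "m = Poly_Mapping.single X 1 + m'"
        using mono_minus_single [of 1 m X] by (metis One_nat_def Suc_leI gr0I)
      have "mono_poly m = px * (mono_poly m' :: 'k poly3)" by (simp add: m' pvar_eq mult_single)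
      then have eq: "px * \<mu> * mono_poly m = px * D * mono_poly m'"
        by (simp add: \<mu> mult_ac)
      show ?thesis using DI unfolding eq I_iff by blast
    qed
  qed
  then show ?thesis using \<mu> by (simp add: D_def S_def T_def)
qed

text \<open>\<open>hc\<close>, \<open>hh\<close> and \<open>EE\<close> are the entries of \<open>B\<^sub>0\<close>, \<open>r\<^sup>T p\<^sup>-\<^sup>1 r\<close> and \<open>Q\<close>; \<open>\<alpha>\<close>, \<open>\<beta>\<close> and \<open>\<delta>\<close> below are those of
  \<open>A'\<close>, \<open>B\<^sub>1\<close> and \<open>D\<^sub>0 - D\<^sub>0\<^sup>T\<close>.\<close>

definition hc :: "nat \<Rightarrow> nat \<Rightarrow> 'k" where "hc i k = coef (h i) (yz (n - 1) k)"
definition hh :: "nat \<Rightarrow> nat \<Rightarrow> 'k" where "hh i j = ev \<Phi> (h i * mono_poly (yz n j))"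
definition EE :: "nat \<Rightarrow> nat \<Rightarrow> 'k" where "EE l k = coef (E k) (yz (n - 1) l)"

text \<open>Both sides are the value of \<Phi> at \<open>px * h i * h j\<close>. In the same way the
  next two lemmas rest on the products of x with \<open>E k * E l\<close> and with
  \<open>E k * h j\<close>. These symmetries make the coordinate matrix alternating.\<close>

lemma hh_sym: "i \<le> n \<Longrightarrow> j \<le> n \<Longrightarrow> hh i j = hh j i"
  using ev_h [of j "h i"] ev_h [of i "h j"] by (simp add: hh_def algebra_simps)

lemma EE_sym: "k < n \<Longrightarrow> l < n \<Longrightarrow> EE l k = EE k l"
  using ev_E [of l "E k"] ev_E [of k "E l"] by (simp add: EE_def algebra_simps)

lemma ev_E_yz: "k < n \<Longrightarrow> j \<le> n \<Longrightarrow> ev \<Phi> (E k * mono_poly (yz n j)) = hc j k"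
  using ev_E [of k "h j"] ev_h [of j "E k"] by (simp add: hc_def algebra_simps)

definition \<alpha> :: "nat \<Rightarrow> nat \<Rightarrow> 'k" where
  "\<alpha> i k = hh i (k + 1) - hh k (i + 1)"

definition \<beta> :: "nat \<Rightarrow> nat \<Rightarrow> 'k" where
  "\<beta> i j = (if j = 0 then 0 else hc i (j - 1)) - (if j = n then 0 else hc (i + 1) j)"

definition \<delta> :: "nat \<Rightarrow> nat \<Rightarrow> 'k" where
  "\<delta> l j = (if l < n \<and> 1 \<le> j then EE l (j - 1) else 0) - (if j < n \<and> 1 \<le> l then EE j (l - 1) else 0)"

text \<open>The monomial parts of \<open>pz * G i\<close> and \<open>py * G (i + 1)\<close> agree,
  so the difference of these products is divisible by x. The quotient lies in \<open>I\<close>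
  because the \<open>G j\<close> kill \<Phi> itself, and its coordinates are those of
  \<open>degree_n_expansion\<close>.\<close>

lemma h_relation:
  assumes i: "i < n"
  shows "pz * h i - py * h (i + 1)
    = (\<Sum>k<n. pconst (\<alpha> i k) * (px * E k)) + (\<Sum>j\<le>n. pconst (\<beta> i j) * G j)"
proof -
  let ?\<theta> = "pz * h i - py * h (i + 1)"
  have "py * G (i + 1) - pz * G i = px * ?\<theta>"
    using i by (simp add: G_def right_diff_distrib pz_yz Suc_diff_Suc mult.left_commute)
  then have x\<theta>: "px * ?\<theta> = py * G (i + 1) - pz * G i" by simp
  have "?\<theta> \<in> I"
    unfolding I_iff x\<theta>
    using i by (simp add: left_diff_distrib ev_diff ev_G mult.assoc mult.left_commute [of "pvar _"])
  moreover have "homog ?\<theta> (int n)"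
    using i by (intro homog_diff homog_pvar_mult homog_h) auto
  ultimately have "?\<theta> = (\<Sum>k<n. pconst (ev \<Phi> (?\<theta> * mono_poly (yz (n - 1) k))) * (px * E k))
    + (\<Sum>j\<le>n. pconst (coef ?\<theta> (yz n j)) * G j)"
    by (rule degree_n_expansion)
  moreover have "ev \<Phi> (?\<theta> * mono_poly (yz (n - 1) k)) = \<alpha> i k" if k: "k < n" for k
  proof -
    have "?\<theta> * mono_poly (yz (n - 1) k)
        = h i * (pz * mono_poly (yz (n - 1) k)) - h (i + 1) * (py * mono_poly (yz (n - 1) k))"
      by (simp add: algebra_simps)
    also have "pz * mono_poly (yz (n - 1) k) = mono_poly (yz n (k + 1))"
      using k by (simp add: pz_yz)
    also have "py * mono_poly (yz (n - 1) k) = mono_poly (yz n k)"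
      using k by (simp add: pz_yz Suc_diff_Suc)
    finally show ?thesis
      using i k by (simp add: ev_diff hh_def [symmetric] \<alpha>_def hh_sym [of k])
  qed
  moreover have "coef ?\<theta> (yz n j) = \<beta> i j" if "j \<le> n" for j
    using that by (auto simp: lookup_minus coef_pvar_mult_mon \<beta>_def hc_def)
  ultimately show ?thesis by simp
qed

text \<open>Paired with a polynomial, \<open>pz * E j\<close> and \<open>py * E (j - 1)\<close> both
  read off the same coefficient, that of the monomial with exponents \<open>n - 1 - j\<close> in y
  and \<open>j - 1\<close> in z. Hence the difference is in \<open>I\<close>. At
  \<open>j = 0\<close> and \<open>j = n\<close> one term is missing and the other pairs to
  zero.\<close>

lemma E_relation:
  assumes j: "j \<le> n"
  shows "(if j < n then pz * E j else 0) - (if 1 \<le> j then py * E (j - 1) else 0)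
    = - (\<Sum>k<n. pconst (\<beta> k j) * (px * E k)) - (\<Sum>l\<le>n. pconst (\<delta> l j) * G l)"
proof -
  let ?\<theta> = "(if j < n then pz * E j else 0) - (if 1 \<le> j then py * E (j - 1) else 0)"
  have ev\<theta>: "ev \<Phi> (px * ?\<theta> * g) = (if j < n then coef (pz * g) (yz (n - 1) j) else 0)
      - (if 1 \<le> j then coef (py * g) (yz (n - 1) (j - 1)) else 0)" for g
  proof -
    have "px * ?\<theta> * g = (if j < n then px * E j * (pz * g) else 0)
        - (if 1 \<le> j then px * E (j - 1) * (py * g) else 0)"
      by (simp add: algebra_simps)
    then show ?thesis using j by (simp add: ev_diff ev_E)
  qed
  have "?\<theta> \<in> I"
    unfolding I_iff ev\<theta> using j by (auto simp: coef_pvar_mult_mon)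
  moreover have "homog ?\<theta> (int n)"
    using j by (auto intro!: homog_diff homog_uminus homog_pvar_mult homog_E)
  ultimately have "?\<theta> = (\<Sum>k<n. pconst (ev \<Phi> (?\<theta> * mono_poly (yz (n - 1) k))) * (px * E k))
    + (\<Sum>l\<le>n. pconst (coef ?\<theta> (yz n l)) * G l)"
    by (rule degree_n_expansion)
  moreover have "ev \<Phi> (?\<theta> * mono_poly (yz (n - 1) k)) = - \<beta> k j" if k: "k < n" for k
  proof -
    have "?\<theta> * mono_poly (yz (n - 1) k)
        = (if j < n then E j * (pz * mono_poly (yz (n - 1) k)) else 0)
          - (if 1 \<le> j then E (j - 1) * (py * mono_poly (yz (n - 1) k)) else 0)"
      by (simp add: algebra_simps)
    also have "pz * mono_poly (yz (n - 1) k) = mono_poly (yz n (k + 1))"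
      using k by (simp add: pz_yz)
    also have "py * mono_poly (yz (n - 1) k) = mono_poly (yz n k)"
      using k by (simp add: pz_yz Suc_diff_Suc)
    finally show ?thesis
      using j k by (auto simp: ev_diff ev_uminus ev_E_yz \<beta>_def)
  qed
  moreover have "coef ?\<theta> (yz n l) = - \<delta> l j" if "l \<le> n" for l
  proof -
    have "coef (pz * E j) (yz n l) = (if l = 0 then 0 else EE j (l - 1))" if "j < n"
      using \<open>l \<le> n\<close> EE_sym [of j "l - 1"] that by (auto simp: coef_pvar_mult_mon EE_def)
    moreover have "coef (py * E (j - 1)) (yz n l) = (if l = n then 0 else EE l (j - 1))"
      using \<open>l \<le> n\<close> by (auto simp: coef_pvar_mult_mon EE_def)
    ultimately show ?thesis
      using \<open>l \<le> n\<close> j by (auto simp: lookup_minus \<delta>_def)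
  qed
  ultimately show ?thesis by (simp add: sum_negf)
qed

text \<open>\<open>CA\<close>, \<open>CB\<close>, \<open>CD\<close> are the blocks \<open>A\<close>, \<open>B\<close>, \<open>D\<close> of \<open>b\<^sub>2\<close>. On column vectors cut into blocks \<open>p\<close>, \<open>q\<close> of
  lengths \<open>n\<close> and \<open>n + 1\<close>, \<open>r1\<close> and \<open>r2\<close> are the two blocks of the product with \<open>b\<^sub>2\<close>, and \<open>g\<close> is the product
  with the row of generators.\<close>

definition CA :: "nat \<Rightarrow> nat \<Rightarrow> 'k poly3" where "CA i k = px * pconst (\<alpha> i k)"
definition CB :: "nat \<Rightarrow> nat \<Rightarrow> 'k poly3" where
  "CB i j = px * pconst (\<beta> i j) + ((if j = i then pz else 0) - (if j = i + 1 then py else 0))"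
definition CD :: "nat \<Rightarrow> nat \<Rightarrow> 'k poly3" where "CD l j = px * pconst (\<delta> l j)"

definition r1 :: "(nat \<Rightarrow> 'k poly3) \<Rightarrow> (nat \<Rightarrow> 'k poly3) \<Rightarrow> nat \<Rightarrow> 'k poly3" where
  "r1 p q i = (\<Sum>k<n. CA i k * p k) + (\<Sum>j\<le>n. CB i j * q j)"
definition r2 :: "(nat \<Rightarrow> 'k poly3) \<Rightarrow> (nat \<Rightarrow> 'k poly3) \<Rightarrow> nat \<Rightarrow> 'k poly3" where
  "r2 p q j = - (\<Sum>i<n. CB i j * p i) + (\<Sum>l\<le>n. CD j l * q l)"

definition g :: "(nat \<Rightarrow> 'k poly3) \<Rightarrow> (nat \<Rightarrow> 'k poly3) \<Rightarrow> 'k poly3" where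
  "g a c = (\<Sum>k<n. px * E k * a k) + (\<Sum>j\<le>n. G j * c j)"

section \<open>The maps form a complex\<close>

text \<open>The zero diagonal is recorded separately because skew symmetry does not imply it in
  characteristic 2.\<close>

lemma CA_alt: "CA k i = - CA i k" "CA i i = 0"
  by (simp_all add: CA_def \<alpha>_def algebra_simps)

lemma CD_alt: "CD l j = - CD j l" "CD j j = 0"
  by (auto simp: CD_def \<delta>_def algebra_simps)

lemma r1_eq:
  assumes "i < n"
  shows "r1 p q i = pz * q i - py * q (Suc i)
    + px * ((\<Sum>k<n. pconst (\<alpha> i k) * p k) + (\<Sum>j\<le>n. pconst (\<beta> i j) * q j))"
proof -
  have "(\<Sum>j\<le>n. CB i j * q j) = (\<Sum>j\<le>n. px * (pconst (\<beta> i j) * q j)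
      + ((if j = i then pz * q j else 0) - (if j = Suc i then py * q j else 0)))"
    by (rule sum.cong) (auto simp: CB_def algebra_simps)
  also have "\<dots> = px * (\<Sum>j\<le>n. pconst (\<beta> i j) * q j) + (pz * q i - py * q (Suc i))"
    using assms by (simp add: sum.distrib sum_subtractf sum_distrib_left)
  finally show ?thesis by (simp add: r1_def CA_def sum_distrib_left algebra_simps)
qed

lemma r2_eq:
  assumes "j \<le> n"
  shows "r2 p q j = (if j = 0 then 0 else py * p (j - 1)) - (if j = n then 0 else pz * p j)
    + px * (- (\<Sum>i<n. pconst (\<beta> i j) * p i) + (\<Sum>l\<le>n. pconst (\<delta> j l) * q l))"
proof -
  have "(\<Sum>i<n. CB i j * p i) = (\<Sum>i<n. px * (pconst (\<beta> i j) * p i)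
      + ((if i = j then pz * p i else 0) - (if j = Suc i then py * p i else 0)))"
    by (rule sum.cong) (auto simp: CB_def algebra_simps)
  also have "\<dots> = px * (\<Sum>i<n. pconst (\<beta> i j) * p i)
      + ((if j = n then 0 else pz * p j) - (\<Sum>i<n. if j = Suc i then py * p i else 0))"
    using assms by (simp add: sum.distrib sum_subtractf sum_distrib_left)
  also have "(\<Sum>i<n. if j = Suc i then py * p i else 0) = (if j = 0 then 0 else py * p (j - 1))"
    using assms by (cases j) (auto simp: sum.delta')
  finally show ?thesis by (simp add: r2_def CD_def sum_distrib_left algebra_simps)
qed

text \<open>The row of generators annihilates the columns of \<open>b2\<close>: these are x times
  \<open>h_relation\<close> and \<open>E_relation\<close>, where x times \<open>h i\<close> is
  rewritten through \<open>G i\<close> and the monomials cancel.\<close>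

lemma column_relations:
  shows "i < n \<Longrightarrow> (\<Sum>k<n. px * E k * CA k i) - (\<Sum>j\<le>n. G j * CB i j) = 0"
    and "j \<le> n \<Longrightarrow> (\<Sum>k<n. px * E k * CB k j) + (\<Sum>l\<le>n. G l * CD l j) = 0"
proof -
  assume i: "i < n"
  have "(\<Sum>j\<le>n. G j * CB i j) = (\<Sum>j\<le>n. px * (pconst (\<beta> i j) * G j)
      + ((if j = i then pz * G j else 0) - (if j = Suc i then py * G j else 0)))"
    by (rule sum.cong) (auto simp: CB_def algebra_simps)
  also have "\<dots> = px * (\<Sum>j\<le>n. pconst (\<beta> i j) * G j) + (pz * G i - py * G (Suc i))"
    using i by (simp add: sum.distrib sum_subtractf sum_distrib_left)
  also have "pz * G i - py * G (Suc i) = - (px * (pz * h i - py * h (i + 1)))"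
    using i by (simp add: G_def right_diff_distrib pz_yz Suc_diff_Suc mult.left_commute)
  also have "\<dots> = - px * ((\<Sum>k<n. pconst (\<alpha> i k) * (px * E k)) + (\<Sum>j\<le>n. pconst (\<beta> i j) * G j))"
    by (simp only: h_relation [OF i] mult_minus_left)
  finally have "(\<Sum>j\<le>n. G j * CB i j) = - (px * (\<Sum>k<n. pconst (\<alpha> i k) * (px * E k)))"
    by (simp add: distrib_left)
  moreover have "(\<Sum>k<n. px * E k * CA k i) = - (px * (\<Sum>k<n. pconst (\<alpha> i k) * (px * E k)))"
    by (subst CA_alt(1)) (simp add: CA_def sum_distrib_left sum_negf mult_ac)
  ultimately show "(\<Sum>k<n. px * E k * CA k i) - (\<Sum>j\<le>n. G j * CB i j) = 0" by simp
next
  assume j: "j \<le> n"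
  have "(\<Sum>k<n. px * E k * CB k j) = (\<Sum>k<n. px * (pconst (\<beta> k j) * (px * E k))
      + px * ((if k = j then pz * E k else 0) - (if j = Suc k then py * E k else 0)))"
    by (rule sum.cong) (auto simp: CB_def algebra_simps)
  also have "\<dots> = px * (\<Sum>k<n. pconst (\<beta> k j) * (px * E k))
      + px * ((if j < n then pz * E j else 0) - (\<Sum>k<n. if j = Suc k then py * E k else 0))"
    by (simp only: sum.distrib sum_subtractf sum_distrib_left [symmetric]) simp
  also have "(\<Sum>k<n. if j = Suc k then py * E k else 0) = (if 1 \<le> j then py * E (j - 1) else 0)"
    using j by (cases j) (auto simp: sum.delta')
  finally have "(\<Sum>k<n. px * E k * CB k j) = - (px * (\<Sum>l\<le>n. pconst (\<delta> l j) * G l))"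
    by (simp only: E_relation [OF j]) (simp add: algebra_simps)
  then show "(\<Sum>k<n. px * E k * CB k j) + (\<Sum>l\<le>n. G l * CD l j) = 0"
    by (simp add: CD_def sum_distrib_left algebra_simps)
qed

lemma g_r: "g (r1 p q) (r2 p q) = 0"
proof -
  have "(\<Sum>k<n. px * E k * (\<Sum>i<n. CA k i * p i)) = (\<Sum>i<n. (\<Sum>k<n. px * E k * CA k i) * p i)"
    unfolding sum_distrib_left sum_distrib_right by (subst sum.swap) (simp add: mult.assoc)
  moreover have "(\<Sum>k<n. px * E k * (\<Sum>j\<le>n. CB k j * q j)) = (\<Sum>j\<le>n. (\<Sum>k<n. px * E k * CB k j) * q j)"
    unfolding sum_distrib_left sum_distrib_right by (subst sum.swap) (simp add: mult.assoc)
  moreover have "(\<Sum>j\<le>n. G j * (\<Sum>i<n. CB i j * p i)) = (\<Sum>i<n. (\<Sum>j\<le>n. G j * CB i j) * p i)"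
    unfolding sum_distrib_left sum_distrib_right by (subst sum.swap) (simp add: mult.assoc)
  moreover have "(\<Sum>l\<le>n. G l * (\<Sum>j\<le>n. CD l j * q j)) = (\<Sum>j\<le>n. (\<Sum>l\<le>n. G l * CD l j) * q j)"
    unfolding sum_distrib_left sum_distrib_right by (subst sum.swap) (simp add: mult.assoc)
  ultimately have "g (r1 p q) (r2 p q)
      = (\<Sum>i<n. ((\<Sum>k<n. px * E k * CA k i) - (\<Sum>j\<le>n. G j * CB i j)) * p i)
        + (\<Sum>j\<le>n. ((\<Sum>k<n. px * E k * CB k j) + (\<Sum>l\<le>n. G l * CD l j)) * q j)"
    by (simp add: g_def r1_def r2_def distrib_left sum.distrib left_diff_distrib distrib_right
        right_diff_distrib sum_subtractf sum_negf)
  also have "\<dots> = 0" by (simp add: column_relations)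
  finally show ?thesis .
qed

text \<open>The transpose of \<open>column_relations\<close>, since the matrix is
  alternating.\<close>

lemma r_g:
  shows "i < n \<Longrightarrow> r1 (\<lambda>k. px * E k * s) (\<lambda>j. G j * s) i = 0"
    and "j \<le> n \<Longrightarrow> r2 (\<lambda>k. px * E k * s) (\<lambda>j. G j * s) j = 0"
proof -
  assume i: "i < n"
  have "r1 (\<lambda>k. px * E k * s) (\<lambda>j. G j * s) i
      = ((\<Sum>k<n. px * E k * CA i k) + (\<Sum>j\<le>n. G j * CB i j)) * s"
    by (simp add: r1_def sum_distrib_left distrib_left mult_ac)
  also have "(\<Sum>k<n. px * E k * CA i k) = - (\<Sum>k<n. px * E k * CA k i)"
    by (subst CA_alt(1)) (simp add: sum_negf)
  finally show "r1 (\<lambda>k. px * E k * s) (\<lambda>j. G j * s) i = 0"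
    using column_relations(1) [OF i] by simp
next
  assume j: "j \<le> n"
  have "r2 (\<lambda>k. px * E k * s) (\<lambda>j. G j * s) j
      = (- (\<Sum>k<n. px * E k * CB k j) + (\<Sum>l\<le>n. G l * CD j l)) * s"
    by (simp add: r2_def sum_distrib_left right_diff_distrib mult_ac)
  also have "(\<Sum>l\<le>n. G l * CD j l) = - (\<Sum>l\<le>n. G l * CD l j)"
    by (subst CD_alt(1)) (simp add: sum_negf)
  finally show "r2 (\<lambda>k. px * E k * s) (\<lambda>j. G j * s) j = 0"
    using column_relations(2) [OF j] by (simp add: add_eq_0_iff)
qed

end

section \<open>Exactness at the two inner terms of the complex\<close>

lemma dvd_diff_add_mult: "d dvd u - w \<Longrightarrow> d dvd u - (w + d * v)" for d :: "'a::comm_ring_1"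
  by (metis diff_diff_eq dvd_diff dvd_triv_left)

lemma homog_mono_poly: "homog (mono_poly m) (int (mdeg m))"
  by (simp add: homog_single)

context dual_basis
begin

lemma g_cong: "(\<And>k. k < n \<Longrightarrow> a k = a' k) \<Longrightarrow> (\<And>j. j \<le> n \<Longrightarrow> c j = c' j) \<Longrightarrow> g a c = g a' c'"
  by (simp add: g_def)

lemma g_diff: "g (\<lambda>k. a k - a' k) (\<lambda>j. c j - c' j) = g a c - g a' c'"
  by (simp add: g_def right_diff_distrib sum_subtractf)

lemma g_mult: "g (\<lambda>k. s * a k) (\<lambda>j. s * c j) = s * g a c"
  by (simp add: g_def distrib_left sum_distrib_left mult_ac)

lemma r1_lin: "r1 (\<lambda>k. p k + s * p' k) (\<lambda>j. q j + s * q' j) i = r1 p q i + s * r1 p' q' i"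
  by (simp add: r1_def distrib_left sum.distrib sum_distrib_left mult_ac)

lemma r2_lin: "r2 (\<lambda>k. p k + s * p' k) (\<lambda>j. q j + s * q' j) i = r2 p q i + s * r2 p' q' i"
  by (simp add: r2_def distrib_left right_diff_distrib sum.distrib sum_distrib_left mult_ac)

lemma yz_poly: "(mono_poly (yz n j) :: 'k poly3) = py ^ (n - j) * pz ^ j"
  by (simp add: mono_poly_mon)

lemma dle_r1:
  assumes "\<And>k. k < n \<Longrightarrow> dle (p k) (e - 1)" "\<And>j. j \<le> n \<Longrightarrow> dle (q j) (e - 1)" "i < n"
  shows "dle (r1 p q i) e"
  unfolding r1_eq [OF assms(3)] using assms
  by (intro dle_add dle_diff dle_pvar_mult dle_sum dle_pconst_mult) auto

lemma dle_r2:
  assumes "\<And>k. k < n \<Longrightarrow> dle (p k) (e - 1)" "\<And>j. j \<le> n \<Longrightarrow> dle (q j) (e - 1)" "j \<le> n"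
  shows "dle (r2 p q j) e"
proof -
  have "dle (if j = 0 then 0 else py * p (j - 1)) e" "dle (if j = n then 0 else pz * p j) e"
    using assms by (auto intro!: dle_pvar_mult)
  then show ?thesis
    unfolding r2_eq [OF assms(3)] using assms
    by (intro dle_add dle_diff dle_uminus dle_pvar_mult dle_sum dle_pconst_mult) auto
qed

text \<open>Duality inside the box of exponents below \<open>n\<close>. The test monomial
  \<open>?t\<close> is complementary to \<open>m\<close>: their product has both exponents equal to
  \<open>n - 1\<close>. So has the product of \<open>yz (n - 1) k\<close> and \<open>?s\<close>, and
  therefore the coefficient that \<open>E k\<close> extracts from \<open>a k * mono_poly ?t\<close>
  is the coefficient of \<open>a k * mono_poly ?s\<close> at \<open>m\<close>.\<close>

lemma combination_of_duals:
  assumes "g' = (\<Sum>k<n. E k * a k)" "\<And>t. ev \<Phi> (px * g' * t) = 0"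
    and m: "coef m X = 0" "coef m Y < n" "coef m Z < n"
  shows "coef (\<Sum>k<n. a k * (py ^ k * pz ^ (n - 1 - k))) m = 0"
proof -
  let ?t = "mon 0 (n - 1 - coef m Y) (n - 1 - coef m Z)"
  have eq: "coef (a k * mono_poly ?t) (yz (n - 1) k) = coef (a k * (py ^ k * pz ^ (n - 1 - k))) m"
    if k: "k < n" for k
  proof -
    let ?s = "mon 0 k (n - 1 - k)"
    have "coef (a k * mono_poly ?t) (yz (n - 1) k) = coef (mono_poly ?s * (a k * mono_poly ?t)) (?s + yz (n - 1) k)"
      by simp
    also have "?s + yz (n - 1) k = ?t + m"
      using m k by (intro mono_eqI) (auto simp: lookup_add)
    also have "mono_poly ?s * (a k * mono_poly ?t) = mono_poly ?t * (a k * mono_poly ?s)"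
      by (simp add: mult_ac)
    also have "coef \<dots> (?t + m) = coef (a k * mono_poly ?s) m" by simp
    finally show ?thesis by (simp add: mono_poly_mon)
  qed
  have "(\<Sum>k<n. coef (a k * mono_poly ?t) (yz (n - 1) k)) = (\<Sum>k<n. ev \<Phi> (px * E k * (a k * mono_poly ?t)))"
    by (simp add: ev_E)
  also have "\<dots> = ev \<Phi> (px * g' * mono_poly ?t)"
    by (simp add: assms(1) sum_distrib_left sum_distrib_right ev_sum mult_ac)
  also have "\<dots> = 0" by (rule assms(2))
  finally have "(\<Sum>k<n. coef (a k * mono_poly ?t) (yz (n - 1) k)) = 0" .
  moreover have "(\<Sum>k<n. coef (a k * mono_poly ?t) (yz (n - 1) k))
      = (\<Sum>k<n. coef (a k * (py ^ k * pz ^ (n - 1 - k))) m)"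
    by (rule sum.cong [OF refl], rule eq) simp
  ultimately show ?thesis by (simp only: lookup_sum)
qed

text \<open>Each round subtracts two images: that of \<open>p\<close> makes the block
  \<open>c\<close> divisible by x, that of \<open>q\<close> does the same for \<open>a\<close>.
  Cancelling x then lowers the degree bound; at \<open>e = 0\<close> the bound is negative and
  everything vanishes.\<close>

lemma kernel_g_bounded:
  assumes "\<And>k. k < n \<Longrightarrow> dle (a k) (int e - 1)" "\<And>j. j \<le> n \<Longrightarrow> dle (c j) (int e - 1)" "g a c = 0"
  shows "\<exists>p q. (\<forall>i<n. a i = r1 p q i) \<and> (\<forall>j\<le>n. c j = r2 p q j)"
  using assms
proof (induction e arbitrary: a c)
  case 0
  then have "\<forall>i<n. a i = r1 (\<lambda>_. 0) (\<lambda>_. 0) i" "\<forall>j\<le>n. c j = r2 (\<lambda>_. 0) (\<lambda>_. 0) j"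
    by (auto simp: r1_def r2_def intro!: dle_neg [of _ "-1"])
  then show ?case by blast
next
  case (Suc e)
  have da: "dle (a k) (int e)" if "k < n" for k using Suc.prems(1) [OF that] by simp
  have dc: "dle (c j) (int e)" if "j \<le> n" for j using Suc.prems(2) [OF that] by simp
  have "(\<Sum>j\<le>n. c j * (py ^ (n - j) * pz ^ j)) = g a c - px * ((\<Sum>k<n. E k * a k) - (\<Sum>j\<le>n. h j * c j))"
    by (simp add: g_def G_def yz_poly algebra_simps sum_subtractf sum_distrib_left)
  then have "px dvd (\<Sum>j\<le>n. c j * (py ^ (n - j) * pz ^ j))"
    using Suc.prems(3) by simp
  from syz_monomials [OF dc this] obtain p where p: "\<And>i. i < n \<Longrightarrow> dle (p i) (int e - 1)"
    "\<And>j. j \<le> n \<Longrightarrow> px dvd c j - ((if j = 0 then 0 else py * p (j - 1)) - (if j = n then 0 else pz * p j))"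
    by blast
  define a1 where "a1 k = a k - r1 p (\<lambda>_. 0) k" for k
  define c1 where "c1 j = c j - r2 p (\<lambda>_. 0) j" for j
  have g1: "g a1 c1 = 0"
    unfolding a1_def [abs_def] c1_def [abs_def] g_diff Suc.prems(3) by (simp add: g_r)
  have da1: "dle (a1 k) (int e)" if "k < n" for k
    unfolding a1_def using that da p(1) by (intro dle_diff dle_r1) auto
  have dc1: "dle (c1 j) (int e)" if "j \<le> n" for j
    unfolding c1_def using that dc p(1) by (intro dle_diff dle_r2) auto
  have "px dvd c1 j" if "j \<le> n" for j
    unfolding c1_def r2_eq [OF that] using p(2) [OF that]
    by (rule dvd_diff_add_mult)
  then have "\<exists>w. c1 j = px * w" if "j \<le> n" for j using that by blast
  then obtain w where w: "\<And>j. j \<le> n \<Longrightarrow> c1 j = px * w j" by metis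
  \<comment> \<open>With \<open>c1\<close> divisible by x, one factor x cancels from the whole
    relation. The combination of the \<open>E k\<close> is then one of the \<open>G j\<close>, so it
    lies in \<open>I\<close>, which is the hypothesis of
    \<open>combination_of_duals\<close>.\<close>
  have "px * ((\<Sum>k<n. E k * a1 k) + (\<Sum>j\<le>n. G j * w j)) = g a1 c1"
    by (simp add: g_def w distrib_left sum_distrib_left mult_ac)
  then have Ea: "(\<Sum>k<n. E k * a1 k) = - (\<Sum>j\<le>n. G j * w j)"
    using g1 by (simp add: eq_neg_iff_add_eq_0)
  have ann: "ev \<Phi> (px * (\<Sum>k<n. E k * a1 k) * t) = 0" for t
  proof -
    have "px * (\<Sum>k<n. E k * a1 k) * t = - (\<Sum>j\<le>n. G j * (px * w j * t))"
      unfolding Ea by (simp add: sum_distrib_left sum_distrib_right mult_ac)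
    then show ?thesis by (simp add: ev_uminus ev_sum ev_G)
  qed
  obtain q where q: "\<And>k. k \<le> n \<Longrightarrow> dle (q k) (int e - 1)"
    "\<And>k. k < n \<Longrightarrow> px dvd a1 k - (pz * q k - py * q (Suc k))"
    using syz_dual_monomials [of n a1 "int e", OF n da1 combination_of_duals [OF refl ann]] by blast
  define a2 where "a2 k = a1 k - r1 (\<lambda>_. 0) q k" for k
  define c2 where "c2 j = c1 j - r2 (\<lambda>_. 0) q j" for j
  have g2: "g a2 c2 = 0"
    unfolding a2_def [abs_def] c2_def [abs_def] g_diff g1 by (simp add: g_r)
  have da2: "dle (a2 k) (int e)" if "k < n" for k
    unfolding a2_def using that da1 q(1) by (intro dle_diff dle_r1) auto
  have dc2: "dle (c2 j) (int e)" if "j \<le> n" for j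
    unfolding c2_def using that dc1 q(1) by (intro dle_diff dle_r2) auto
  have "px dvd a2 k" if "k < n" for k
    unfolding a2_def r1_eq [OF that] using q(2) [OF that]
    by (rule dvd_diff_add_mult)
  then have "\<exists>u. a2 k = px * u \<and> dle u (int e - 1)" if "k < n" for k
    using pvar_dvd_quo [OF _ da2 [OF that]] that by metis
  then obtain a3 where a3: "\<And>k. k < n \<Longrightarrow> a2 k = px * a3 k" "\<And>k. k < n \<Longrightarrow> dle (a3 k) (int e - 1)"
    by metis
  \<comment> \<open>The second correction does not spoil the first: with zero in the first block,
    \<open>r2\<close> is a multiple of x.\<close>
  have "px dvd c2 j" if "j \<le> n" for j
    unfolding c2_def r2_eq [OF that] w [OF that] by (simp add: dvd_diff)
  then have "\<exists>u. c2 j = px * u \<and> dle u (int e - 1)" if "j \<le> n" for j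
    using pvar_dvd_quo [OF _ dc2 [OF that]] that by metis
  then obtain c3 where c3: "\<And>j. j \<le> n \<Longrightarrow> c2 j = px * c3 j" "\<And>j. j \<le> n \<Longrightarrow> dle (c3 j) (int e - 1)"
    by metis
  have "px * g a3 c3 = g a2 c2"
    unfolding g_mult [symmetric] by (rule g_cong) (simp_all add: a3 c3)
  then have "g a3 c3 = 0" using g2 by simp
  then obtain p' q' where pq': "\<forall>i<n. a3 i = r1 p' q' i" "\<forall>j\<le>n. c3 j = r2 p' q' j"
    using Suc.IH [of a3 c3] a3 c3 by blast
  have split: "r1 p q i = r1 p (\<lambda>_. 0) i + r1 (\<lambda>_. 0) q i"
    "r2 p q j = r2 p (\<lambda>_. 0) j + r2 (\<lambda>_. 0) q j" for i j
    using r1_lin [of p 1 "\<lambda>_. 0" "\<lambda>_. 0" q i] r2_lin [of p 1 "\<lambda>_. 0" "\<lambda>_. 0" q j] by simp_all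
  show ?case
  proof (intro exI conjI allI impI)
    fix i assume "i < n"
    then show "a i = r1 (\<lambda>k. p k + px * p' k) (\<lambda>j. q j + px * q' j) i"
      using a3(1) [of i] pq' by (simp add: r1_lin split a2_def a1_def algebra_simps)
  next
    fix j assume "j \<le> n"
    then show "c j = r2 (\<lambda>k. p k + px * p' k) (\<lambda>j. q j + px * q' j) j"
      using c3(1) [of j] pq' by (simp add: r2_lin split c2_def c1_def algebra_simps)
  qed
qed

lemma kernel_g:
  assumes "g a c = 0"
  obtains p q where "\<And>i. i < n \<Longrightarrow> a i = r1 p q i" "\<And>j. j \<le> n \<Longrightarrow> c j = r2 p q j"
proof -
  obtain e e' where e: "\<forall>k\<in>{..<n}. dle (a k) (int e)" "\<forall>j\<in>{..n}. dle (c j) (int e')"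
    using dle_exists_finite [of "{..<n}" a] dle_exists_finite [of "{..n}" c] by auto
  have "dle (a k) (int (Suc (e + e')) - 1)" if "k < n" for k
    using e that by (auto intro: dle_mono [of _ "int e"])
  moreover have "dle (c j) (int (Suc (e + e')) - 1)" if "j \<le> n" for j
    using e that by (auto intro: dle_mono [of _ "int e'"])
  ultimately show ?thesis
    using kernel_g_bounded [of a "Suc (e + e')" c] assms that by blast
qed

text \<open>Modulo x the two blocks decouple. The relations for \<open>a\<close> start with
  \<open>pz * a 0\<close> and force one entry after the other to vanish. The relations for
  \<open>c\<close> say that consecutive entries are in the ratio y : z, so \<open>c\<close> is
  proportional to the vector of monomials; coprimality of the powers of y and z makes the factor a
  polynomial.\<close>

lemma kernel_r_mod_x:
  fixes a c :: "nat \<Rightarrow> 'k poly3"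
  assumes a: "\<And>j. j \<le> n \<Longrightarrow> px dvd (if j = 0 then 0 else py * a (j - 1)) - (if j = n then 0 else pz * a j)"
    and c: "\<And>i. i < n \<Longrightarrow> px dvd pz * c i - py * c (Suc i)"
  shows "k < n \<Longrightarrow> px dvd a k"
    and "j \<le> n \<Longrightarrow> px dvd c j - py ^ (n - j) * pz ^ j * mquo (Poly_Mapping.single Z n) (c n)"
proof -
  show "px dvd a k" if "k < n" for k
    using that
  proof (induction k)
    case 0
    then have "px dvd pz ^ 1 * a 0" using a [of 0] by simp
    then show ?case by (rule pvar_dvd_power_mult_cancel) simp
  next
    case (Suc k)
    then have "px dvd py * a k - pz * a (Suc k)" using a [of "Suc k"] by simp
    moreover have "px dvd py * a k" using Suc by simp
    moreover have "pz ^ 1 * a (Suc k) = py * a k - (py * a k - pz * a (Suc k))" by simp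
    ultimately have "px dvd pz ^ 1 * a (Suc k)" by (simp only: dvd_diff)
    then show ?case by (rule pvar_dvd_power_mult_cancel) simp
  qed
next
  let ?q = "mquo (Poly_Mapping.single Z n) (c n)"
  have *: "px dvd pz ^ i * c (n - i) - py ^ i * c n" if "i \<le> n" for i
    using that
  proof (induction i)
    case (Suc i)
    have "px dvd pz * c (n - Suc i) - py * c (n - i)"
      using c [of "n - Suc i"] Suc.prems by (simp add: Suc_diff_Suc)
    moreover have "px dvd pz ^ i * c (n - i) - py ^ i * c n" using Suc by simp
    ultimately have "px dvd pz ^ i * (pz * c (n - Suc i) - py * c (n - i)) + py * (pz ^ i * c (n - i) - py ^ i * c n)"
      by (intro dvd_add dvd_mult)
    then show ?case by (simp add: algebra_simps)
  qed simp
  have "pz ^ n * (- c 0) + py ^ n * c n = - (pz ^ n * c (n - n) - py ^ n * c n)" by simp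
  then have "px dvd pz ^ n * (- c 0) + py ^ n * c n"
    using * [of n] by (simp only: dvd_minus_iff)
  then have cn: "px dvd c n - pz ^ n * ?q"
    by (rule pvar_dvd_coprime) auto
  show "px dvd c j - py ^ (n - j) * pz ^ j * ?q" if j: "j \<le> n" for j
  proof -
    have "px dvd (pz ^ (n - j) * c j - py ^ (n - j) * c n) + py ^ (n - j) * (c n - pz ^ n * ?q)"
      using * [of "n - j"] j cn by (intro dvd_add dvd_mult) auto
    moreover have zn: "pz ^ n = pz ^ (n - j) * (pz ^ j :: 'k poly3)"
      using j by (simp add: power_add [symmetric])
    have "(pz ^ (n - j) * c j - py ^ (n - j) * c n) + py ^ (n - j) * (c n - pz ^ n * ?q)
        = pz ^ (n - j) * (c j - py ^ (n - j) * pz ^ j * ?q)"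
    proof -
      have "(u * d - v * d') + v * (d' - (u * w) * q) = u * (d - v * w * q)" for u v w d d' q :: "'k poly3"
        by (simp add: algebra_simps)
      then show ?thesis unfolding zn .
    qed
    ultimately have "px dvd pz ^ (n - j) * (c j - py ^ (n - j) * pz ^ j * ?q)"
      by (simp only:)
    then show ?thesis by (rule pvar_dvd_power_mult_cancel) simp
  qed
qed

text \<open>The bound on \<open>s\<close> is part of the conclusion because for vectors of degree at
  most \<open>n\<close> it makes \<open>s\<close> a constant, and this is how the Pfaffians are
  compared with the generators.\<close>

lemma kernel_r_bounded:
  assumes "\<And>k. k < n \<Longrightarrow> dle (a k) (int e - 1)" "\<And>j. j \<le> n \<Longrightarrow> dle (c j) (int e - 1)"
    and "\<And>i. i < n \<Longrightarrow> r1 a c i = 0" "\<And>j. j \<le> n \<Longrightarrow> r2 a c j = 0"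
  shows "\<exists>s. dle s (int e - 1 - int n) \<and> (\<forall>k<n. a k = px * E k * s) \<and> (\<forall>j\<le>n. c j = G j * s)"
  using assms
proof (induction e arbitrary: a c)
  case 0
  then have "\<forall>i<n. a i = px * E i * 0" "\<forall>j\<le>n. c j = G j * 0"
    by (auto intro!: dle_neg [of _ "-1"])
  then show ?case using dle_zero by blast
next
  case (Suc e)
  have da: "dle (a k) (int e)" if "k < n" for k using Suc.prems(1) [OF that] by simp
  have dc: "dle (c j) (int e)" if "j \<le> n" for j using Suc.prems(2) [OF that] by simp
  have x: "px dvd u" if "u + px * v = 0" for u v :: "'k poly3"
    using that by (metis add_eq_0_iff dvd_minus_iff dvd_triv_left)
  have pa: "px dvd (if j = 0 then 0 else py * a (j - 1)) - (if j = n then 0 else pz * a j)" if "j \<le> n" for j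
    using Suc.prems(4) [OF that] unfolding r2_eq [OF that] by (rule x)
  have pc: "px dvd pz * c i - py * c (Suc i)" if "i < n" for i
    using Suc.prems(3) [OF that] unfolding r1_eq [OF that] by (rule x)
  \<comment> \<open>Modulo x the vector of generators is zero in the first block and the monomials
    in the second. Subtracting \<open>q\<close> times it therefore leaves both blocks divisible by
    x.\<close>
  define q where "q = mquo (Poly_Mapping.single Z n) (c n)"
  have dq: "dle q (int e - int n)"
    unfolding q_def by (rule dle_mquo [OF dc]) auto
  define a2 where "a2 k = a k - px * E k * q" for k
  define c2 where "c2 j = c j - G j * q" for j
  have lin: "r1 a2 c2 i = r1 a c i - r1 (\<lambda>k. px * E k * q) (\<lambda>j. G j * q) i"
    "r2 a2 c2 i = r2 a c i - r2 (\<lambda>k. px * E k * q) (\<lambda>j. G j * q) i" for i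
    using r1_lin [of a "-1" "\<lambda>k. px * E k * q" c "\<lambda>j. G j * q" i]
      r2_lin [of a "-1" "\<lambda>k. px * E k * q" c "\<lambda>j. G j * q" i]
    by (simp_all add: a2_def [abs_def] c2_def [abs_def])
  have "dle (px * E k) (int n)" if "k < n" for k
    using homog_xE [OF that] by (auto simp: homog_def dle_def)
  then have da2: "dle (a2 k) (int e)" if "k < n" for k
    unfolding a2_def using that da dq by (intro dle_diff dle_mult [of "px * E k" "int n" q "int e - int n"]) auto
  have "dle (G j) (int n)" if "j \<le> n" for j
    using homog_G [OF that] by (auto simp: homog_def dle_def)
  then have dc2: "dle (c2 j) (int e)" if "j \<le> n" for j
    unfolding c2_def using that dc dq by (intro dle_diff dle_mult [of _ "int n"]) auto
  have "px dvd a2 k" if "k < n" for k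
    unfolding a2_def using kernel_r_mod_x(1) [of a c k, OF pa pc that] by (simp add: dvd_diff mult.assoc)
  then have "\<exists>u. a2 k = px * u \<and> dle u (int e - 1)" if "k < n" for k
    using pvar_dvd_quo [OF _ da2 [OF that]] that by metis
  then obtain a3 where a3: "\<And>k. k < n \<Longrightarrow> a2 k = px * a3 k" "\<And>k. k < n \<Longrightarrow> dle (a3 k) (int e - 1)"
    by metis
  have "px dvd c2 j" if "j \<le> n" for j
  proof -
    have "c2 j = (c j - py ^ (n - j) * pz ^ j * q) + px * (h j * q)"
      by (simp add: c2_def G_def yz_poly algebra_simps)
    then show ?thesis
      using kernel_r_mod_x(2) [of a c j, OF pa pc that] by (simp add: q_def)
  qed
  then have "\<exists>u. c2 j = px * u \<and> dle u (int e - 1)" if "j \<le> n" for j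
    using pvar_dvd_quo [OF _ dc2 [OF that]] that by metis
  then obtain c3 where c3: "\<And>j. j \<le> n \<Longrightarrow> c2 j = px * c3 j" "\<And>j. j \<le> n \<Longrightarrow> dle (c3 j) (int e - 1)"
    by metis
  have r13: "r1 a2 c2 i = px * r1 a3 c3 i" and r23: "r2 a2 c2 i = px * r2 a3 c3 i" for i
    by (simp_all add: r1_def r2_def a3 c3 distrib_left right_diff_distrib sum_distrib_left mult_ac)
  have "r1 a3 c3 i = 0" if "i < n" for i
    using r13 [of i] lin(1) [of i] Suc.prems(3) [OF that] r_g(1) [OF that] by simp
  moreover have "r2 a3 c3 i = 0" if "i \<le> n" for i
    using r23 [of i] lin(2) [of i] Suc.prems(4) [OF that] r_g(2) [OF that] by simp
  ultimately obtain s where s: "dle s (int e - 1 - int n)" "\<forall>k<n. a3 k = px * E k * s" "\<forall>j\<le>n. c3 j = G j * s"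
    using Suc.IH [of a3 c3] a3(2) c3(2) by blast
  show ?case
  proof (intro exI [of _ "q + px * s"] conjI allI impI)
    show "dle (q + px * s) (int (Suc e) - 1 - int n)"
      using dq s(1) by (intro dle_add dle_pvar_mult) (auto elim: dle_mono)
  next
    fix k assume "k < n"
    then show "a k = px * E k * (q + px * s)"
      using a3(1) [of k] s by (simp add: a2_def algebra_simps)
  next
    fix j assume "j \<le> n"
    then show "c j = G j * (q + px * s)"
      using c3(1) [of j] s by (simp add: c2_def algebra_simps)
  qed
qed

lemma kernel_r:
  assumes "\<And>i. i < n \<Longrightarrow> r1 a c i = 0" "\<And>j. j \<le> n \<Longrightarrow> r2 a c j = 0"
  obtains s where "\<And>k. k < n \<Longrightarrow> a k = px * E k * s" "\<And>j. j \<le> n \<Longrightarrow> c j = G j * s"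
proof -
  obtain e e' where e: "\<forall>k\<in>{..<n}. dle (a k) (int e)" "\<forall>j\<in>{..n}. dle (c j) (int e')"
    using dle_exists_finite [of "{..<n}" a] dle_exists_finite [of "{..n}" c] by auto
  have "dle (a k) (int (Suc (e + e')) - 1)" if "k < n" for k
    using e that by (auto intro: dle_mono [of _ "int e"])
  moreover have "dle (c j) (int (Suc (e + e')) - 1)" if "j \<le> n" for j
    using e that by (auto intro: dle_mono [of _ "int e'"])
  ultimately show ?thesis
    using kernel_r_bounded [of a "Suc (e + e')" c] assms that by blast
qed

section \<open>The generators span \<open>I\<close>\<close>

text \<open>As \<Phi> lives in one degree, each homogeneous component of low degree inherits the
  vanishing. A power of x lifts the component to degree \<open>n - 1\<close>, where nondegeneracy
  applies, and the power of x can be cancelled.\<close>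

lemma I_coef_eq_0:
  assumes f: "f \<in> I" and m: "mdeg m < n"
  shows "coef f m = 0"
proof -
  define d where "d = mdeg m"
  define f\<^sub>d where "f\<^sub>d = (\<Sum>m\<in>{m\<in>Poly_Mapping.keys f. mdeg m = d}. pconst (coef f m) * mono_poly m)"
  have cfd: "coef f\<^sub>d m' = (if mdeg m' = d then coef f m' else 0)" for m'
  proof -
    have "coef f\<^sub>d m' = (\<Sum>m\<in>{m\<in>Poly_Mapping.keys f. mdeg m = d}. if m = m' then coef f m else 0)"
      by (simp add: f\<^sub>d_def lookup_sum lookup_single when_def if_distrib [of "\<lambda>x. _ * x"] cong: if_cong)
    then show ?thesis by (auto simp: in_keys_iff)
  qed
  have hfd: "homog f\<^sub>d (int d)"
    by (auto simp: homog_def in_keys_iff cfd split: if_splits)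
  let ?t = "px ^ (n - 1 - d) :: 'k poly3"
  have ht: "homog ?t (int (n - 1 - d))"
    by (simp add: pvar_power homog_single)
  have "?t * f\<^sub>d = 0"
  proof (rule nondegenerate)
    show "homog (?t * f\<^sub>d) (int n - 1)"
      by (rule homog_mult [OF ht hfd]) (use m in \<open>simp add: d_def\<close>)
    fix m' assume m': "mdeg m' = n - 1"
    have "ev \<Phi> (px * f * (?t * mono_poly m')) = ev \<Phi> (px * f\<^sub>d * (?t * mono_poly m'))
        + ev \<Phi> ((px * ?t * mono_poly m') * (f - f\<^sub>d))"
      unfolding ev_add [symmetric] by (simp add: algebra_simps)
    also have "ev \<Phi> ((px * ?t * mono_poly m') * (f - f\<^sub>d)) = 0"
    proof (rule ev_mult_eq_0)
      fix m'' assume "m'' \<in> Poly_Mapping.keys (f - f\<^sub>d)"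
      then have "mdeg m'' \<noteq> d" by (auto simp: in_keys_iff lookup_minus cfd split: if_splits)
      moreover have "homog (px * ?t * mono_poly m' * mono_poly m'') (2 * int n - 1 - int d + int (mdeg m''))"
        by (rule homog_mult [OF homog_mult [OF homog_mult [OF homog_pvar ht refl]
              homog_mono_poly refl] homog_mono_poly]) (use m m' n in \<open>auto simp: d_def\<close>)
      ultimately show "ev \<Phi> (px * ?t * mono_poly m' * mono_poly m'') = 0"
        by (intro ev_homog) auto
    qed
    finally have "ev \<Phi> (px * f\<^sub>d * (?t * mono_poly m')) = ev \<Phi> (px * f * (?t * mono_poly m'))" by simp
    also have "\<dots> = 0" using f unfolding I_iff by blast
    finally show "ev \<Phi> (px * (?t * f\<^sub>d) * mono_poly m') = 0" by (simp add: mult_ac)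
  qed
  then have "f\<^sub>d = 0" by simp
  then show ?thesis using cfd [of m] by (simp add: d_def)
qed

text \<open>A monomial of degree at least \<open>n\<close> is divisible by x or by some monomial of
  degree \<open>n\<close> in y and z, so the claim holds for monomials and extends
  additively.\<close>

lemma reduce_mod_x:
  fixes f :: "'k poly3"
  assumes "\<And>m. m \<in> Poly_Mapping.keys f \<Longrightarrow> n \<le> mdeg m" "dle f e"
  shows "\<exists>c. (\<forall>j\<le>n. dle (c j) (e - int n)) \<and> px dvd f - (\<Sum>j\<le>n. mono_poly (yz n j) * c j)"
proof -
  define P where "P f \<longleftrightarrow> (\<exists>c. (\<forall>j\<le>n. dle (c j) (e - int n)) \<and>
    px dvd f - (\<Sum>j\<le>n. mono_poly (yz n j) * c j))" for f :: "'k poly3"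
  have mono: "P (pconst u * mono_poly m)" if m: "n \<le> mdeg m" "int (mdeg m) \<le> e" for u m
  proof (cases "coef m X = 0")
    case False
    then have "px dvd pconst u * (mono_poly m :: 'k poly3)"
      by (auto simp: pvar_dvd_iff lookup_single when_def)
    then show ?thesis unfolding P_def by (intro exI [of _ "\<lambda>_. 0"]) simp
  next
    case True
    \<comment> \<open>Takes as many factors z as possible; the total degree guarantees enough
      factors y for the rest.\<close>
    define l where "l = min n (coef m Z)"
    define t where "t = mon 0 (coef m Y - (n - l)) (coef m Z - l)"
    have l: "l \<le> n" by (simp add: l_def)
    have mt: "m = yz n l + t"
      using True m by (intro mono_eqI) (auto simp: t_def l_def lookup_add mdeg_def)
    let ?c = "\<lambda>j. if j = l then pconst u * (mono_poly t :: 'k poly3) else 0"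
    have "(\<Sum>j\<le>n. mono_poly (yz n j) * ?c j) = mono_poly (yz n l) * (pconst u * mono_poly t)"
      using l by (simp add: if_distrib [of "\<lambda>x. _ * x"] cong: if_cong)
    also have "\<dots> = pconst u * mono_poly m"
      by (simp add: mt mult_single pconst_def)
    finally have "px dvd pconst u * mono_poly m - (\<Sum>j\<le>n. mono_poly (yz n j) * ?c j)" by simp
    moreover have "mdeg m = n + mdeg t" using mt l by (simp add: mdeg_add)
    then have "dle (?c j) (e - int n)" for j
      using m by (auto intro!: dle_pconst_mult dle_single)
    ultimately show ?thesis unfolding P_def by (intro exI [of _ ?c]) simp
  qed
  have add: "P (f1 + f2)" if P1: "P f1" and P2: "P f2" for f1 f2
  proof -
    obtain c1 where c1: "\<forall>j\<le>n. dle (c1 j) (e - int n)" "px dvd f1 - (\<Sum>j\<le>n. mono_poly (yz n j) * c1 j)"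
      using P1 unfolding P_def by blast
    obtain c2 where c2: "\<forall>j\<le>n. dle (c2 j) (e - int n)" "px dvd f2 - (\<Sum>j\<le>n. mono_poly (yz n j) * c2 j)"
      using P2 unfolding P_def by blast
    have eq: "(f1 + f2) - (\<Sum>j\<le>n. mono_poly (yz n j) * (c1 j + c2 j))
        = (f1 - (\<Sum>j\<le>n. mono_poly (yz n j) * c1 j)) + (f2 - (\<Sum>j\<le>n. mono_poly (yz n j) * c2 j))"
      by (simp add: distrib_left sum.distrib)
    have "px dvd (f1 + f2) - (\<Sum>j\<le>n. mono_poly (yz n j) * (c1 j + c2 j))"
      unfolding eq by (rule dvd_add [OF c1(2) c2(2)])
    then show ?thesis
      unfolding P_def using c1(1) c2(1) by (intro exI [of _ "\<lambda>j. c1 j + c2 j"]) (auto intro: dle_add)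
  qed
  have "P 0" unfolding P_def by (intro exI [of _ "\<lambda>_. 0"]) simp
  have "P (\<Sum>m\<in>S. pconst (coef f m) * mono_poly m)" if "S \<subseteq> Poly_Mapping.keys f" for S
    using finite_subset [OF that finite_keys] that
  proof (induction S rule: finite_induct)
    case (insert m S)
    then have "P (pconst (coef f m) * mono_poly m)"
      using assms by (intro mono) (auto simp: dle_def)
    then show ?case using insert by (simp add: add)
  qed (use \<open>P 0\<close> in simp)
  then have "P (\<Sum>m\<in>Poly_Mapping.keys f. pconst (coef f m) * mono_poly m)" by blast
  then have "P f" by (subst poly_as_sum)
  then show ?thesis unfolding P_def .
qed

text \<open>Because \<open>px * f\<close> is in \<open>I\<close>, the functional
  \<open>\<psi>\<close> that \<open>f\<close> induces vanishes on multiples of x, and by degrees it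
  lives on monomials of degree at most \<open>n - 1\<close>. The \<open>E k\<close> and their
  multiples by powers of y represent every such functional.\<close>

lemma dual_combination:
  assumes f: "px * f \<in> I" and deg: "\<And>m. m \<in> Poly_Mapping.keys f \<Longrightarrow> n - 1 \<le> mdeg m" and df: "dle f e"
  shows "\<exists>v. (\<forall>k<n. dle (v k) (e - int n + 1)) \<and> f - (\<Sum>k<n. E k * v k) \<in> I"
proof -
  define \<psi> where "\<psi> m = ev \<Phi> (px * f * mono_poly m)" for m
  have \<psi>0: "n - 1 \<ge> mdeg m \<and> int (mdeg m) \<ge> 2 * int n - 2 - e" if "\<psi> m \<noteq> 0" for m
  proof (rule ccontr)
    assume c: "\<not> (n - 1 \<ge> mdeg m \<and> int (mdeg m) \<ge> 2 * int n - 2 - e)"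
    have "ev \<Phi> (px * mono_poly m * f) = 0"
    proof (rule ev_mult_eq_0)
      fix m' assume m': "m' \<in> Poly_Mapping.keys f"
      have "homog (px * mono_poly m * mono_poly m') (1 + int (mdeg m) + int (mdeg m'))"
        by (intro homog_mult [OF homog_mult [OF homog_pvar homog_single] homog_single]) auto
      then show "ev \<Phi> (px * mono_poly m * mono_poly m') = 0"
        by (rule ev_homog) (use c deg [OF m'] df m' n in \<open>auto simp: dle_def\<close>)
    qed
    then show False using that by (simp add: \<psi>_def mult_ac)
  qed
  have \<psi>X: "coef m X = 0" if "\<psi> m \<noteq> 0" for m
  proof (rule ccontr)
    assume "coef m X \<noteq> 0"
    then obtain m' where m': "m = Poly_Mapping.single X 1 + m'"
      using mono_minus_single [of 1 m X] by (metis One_nat_def Suc_leI gr0I)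
    have "mono_poly m = px * (mono_poly m' :: 'k poly3)" by (simp add: m' pvar_eq mult_single)
    then have "\<psi> m = ev \<Phi> (px * (px * f) * mono_poly m')" by (simp add: \<psi>_def mult_ac)
    then show False using f that by (simp add: I_iff)
  qed
  \<comment> \<open>\<open>E k\<close> times the power of y with exponent
    \<open>n - 1 - k - b\<close> is dual to the single monomial \<open>mon 0 b k\<close>. The range
    of \<open>b\<close> covers the degrees up to \<open>n - 1\<close>, and the lower bound in
    \<open>\<psi>0\<close> limits the degree of \<open>v k\<close>.\<close>
  define v where "v k = (\<Sum>b<n - k. pconst (\<psi> (mon 0 b k)) * mono_poly (mon 0 (n - 1 - k - b) 0))" for k
  have "dle (v k) (e - int n + 1)" if "k < n" for k
    unfolding v_def
  proof (rule dle_sum)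
    fix b assume b: "b \<in> {..<n - k}"
    show "dle (pconst (\<psi> (mon 0 b k)) * mono_poly (mon 0 (n - 1 - k - b) 0)) (e - int n + 1)"
    proof (cases "\<psi> (mon 0 b k) = 0")
      case False
      then show ?thesis
        using \<psi>0 [OF False] b that n by (intro dle_pconst_mult dle_single) auto
    qed simp
  qed
  moreover have "f - (\<Sum>k<n. E k * v k) \<in> I"
  proof -
    have "ev \<Phi> (px * (f - (\<Sum>k<n. E k * v k)) * mono_poly m) = 0" for m
    proof -
      have vk: "coef (v k * mono_poly m) (yz (n - 1) k) = (if coef m X = 0 \<and> coef m Z = k \<and> coef m Y < n - k then \<psi> m else 0)"
        if "k < n" for k
      proof -
        have "coef (v k * mono_poly m) (yz (n - 1) k)
            = (\<Sum>b<n - k. \<psi> (mon 0 b k) * (if mon 0 (n - 1 - k - b) 0 + m = yz (n - 1) k then 1 else 0))"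
          by (simp add: v_def sum_distrib_right lookup_sum mult.assoc mult_single lookup_single when_def)
        also have "\<dots> = (\<Sum>b<n - k. if b = coef m Y then (if coef m X = 0 \<and> coef m Z = k then \<psi> m else 0) else 0)"
        proof (rule sum.cong)
          fix b assume b: "b \<in> {..<n - k}"
          have "mon 0 (n - 1 - k - b) 0 + m = mon 0 (n - 1 - k - b) 0 + mon 0 b k \<longleftrightarrow> m = mon 0 b k"
            by simp
          moreover have "mon 0 (n - 1 - k - b) 0 + mon 0 b k = yz (n - 1) k"
            using b by (simp add: mon_add)
          ultimately have *: "mon 0 (n - 1 - k - b) 0 + m = yz (n - 1) k \<longleftrightarrow> m = mon 0 b k"
            by (simp only:)
          have "m = mon 0 b k \<longleftrightarrow> coef m X = 0 \<and> coef m Y = b \<and> coef m Z = k"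
            by (metis coef_mon mon_coef)
          then show "\<psi> (mon 0 b k) * (if mon 0 (n - 1 - k - b) 0 + m = yz (n - 1) k then 1 else 0)
              = (if b = coef m Y then (if coef m X = 0 \<and> coef m Z = k then \<psi> m else 0) else 0)"
            unfolding * by auto
        qed simp
        finally show ?thesis by simp
      qed
      have "ev \<Phi> (px * (\<Sum>k<n. E k * v k) * mono_poly m)
          = (\<Sum>k<n. ev \<Phi> (px * E k * (v k * mono_poly m)))"
        by (simp add: sum_distrib_left sum_distrib_right ev_sum mult_ac)
      also have "\<dots> = (\<Sum>k<n. if k = coef m Z then (if coef m X = 0 \<and> coef m Y < n - k then \<psi> m else 0) else 0)"
      proof (rule sum.cong)
        fix k assume "k \<in> {..<n}"
        then have k: "k < n" by simp
        show "ev \<Phi> (px * E k * (v k * mono_poly m))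
            = (if k = coef m Z then (if coef m X = 0 \<and> coef m Y < n - k then \<psi> m else 0) else 0)"
          by (simp only: ev_E [OF k] vk [OF k]) auto
      qed simp
      also have "\<dots> = \<psi> m"
      proof (cases "\<psi> m = 0")
        case False
        then show ?thesis using \<psi>0 [OF False] \<psi>X [OF False] n by (auto simp: mdeg_def)
      qed (simp cong: if_cong)
      finally show ?thesis by (simp add: \<psi>_def right_diff_distrib left_diff_distrib ev_diff)
    qed
    then show ?thesis unfolding I_iff by (metis ev_mult_eq_0)
  qed
  ultimately show ?thesis by blast
qed

lemma g_lin: "g (\<lambda>k. a k + s * a' k) (\<lambda>j. c j + s * c' j) = g a c + s * g a' c'"
  by (simp add: g_def distrib_left sum.distrib sum_distrib_left mult_ac)

lemma g_in_I: "g a c \<in> I"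
  unfolding g_def I_def using G_in_I xE_in_I unfolding I_def
  by (intro ann_add ann_sum) (auto intro: ann_mult)

text \<open>Subtracting a combination of the \<open>G j\<close> leaves \<open>px * f2\<close>. Here
  \<open>f2\<close> itself need not be in \<open>I\<close>, but it is a combination of the
  \<open>E k\<close> plus an element of \<open>I\<close> with a smaller degree bound; multiplying by
  x turns the former into a combination of generators and leaves the latter to the
  induction.\<close>

lemma image_g_bounded:
  assumes "dle f (int e - 1)" "f \<in> I"
  shows "\<exists>a c. f = g a c"
  using assms
proof (induction e arbitrary: f)
  case 0
  then have "f = g (\<lambda>_. 0) (\<lambda>_. 0)" by (auto simp: g_def intro!: dle_neg [of _ "-1"])
  then show ?case by blast
next
  case (Suc e)
  have df: "dle f (int e)" using Suc.prems by simp
  have "n \<le> mdeg m" if "m \<in> Poly_Mapping.keys f" for m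
    using I_coef_eq_0 [OF Suc.prems(2), of m] that by (force simp: in_keys_iff)
  from reduce_mod_x [OF this df] obtain c where c: "\<And>j. j \<le> n \<Longrightarrow> dle (c j) (int e - int n)"
    "px dvd f - (\<Sum>j\<le>n. mono_poly (yz n j) * c j)" by blast
  define f1 where "f1 = f - g (\<lambda>_. 0) c"
  have "f1 = (f - (\<Sum>j\<le>n. mono_poly (yz n j) * c j)) + px * (\<Sum>j\<le>n. h j * c j)"
    by (simp add: f1_def g_def G_def algebra_simps sum_subtractf sum_distrib_left)
  then have "px dvd f1" using c(2) by simp
  moreover have "dle (G j) (int n)" if "j \<le> n" for j
    using homog_G [OF that] by (auto simp: homog_def dle_def)
  then have "dle f1 (int e)"
    unfolding f1_def g_def using c(1) df by (auto intro!: dle_diff dle_sum dle_mult [of _ "int n"])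
  ultimately obtain f2 where f2: "f1 = px * f2" "dle f2 (int e - 1)"
    by (rule pvar_dvd_quo)
  have f1I: "px * f2 \<in> I"
    unfolding f2(1) [symmetric] f1_def
    using Suc.prems(2) g_in_I [of "\<lambda>_. 0" c] unfolding I_def by (rule ann_diff)
  have "n - 1 \<le> mdeg m" if "m \<in> Poly_Mapping.keys f2" for m
  proof (rule ccontr)
    assume "\<not> n - 1 \<le> mdeg m"
    then have "coef (px * f2) (Poly_Mapping.single X 1 + m) = 0"
      by (intro I_coef_eq_0 [OF f1I]) (simp add: mdeg_add)
    then show False using that by (simp add: pvar_eq in_keys_iff)
  qed
  from dual_combination [OF f1I this f2(2)] obtain v where v: "\<And>k. k < n \<Longrightarrow> dle (v k) (int e - int n)"
    "f2 - (\<Sum>k<n. E k * v k) \<in> I" by auto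
  have "dle (E k) (int n - 1)" if "k < n" for k
    using homog_E [OF that] by (auto simp: homog_def dle_def)
  then have "dle (f2 - (\<Sum>k<n. E k * v k)) (int e - 1)"
    using v(1) f2(2) by (auto intro!: dle_diff dle_sum dle_mult [of _ "int n - 1" _ "int e - int n"])
  then obtain a' c' where ac: "f2 - (\<Sum>k<n. E k * v k) = g a' c'"
    using Suc.IH v(2) by blast
  have "f = g v c + px * g a' c'"
    unfolding ac [symmetric] using f2(1)
    by (simp add: f1_def g_def right_diff_distrib sum_distrib_left mult_ac) (simp add: algebra_simps)
  then have "f = g (\<lambda>k. v k + px * a' k) (\<lambda>j. c j + px * c' j)" by (simp add: g_lin)
  then show ?case by blast
qed

lemma image_g: "I = {g a c | a c. True}"
proof -
  have "\<exists>a c. f = g a c" if "f \<in> I" for f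
  proof -
    obtain e where "dle f (int e)" using dle_exists by blast
    then show ?thesis using image_g_bounded [of f "Suc e"] that by simp
  qed
  then show ?thesis using g_in_I by blast
qed

lemma G_mult_eq_0:
  assumes "G n * s = 0"
  shows "s = 0"
proof -
  have "coef (G n) (yz n n) = 1"
    by (simp add: G_def lookup_minus lookup_single coef_pvar_mult_mon)
  then have "G n \<noteq> 0" by auto
  then show ?thesis using assms by simp
qed

end

subsection \<open>Pfaffians\<close>

definition del :: "nat \<Rightarrow> 'a list \<Rightarrow> 'a list" where
  "del k l = take k l @ drop (Suc k) l"

lemma pf_Cons: "pf A (i # l) = (\<Sum>k<length l. (-1) ^ k * A $$ (i, l ! k) * pf A (del k l))"
  by (simp add: del_def)

declare pf.simps(2) [simp del]

lemma del_0 [simp]: "del 0 (x # l) = l"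
  by (simp add: del_def)

lemma del_Suc [simp]: "del (Suc k) (x # l) = x # del k l"
  by (simp add: del_def)

lemma del_append: "del (length u + k) (u @ l) = u @ del k l"
  by (simp add: del_def)

lemma length_del [simp]: "k < length l \<Longrightarrow> length (del k l) = length l - 1"
  by (simp add: del_def)

lemma set_del: "set (del k l) \<subseteq> set l"
  by (auto simp: del_def dest: in_set_takeD in_set_dropD)

lemma nth_del: "k < length l \<Longrightarrow> j < length l - 1 \<Longrightarrow> del k l ! j = (if j < k then l ! j else l ! Suc j)"
  by (auto simp: del_def nth_append min_def)

lemma del_del: "j < k \<Longrightarrow> k < length l \<Longrightarrow> del j (del k l) = del (k - 1) (del j l)"
  by (rule nth_equalityI) (auto simp: nth_del)

text \<open>The diagonal condition is separate because of characteristic 2; the index set confines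
  the condition to entries inside the matrix.\<close>

definition alternating_on :: "nat set \<Rightarrow> 'a::comm_ring_1 mat \<Rightarrow> bool" where
  "alternating_on S A \<longleftrightarrow> (\<forall>i\<in>S. A $$ (i, i) = 0) \<and> (\<forall>i\<in>S. \<forall>j\<in>S. A $$ (j, i) = - A $$ (i, j))"

text \<open>Expanding along two indices gives a sum over ordered pairs of removed positions. The
  pairs in \<open>L\<close> and \<open>U\<close> are the two orders, and exchanging \<open>i\<close>
  with \<open>j\<close> swaps the two partial sums up to sign. With one \<open>u\<close> for all
  \<open>i\<close>, \<open>j\<close>, both antisymmetry and vanishing for \<open>i = j\<close> can
  be read off without dividing by 2.\<close>

lemma pf_Cons_Cons:
  fixes A :: "'a::comm_ring_1 mat"
  shows "\<exists>u. \<forall>i j. pf A (i # j # l) = A $$ (i, j) * pf A l + u j i - u i j"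
proof -
  define t where "t = (\<lambda>i j (k, m). (-1) ^ (k + m) * A $$ (i, l ! k) * A $$ (j, del k l ! m) * pf A (del m (del k l)))"
  define L where "L = {(k, m). m < k \<and> k < length l}"
  define U where "U = {(k, m). k \<le> m \<and> m < length l - 1}"
  let ?n = "length l"
  have LU: "L \<union> U = {..<?n} \<times> {..<?n - 1}" "L \<inter> U = {}"
    by (auto simp: L_def U_def)
  then have fin: "finite L" "finite U"
    by (metis finite_Un finite_SigmaI finite_lessThan)+
  have 1: "pf A (i # j # l) = A $$ (i, j) * pf A l - (sum (t i j) L + sum (t i j) U)" for i j
  proof -
    have "pf A (i # j # l) = A $$ (i, j) * pf A l
        + (\<Sum>k<?n. (-1) ^ Suc k * A $$ (i, l ! k) * pf A (j # del k l))"
      by (simp add: pf_Cons [of A i] sum.lessThan_Suc_shift del: sum.lessThan_Suc)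
    also have "(\<Sum>k<?n. (-1) ^ Suc k * A $$ (i, l ! k) * pf A (j # del k l))
        = - (\<Sum>k<?n. \<Sum>m<?n - 1. t i j (k, m))"
      unfolding sum_negf [symmetric]
    proof (rule sum.cong)
      fix k assume "k \<in> {..<?n}"
      then have "pf A (j # del k l)
          = (\<Sum>m<?n - 1. (-1) ^ m * A $$ (j, del k l ! m) * pf A (del m (del k l)))"
        by (simp add: pf_Cons)
      then show "(-1) ^ Suc k * A $$ (i, l ! k) * pf A (j # del k l) = (\<Sum>m<?n - 1. - t i j (k, m))"
        by (simp add: sum_distrib_left power_add mult.assoc mult.left_commute sum_negf t_def)
    qed simp
    also have "(\<Sum>k<?n. \<Sum>m<?n - 1. t i j (k, m)) = sum (t i j) (L \<union> U)"
      unfolding LU by (simp add: sum.cartesian_product)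
    also have "\<dots> = sum (t i j) L + sum (t i j) U"
      using fin LU(2) by (rule sum.union_disjoint)
    finally show ?thesis by simp
  qed
  have 2: "sum (t i j) L = - sum (t j i) U" for i j
    unfolding sum_negf [symmetric]
  \<comment> \<open>Removing position \<open>k\<close> and then \<open>m < k\<close> leaves the same
    list as removing \<open>m\<close> first and then \<open>k - 1\<close>; the shift by one produces
    the sign.\<close>
  proof (rule sum.reindex_bij_witness [of _ "\<lambda>(k, m). (Suc m, k)" "\<lambda>(k, m). (m, k - 1)"])
    fix p assume "p \<in> L"
    then obtain k m where km: "p = (k, m)" "m < k" "k < ?n" by (auto simp: L_def)
    then have "(-1::'a) ^ (k + m) = - ((-1) ^ (m + (k - 1)))"
      by (cases k) (simp_all add: add.commute)
    moreover have "del (k - 1) (del m l) = del m (del k l)"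
      using km by (simp add: del_del)
    moreover have "del m l ! (k - 1) = l ! k" "del k l ! m = l ! m"
      using km by (auto simp: nth_del)
    ultimately show "- t j i (case p of (k, m) \<Rightarrow> (m, k - 1)) = t i j p"
      using km by (simp add: t_def algebra_simps)
  qed (auto simp: L_def U_def)
  have "pf A (i # j # l) = A $$ (i, j) * pf A l + sum (t j i) U - sum (t i j) U" for i j
    unfolding 1 2 by simp
  then show ?thesis by (intro exI [of _ "\<lambda>i j. sum (t i j) U"]) simp
qed

lemma pf_swap_first:
  fixes A :: "'a::comm_ring_1 mat"
  assumes "alternating_on S A" "i \<in> S" "j \<in> S"
  shows "pf A (i # j # l) = - pf A (j # i # l)"
proof -
  obtain u where "\<And>i j. pf A (i # j # l) = A $$ (i, j) * pf A l + u j i - u i j"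
    using pf_Cons_Cons by blast
  moreover have "A $$ (j, i) = - A $$ (i, j)" using assms unfolding alternating_on_def by blast
  ultimately show ?thesis by simp
qed

lemma pf_repeated_first:
  fixes A :: "'a::comm_ring_1 mat"
  assumes "alternating_on S A" "i \<in> S"
  shows "pf A (i # i # l) = 0"
proof -
  obtain u where "\<And>i j. pf A (i # j # l) = A $$ (i, j) * pf A l + u j i - u i j"
    using pf_Cons_Cons by blast
  moreover have "A $$ (i, i) = 0" using assms unfolding alternating_on_def by blast
  ultimately show ?thesis by simp
qed

text \<open>Expand along the first index. Terms that remove neither \<open>i\<close> nor
  \<open>j\<close> change sign by induction. The two that remove one of them are exchanged, and
  their signs differ because the positions do by one.\<close>

lemma pf_swap_adjacent:
  fixes A :: "'a::comm_ring_1 mat"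
  assumes "alternating_on S A" "set (u @ i # j # l) \<subseteq> S"
  shows "pf A (u @ i # j # l) = - pf A (u @ j # i # l)"
  using assms(2)
proof (induction "length (u @ i # j # l)" arbitrary: u i j l rule: less_induct)
  case less
  show ?case
  proof (cases u)
    case Nil
    then show ?thesis using pf_swap_first [OF assms(1), of i j l] less.prems by simp
  next
    case (Cons w u')
    let ?L = "u' @ i # j # l" and ?L' = "u' @ j # i # l"
    define \<sigma> where "\<sigma> = (\<lambda>k. if k = length u' then Suc k else if k = Suc (length u') then k - 1 else k)"
    have "pf A (w # ?L) = (\<Sum>k<length ?L. (-1) ^ k * A $$ (w, ?L ! k) * pf A (del k ?L))"
      by (rule pf_Cons)
    also have "\<dots> = (\<Sum>k<length ?L'. - ((-1) ^ k * A $$ (w, ?L' ! k) * pf A (del k ?L')))"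
    proof (rule sum.reindex_bij_witness [of _ \<sigma> \<sigma>])
      fix k assume "k \<in> {..<length ?L}"
      then have k: "k < length ?L" by simp
      show "\<sigma> (\<sigma> k) = k" by (simp add: \<sigma>_def)
      show "\<sigma> k \<in> {..<length ?L'}" using k by (auto simp: \<sigma>_def)
      consider (a) "k < length u'" | (b) "k = length u'" | (c) "k = Suc (length u')"
        | (d) "k > Suc (length u')" by linarith
      then show "- ((-1) ^ \<sigma> k * A $$ (w, ?L' ! \<sigma> k) * pf A (del (\<sigma> k) ?L'))
          = (-1) ^ k * A $$ (w, ?L ! k) * pf A (del k ?L)"
      proof cases
        case a
        have "pf A (del k u' @ i # j # l) = - pf A (del k u' @ j # i # l)"
          using less.prems set_del [of k u'] a Cons by (intro less.hyps) auto
        then show ?thesis using a by (simp add: \<sigma>_def del_def nth_append)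
      next
        case b
        then show ?thesis by (simp add: \<sigma>_def del_def nth_append)
      next
        case c
        then show ?thesis by (simp add: \<sigma>_def del_def nth_append)
      next
        case d
        then obtain r where r: "k = length u' + Suc (Suc r)" "r < length l"
          using k that [of "k - Suc (Suc (length u'))"] by simp
        have "pf A (u' @ i # j # del r l) = - pf A (u' @ j # i # del r l)"
          using less.prems set_del [of r l] r Cons by (intro less.hyps) auto
        moreover have "\<sigma> k = k" using d by (simp add: \<sigma>_def)
        ultimately show ?thesis unfolding \<open>\<sigma> k = k\<close> unfolding r del_append by (simp add: nth_append)
      qed
    next
      fix k assume "k \<in> {..<length ?L'}"
      then have k: "k < length ?L" by simp
      show "\<sigma> (\<sigma> k) = k" by (simp add: \<sigma>_def)
      show "\<sigma> k \<in> {..<length ?L}" using k by (auto simp: \<sigma>_def)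
    qed
    also have "\<dots> = - pf A (w # ?L')" by (simp add: pf_Cons sum_negf)
    finally show ?thesis using Cons by simp
  qed
qed

text \<open>Adjacent swaps carry the second occurrence of \<open>i\<close> to the left until it
  meets the first.\<close>

lemma pf_repeated:
  fixes A :: "'a::comm_ring_1 mat"
  assumes "alternating_on S A" "set (i # u @ i # l) \<subseteq> S"
  shows "pf A (i # u @ i # l) = 0"
  using assms(2)
proof (induction u arbitrary: l rule: rev_induct)
  case Nil
  then show ?case using assms(1) by (auto intro: pf_repeated_first)
next
  case (snoc w u)
  have "pf A ((i # u) @ w # i # l) = - pf A ((i # u) @ i # w # l)"
    using snoc.prems by (intro pf_swap_adjacent [OF assms(1)]) auto
  also have "pf A ((i # u) @ i # w # l) = 0"
    using snoc.IH [of "w # l"] snoc.prems by simp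
  finally show ?case by simp
qed

lemma filter_neq_upt: "j < m \<Longrightarrow> filter (\<lambda>i. i \<noteq> j) [0..<m] = del j [0..<m]"
proof -
  assume j: "j < m"
  then have "[0..<m] = [0..<j] @ j # [Suc j..<m]"
    by (metis less_imp_le_nat upt_add_eq_append upt_conv_Cons zero_le le_add_diff_inverse)
  moreover have "filter (\<lambda>i. i \<noteq> j) ([0..<j] @ j # [Suc j..<m]) = [0..<j] @ [Suc j..<m]"
    by (auto simp: filter_id_conv)
  ultimately show ?thesis using j by (simp add: del_def)
qed

text \<open>Row \<open>i\<close> times the signed Pfaffians is the expansion of the Pfaffian on the
  list of all indices with \<open>i\<close> put in front, and \<open>i\<close> occurs twice in that
  list.\<close>

lemma pfaff_row_kernel:
  fixes M :: "'a::comm_ring_1 mat"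
  assumes M: "M \<in> carrier_mat m m" "alternating_on {..<m} M" and i: "i < m"
  shows "(\<Sum>j<m. M $$ (i, j) * pfaff_row M $$ (0, j)) = 0"
proof -
  have "(\<Sum>j<m. M $$ (i, j) * pfaff_row M $$ (0, j)) = pf M (i # [0..<m])"
    using M(1) by (auto simp: pf_Cons pfaff_row_def filter_neq_upt intro!: sum.cong)
  also have "[0..<m] = [0..<i] @ i # [Suc i..<m]"
    using i by (metis less_imp_le_nat upt_add_eq_append upt_conv_Cons zero_le le_add_diff_inverse)
  also have "pf M (i # [0..<i] @ i # [Suc i..<m]) = 0"
    using i by (intro pf_repeated [OF M(2)]) auto
  finally show ?thesis .
qed

text \<open>Allows a Pfaffian to be computed after the variables have been specialized.\<close>

lemma pf_ring_hom:
  fixes \<phi> :: "'a::comm_ring_1 \<Rightarrow> 'b::comm_ring_1"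
  assumes hom: "\<phi> 0 = 0" "\<phi> 1 = 1" "\<And>a b. \<phi> (a + b) = \<phi> a + \<phi> b" "\<And>a b. \<phi> (a * b) = \<phi> a * \<phi> b"
    and A: "A \<in> carrier_mat m m" and l: "set l \<subseteq> {..<m}"
  shows "\<phi> (pf A l) = pf (map_mat \<phi> A) l"
  using l
proof (induction "length l" arbitrary: l rule: less_induct)
  case less
  have neg: "\<phi> (- a) = - \<phi> a" for a
    using hom(3) [of a "- a"] hom(1) by (simp add: eq_neg_iff_add_eq_0 add.commute)
  have pow: "\<phi> ((-1) ^ k) = (-1) ^ k" for k
    by (induction k) (simp_all add: hom neg)
  have sm: "\<phi> (sum f F) = (\<Sum>i\<in>F. \<phi> (f i))" for f :: "nat \<Rightarrow> 'a" and F
    by (induction F rule: infinite_finite_induct) (simp_all add: hom)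
  show ?case
  proof (cases l)
    case Nil
    then show ?thesis by (simp add: hom)
  next
    case (Cons i l')
    have "\<phi> (pf A (del k l')) = pf (map_mat \<phi> A) (del k l')" if "k < length l'" for k
      using less.prems Cons that set_del [of k l'] by (intro less.hyps) auto
    moreover have "\<phi> (A $$ (i, l' ! k)) = map_mat \<phi> A $$ (i, l' ! k)" if "k < length l'" for k
    proof -
      have "l' ! k \<in> set l'" using that by simp
      then have "l' ! k < m" "i < m" using less.prems Cons by auto
      then show ?thesis using A by simp
    qed
    ultimately show ?thesis by (simp add: Cons pf_Cons sm hom pow)
  qed
qed

text \<open>Every expansion runs along an index of the first half, where 1 is the only nonzero entry
  among the remaining indices. The sign is left open because the lemma serves to show
  nonvanishing.\<close>

lemma pf_antidiagonal_blocks: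
  fixes A :: "'a::comm_ring_1 mat"
  assumes "distinct l" "\<And>i j. i \<in> set l \<Longrightarrow> j \<in> set l \<Longrightarrow> A $$ (i, j) = 0"
    "\<And>i j. i \<in> set l \<Longrightarrow> j \<in> set l \<Longrightarrow> A $$ (i, n + j) = (if i = j then 1 else 0)"
  shows "\<exists>s. pf A (l @ map ((+) n) l) = (-1) ^ s"
  using assms
proof (induction l)
  case Nil
  then show ?case by (intro exI [of _ 0]) simp
next
  case (Cons i l)
  let ?L = "l @ (n + i) # map ((+) n) l"
  have "pf A (i # ?L) = (\<Sum>k<length ?L. if k = length l then (-1) ^ k * pf A (del k ?L) else 0)"
    unfolding pf_Cons
  proof (rule sum.cong)
    fix k assume k: "k \<in> {..<length ?L}"
    consider (a) "k < length l" | (b) "k = length l" | (c) "k > length l" by linarith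
    then show "(-1) ^ k * A $$ (i, ?L ! k) * pf A (del k ?L) = (if k = length l then (-1) ^ k * pf A (del k ?L) else 0)"
    proof cases
      case a
      then show ?thesis using Cons.prems(2) by (simp add: nth_append)
    next
      case b
      then show ?thesis using Cons.prems(3) by (simp add: nth_append)
    next
      case c
      define r where "r = k - Suc (length l)"
      have r: "k = Suc (length l + r)" "r < length l" using c k by (simp_all add: r_def)
      then have "l ! r \<in> set l" by simp
      then have "i \<noteq> l ! r" using Cons.prems(1) by auto
      then show ?thesis using r Cons.prems(3) by (simp add: nth_append)
    qed
  qed simp
  also have "\<dots> = (-1) ^ length l * pf A (l @ map ((+) n) l)"
    by (simp add: del_def)
  finally have *: "pf A (i # ?L) = (-1) ^ length l * pf A (l @ map ((+) n) l)" .
  obtain s where "pf A (l @ map ((+) n) l) = (-1) ^ s"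
    using Cons by auto
  then have "pf A ((i # l) @ map ((+) n) (i # l)) = (-1) ^ (length l + s)"
    using * by (simp add: power_add)
  then show ?case by blast
qed

subsection \<open>The monomial bases\<close>

text \<open>The x-free monomials form the tail of the ordered basis. This is why
  \<open>b2mat\<close> takes right-most columns and a bottom-right block.\<close>

lemma sym_basis_split:
  "sym_basis i = concat (map (\<lambda>a. map (\<lambda>b. mon a b (i - a - b)) (rev [0..<i - a + 1])) (rev [1..<i + 1]))
    @ map (\<lambda>b. mon 0 b (i - b)) (rev [0..<i + 1])"
proof -
  have "rev [0..<i + 1] = rev [1..<i + 1] @ [0]"
    by (subst upt_conv_Cons) auto
  then have *: "map f (rev [0..<i + 1]) = map f (rev [1..<i + 1]) @ [f 0]" for f :: "nat \<Rightarrow> mono list"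
    by simp
  show ?thesis unfolding sym_basis_def * by simp
qed

lemma length_sym_basis: "i + 1 \<le> length (sym_basis i)"
  by (simp add: sym_basis_split)

lemma sym_basis_last:
  assumes "k \<le> i"
  shows "sym_basis i ! (length (sym_basis i) - (i + 1) + k) = yz i k"
proof -
  have "rev [0..<i + 1] ! k = i - k" using assms by (simp add: rev_nth del: upt_Suc)
  then show ?thesis
    unfolding sym_basis_split using assms
    by (simp add: nth_append del: upt_Suc)
qed

lemma set_sym_basis: "set (sym_basis i) = {m. mdeg m = i}"
proof (rule Set.set_eqI)
  fix m
  have "m \<in> set (sym_basis i) \<longleftrightarrow> (\<exists>a\<le>i. \<exists>b\<le>i - a. m = mon a b (i - a - b))"
    by (auto simp: sym_basis_def less_Suc_eq_le image_iff Bex_def simp del: upt_Suc)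
  also have "\<dots> \<longleftrightarrow> mdeg m = i"
  proof
    assume "mdeg m = i"
    then have "m = mon (coef m X) (coef m Y) (i - coef m X - coef m Y)" "coef m X \<le> i" "coef m Y \<le> i - coef m X"
      by (auto simp: mdeg_def intro: mono_eqI)
    then show "\<exists>a\<le>i. \<exists>b\<le>i - a. m = mon a b (i - a - b)" by blast
  qed auto
  finally show "m \<in> set (sym_basis i) \<longleftrightarrow> m \<in> {m. mdeg m = i}" by simp
qed

lemma distinct_sym_basis: "distinct (sym_basis i)"
  unfolding sym_basis_def
proof (rule distinct_concat)
  let ?f = "\<lambda>a. map (\<lambda>b. mon a b (i - a - b)) (rev [0..<i - a + 1])"
  have X: "coef m X = a" if "m \<in> set (?f a)" for m a using that by auto
  have "inj_on ?f (set (rev [0..<i + 1]))"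
  proof (rule inj_onI)
    fix a a' assume eq: "?f a = ?f a'"
    have "mon a 0 (i - a) \<in> set (?f a)" by (auto simp del: upt_Suc intro!: image_eqI [of _ _ 0])
    then have "mon a 0 (i - a) \<in> set (?f a')" unfolding eq .
    from X [OF this] show "a = a'" by simp
  qed
  then show "distinct (map ?f (rev [0..<i + 1]))"
    unfolding distinct_map by simp
  fix ys assume ys: "ys \<in> set (map ?f (rev [0..<i + 1]))"
  then show "distinct ys" by (auto simp: distinct_map inj_on_def)
  fix zs assume zs: "zs \<in> set (map ?f (rev [0..<i + 1]))" and ne: "ys \<noteq> zs"
  obtain a where a: "ys = ?f a" using ys by auto
  obtain a' where a': "zs = ?f a'" using zs by auto
  show "set ys \<inter> set zs = {}"
  proof (rule ccontr)
    assume "set ys \<inter> set zs \<noteq> {}"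
    then obtain m where "m \<in> set ys" "m \<in> set zs" by blast
    then have "a = a'" using X a a' by metis
    then show False using ne a a' by simp
  qed
qed

lemma sym0_basis_nth: "j \<le> n \<Longrightarrow> sym0_basis n ! j = yz n j"
  by (simp add: sym0_basis_def nth_append del: upt_Suc)

section \<open>Forms and their coefficient vectors\<close>

definition lincomb :: "nat \<Rightarrow> (nat \<Rightarrow> 'k::comm_ring_1) \<Rightarrow> 'k poly3" where
  "lincomb d c = (\<Sum>i<length (sym_basis d). pconst (c i) * mono_poly (sym_basis d ! i))"

lemma homog_lincomb: "homog (lincomb d c) (int d)"
  unfolding lincomb_def
proof (intro homog_sum homog_pconst_mult homog_single)
  fix i assume "i \<in> {..<length (sym_basis d)}"
  then show "int d = int (mdeg (sym_basis d ! i))"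
    using set_sym_basis [of d] nth_mem [of i "sym_basis d"] by auto
qed

lemma coef_lincomb:
  assumes "l < length (sym_basis d)"
  shows "coef (lincomb d c) (sym_basis d ! l) = c l"
proof -
  have "coef (lincomb d c) (sym_basis d ! l) = (\<Sum>i<length (sym_basis d). if i = l then c i else 0)"
    unfolding lincomb_def lookup_sum
    by (rule sum.cong) (use assms in \<open>auto simp: lookup_single when_def nth_eq_iff_index_eq distinct_sym_basis\<close>)
  then show ?thesis using assms by simp
qed

lemma homog_eq_lincomb:
  fixes f :: "'k::comm_ring_1 poly3"
  assumes "homog f (int d)"
  shows "f = lincomb d (\<lambda>i. coef f (sym_basis d ! i))"
proof (rule poly_mapping_eqI)
  fix m
  show "coef f m = coef (lincomb d (\<lambda>i. coef f (sym_basis d ! i))) m"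
  proof (cases "mdeg m = d")
    case True
    then obtain l where "l < length (sym_basis d)" "m = sym_basis d ! l"
      using set_sym_basis [of d] by (metis (mono_tags) in_set_conv_nth mem_Collect_eq)
    then show ?thesis by (simp add: coef_lincomb)
  next
    case False
    then show ?thesis
      using homog_coef [OF assms] homog_coef [OF homog_lincomb] by (metis of_nat_eq_iff)
  qed
qed

lemma ev_lincomb: "ev w (lincomb d c * f) = (\<Sum>i<length (sym_basis d). c i * ev w (mono_poly (sym_basis d ! i) * f))"
  by (simp add: lincomb_def sum_distrib_right ev_sum mult.assoc ev_pconst_mult)

section \<open>The inverse catalecticant provides the dual forms\<close>

lemma mat_inv:
  fixes P :: "'a::field mat"
  assumes P: "P \<in> carrier_mat N N" and inv: "invertible_mat P"
  shows "mat_inv P \<in> carrier_mat N N" "P * mat_inv P = 1\<^sub>m N" "mat_inv P * P = 1\<^sub>m N"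
proof -
  obtain B where B: "inverts_mat P B" "inverts_mat B P"
    using inv unfolding invertible_mat_def by blast
  have PB: "P * B = 1\<^sub>m N" using B(1) P by (simp add: inverts_mat_def)
  then have "dim_col B = N" by (metis index_mult_mat(3) index_one_mat(3))
  moreover have BP: "B * P = 1\<^sub>m (dim_row B)" using B(2) by (simp add: inverts_mat_def)
  then have "dim_row B = N" using P by (metis carrier_matD(2) index_mult_mat(3) index_one_mat(3))
  ultimately have Bc: "B \<in> carrier_mat N N" and BP: "B * P = 1\<^sub>m N" using BP by auto
  have "mat_inv P = B"
    unfolding mat_inv_def
  proof (rule the_equality)
    show "B \<in> carrier_mat (dim_row P) (dim_row P) \<and> P * B = 1\<^sub>m (dim_row P) \<and> B * P = 1\<^sub>m (dim_row P)"
      using P Bc PB BP by auto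
    fix Q assume "Q \<in> carrier_mat (dim_row P) (dim_row P) \<and> P * Q = 1\<^sub>m (dim_row P) \<and> Q * P = 1\<^sub>m (dim_row P)"
    then have Q: "Q \<in> carrier_mat N N" "P * Q = 1\<^sub>m N" using P by auto
    have "Q = B * P * Q" using BP Q by simp
    also have "\<dots> = B * (P * Q)" using Bc P Q by (intro assoc_mult_mat)
    also have "\<dots> = B" using Q Bc by simp
    finally show "Q = B" .
  qed
  then show "mat_inv P \<in> carrier_mat N N" "P * mat_inv P = 1\<^sub>m N" "mat_inv P * P = 1\<^sub>m N"
    using Bc PB BP by auto
qed

lemma Pmat_carrier: "Pmat n \<Phi> \<in> carrier_mat (length (sym_basis (n - 1))) (length (sym_basis (n - 1)))"
  by (simp add: Pmat_def Let_def)

lemma Pmat_entry: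
  assumes "i < length (sym_basis (n - 1))" "j < length (sym_basis (n - 1))"
  shows "Pmat n \<Phi> $$ (i, j) = ev \<Phi> (px * mono_poly (sym_basis (n - 1) ! i) * mono_poly (sym_basis (n - 1) ! j))"
  using assms by (simp add: Pmat_def Let_def pvar_eq mult_single)

lemma mat_mult_entry:
  assumes "A \<in> carrier_mat a b" "B \<in> carrier_mat b c" "i < a" "j < c"
  shows "(A * B) $$ (i, j) = (\<Sum>k<b. A $$ (i, k) * B $$ (k, j))"
  using assms by (auto simp: scalar_prod_def atLeast0LessThan intro!: sum.cong)

locale invertible_catalecticant =
  fixes n :: nat and \<Phi> :: "mono \<Rightarrow> 'k::field"
  assumes n: "n \<ge> 1" and in_D: "in_D (2 * n - 1) \<Phi>" and inv: "invertible_mat (Pmat n \<Phi>)"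
begin

abbreviation "ms \<equiv> sym_basis (n - 1)"
definition "N = length ms"
definition "pinv = mat_inv (Pmat n \<Phi>)"
definition "T = transpose_mat (Rmat n \<Phi>) * pinv"

text \<open>The last \<open>n\<close> columns of the inverse belong to the x-free monomials, and a
  column of the inverse is the coefficient vector of a dual form. For \<open>h\<close>, row
  \<open>j\<close> of \<open>T\<close> solves the system whose right-hand side is column
  \<open>j\<close> of \<open>Rmat n \<Phi>\<close>, because \<open>p\<close> is symmetric.\<close>

definition E :: "nat \<Rightarrow> 'k poly3" where "E k = lincomb (n - 1) (\<lambda>l. pinv $$ (l, N - n + k))"
definition h :: "nat \<Rightarrow> 'k poly3" where "h j = lincomb (n - 1) (\<lambda>l. T $$ (j, l))"

lemma nN: "n \<le> N"
  using length_sym_basis [of "n - 1"] n by (simp add: N_def)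

lemma ms_last: "k < n \<Longrightarrow> ms ! (N - n + k) = yz (n - 1) k"
  using sym_basis_last [of k "n - 1"] n by (simp add: N_def)

lemma ms_nth: "mdeg m = n - 1 \<Longrightarrow> \<exists>i<N. m = ms ! i"
  using set_sym_basis [of "n - 1"] unfolding N_def by (metis (mono_tags) in_set_conv_nth mem_Collect_eq)

lemma Pmat_N: "Pmat n \<Phi> \<in> carrier_mat N N"
  unfolding N_def by (rule Pmat_carrier)

lemma Pmat_sym: "i < N \<Longrightarrow> j < N \<Longrightarrow> Pmat n \<Phi> $$ (i, j) = Pmat n \<Phi> $$ (j, i)"
  by (simp add: Pmat_entry N_def mult_ac)

lemma pinv: "pinv \<in> carrier_mat N N" "Pmat n \<Phi> * pinv = 1\<^sub>m N" "pinv * Pmat n \<Phi> = 1\<^sub>m N"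
  using mat_inv [OF Pmat_N inv] by (simp_all add: pinv_def)

lemma Rmat_N: "Rmat n \<Phi> \<in> carrier_mat N (n + 1)"
  by (simp add: Rmat_def Let_def N_def)

lemma Rmat_entry: "i < N \<Longrightarrow> j \<le> n \<Longrightarrow> Rmat n \<Phi> $$ (i, j) = ev \<Phi> (mono_poly (ms ! i) * mono_poly (yz n j))"
  by (simp add: Rmat_def Let_def N_def sym0_basis_nth mult_single)

lemma T_N: "T \<in> carrier_mat (n + 1) N"
  unfolding T_def using pinv(1) Rmat_N by (intro mult_carrier_mat [of _ _ N]) auto

lemma ev_lincomb_ms:
  assumes "i < N"
  shows "ev \<Phi> (px * lincomb (n - 1) c * mono_poly (ms ! i)) = (\<Sum>l<N. Pmat n \<Phi> $$ (i, l) * c l)"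
proof -
  have "ev \<Phi> (px * lincomb (n - 1) c * mono_poly (ms ! i)) = ev \<Phi> (lincomb (n - 1) c * (px * mono_poly (ms ! i)))"
    by (simp add: mult_ac)
  also have "\<dots> = (\<Sum>l<N. c l * ev \<Phi> (mono_poly (ms ! l) * (px * mono_poly (ms ! i))))"
    by (simp add: ev_lincomb N_def)
  also have "\<dots> = (\<Sum>l<N. Pmat n \<Phi> $$ (i, l) * c l)"
    using assms by (intro sum.cong) (auto simp: Pmat_entry N_def mult_ac)
  finally show ?thesis .
qed

sublocale dual_basis n \<Phi> h E
proof
  show "1 \<le> n" by (rule n)
  show "in_D (2 * n - 1) \<Phi>" by (rule in_D)
  have n1: "int n - 1 = int (n - 1)" using n by simp
  show "homog (E k) (int n - 1)" "homog (h k) (int n - 1)" for k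
    unfolding n1 E_def h_def by (rule homog_lincomb)+
  show "f = 0" if f: "homog f (int n - 1)" and
    z: "\<And>m. mdeg m = n - 1 \<Longrightarrow> ev \<Phi> (px * f * mono_poly m) = 0" for f
  proof -
    define c where "c i = coef f (ms ! i)" for i
    have fc: "f = lincomb (n - 1) c"
      unfolding c_def [abs_def] by (rule homog_eq_lincomb) (use f in \<open>simp only: n1\<close>)
    have row: "(\<Sum>l<N. Pmat n \<Phi> $$ (i, l) * c l) = 0" if "i < N" for i
    proof -
      have "ms ! i \<in> set ms" using that by (simp add: N_def)
      then have "mdeg (ms ! i) = n - 1" using set_sym_basis by blast
      from z [OF this] show ?thesis unfolding fc ev_lincomb_ms [OF that] .
    qed
    have "c k = 0" if k: "k < N" for k
    proof -
      have "c k = (\<Sum>l<N. (pinv * Pmat n \<Phi>) $$ (k, l) * c l)"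
        using k by (simp add: pinv(3) if_distrib [of "\<lambda>x. x * _"] cong: if_cong)
      also have "\<dots> = (\<Sum>l<N. \<Sum>i<N. pinv $$ (k, i) * (Pmat n \<Phi> $$ (i, l) * c l))"
        using mat_mult_entry [OF pinv(1) Pmat_N k]
        by (intro sum.cong) (auto simp: sum_distrib_right mult.assoc)
      also have "\<dots> = (\<Sum>i<N. pinv $$ (k, i) * (\<Sum>l<N. Pmat n \<Phi> $$ (i, l) * c l))"
        by (subst sum.swap) (simp add: sum_distrib_left)
      also have "\<dots> = 0" by (simp add: row)
      finally show ?thesis .
    qed
    then show ?thesis unfolding fc lincomb_def by (simp add: N_def)
  qed
  show "ev \<Phi> (px * E k * mono_poly m) = (if m = yz (n - 1) k then 1 else 0)"
    if k: "k < n" and m: "mdeg m = n - 1" for k m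
  proof -
    obtain i where i: "i < N" "m = ms ! i" using ms_nth [OF m] by blast
    have "ev \<Phi> (px * E k * mono_poly m) = (\<Sum>l<N. Pmat n \<Phi> $$ (i, l) * pinv $$ (l, N - n + k))"
      unfolding i(2) E_def by (rule ev_lincomb_ms [OF i(1)])
    also have "\<dots> = (Pmat n \<Phi> * pinv) $$ (i, N - n + k)"
      using mat_mult_entry [OF Pmat_N pinv(1) i(1)] k nN by simp
    also have "\<dots> = (if i = N - n + k then 1 else 0)"
      using i k nN by (simp add: pinv(2))
    also have "i = N - n + k \<longleftrightarrow> m = yz (n - 1) k"
      unfolding i(2) ms_last [OF k, symmetric] using i(1) k nN
      by (simp add: nth_eq_iff_index_eq distinct_sym_basis N_def)
    finally show ?thesis .
  qed
  show "ev \<Phi> (px * h j * mono_poly m) = \<Phi> (yz n j + m)"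
    if j: "j \<le> n" and m: "mdeg m = n - 1" for j m
  proof -
    obtain i where i: "i < N" "m = ms ! i" using ms_nth [OF m] by blast
    have "ev \<Phi> (px * h j * mono_poly m) = (\<Sum>l<N. Pmat n \<Phi> $$ (i, l) * T $$ (j, l))"
      unfolding i(2) h_def by (rule ev_lincomb_ms [OF i(1)])
    also have "\<dots> = (\<Sum>l<N. T $$ (j, l) * Pmat n \<Phi> $$ (l, i))"
      by (intro sum.cong) (use i Pmat_sym in auto)
    also have "\<dots> = (T * Pmat n \<Phi>) $$ (j, i)"
      using mat_mult_entry [OF T_N Pmat_N, of j i] j i by simp
    also have "T * Pmat n \<Phi> = transpose_mat (Rmat n \<Phi>) * (pinv * Pmat n \<Phi>)"
      unfolding T_def using pinv(1) Pmat_N Rmat_N by (intro assoc_mult_mat) auto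
    also have "\<dots> = transpose_mat (Rmat n \<Phi>)"
      using Rmat_N by (simp add: pinv(3))
    also have "transpose_mat (Rmat n \<Phi>) $$ (j, i) = Rmat n \<Phi> $$ (i, j)"
      using Rmat_N i j by simp
    also have "\<dots> = \<Phi> (yz n j + m)"
      using i j by (simp add: Rmat_entry mult_single add.commute)
    finally show ?thesis .
  qed
qed

lemma hc_eq: "i \<le> n \<Longrightarrow> k < n \<Longrightarrow> hc i k = T $$ (i, N - n + k)"
  unfolding hc_def ms_last [symmetric] h_def using nN by (simp add: coef_lincomb N_def)

lemma EE_eq: "l < n \<Longrightarrow> k < n \<Longrightarrow> EE l k = pinv $$ (N - n + l, N - n + k)"
  unfolding EE_def ms_last [symmetric] E_def using nN by (simp add: coef_lincomb N_def)

lemma hh_eq: "i \<le> n \<Longrightarrow> j \<le> n \<Longrightarrow> hh i j = (T * Rmat n \<Phi>) $$ (i, j)"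
  using mat_mult_entry [OF T_N Rmat_N, of i j]
  by (simp add: hh_def h_def ev_lincomb Rmat_entry N_def)

lemma b2mat_carrier: "b2mat n \<Phi> \<in> carrier_mat (2 * n + 1) (2 * n + 1)"
  by (auto simp: b2mat_def Let_def xmul_def)

text \<open>Identifies the prescribed matrix with the coordinates found in \<open>h_relation\<close>
  and \<open>E_relation\<close>.\<close>

lemma b2mat_entry:
  assumes "i < 2 * n + 1" "j < 2 * n + 1"
  shows "b2mat n \<Phi> $$ (i, j) = (if i < n then (if j < n then CA i j else CB i (j - n))
    else (if j < n then - CB j (i - n) else CD (i - n) (j - n)))"
proof -
  have fold: "mat_inv (Pmat n \<Phi>) = pinv" "transpose_mat (Rmat n \<Phi>) * pinv = T"
    "dim_row (Pmat n \<Phi>) = N"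
    using Pmat_N by (simp_all add: T_def pinv_def)
  consider (A) "i < n" "j < n" | (B) "i < n" "n \<le> j" | (C) "n \<le> i" "j < n" | (D) "n \<le> i" "n \<le> j"
    by linarith
  then show ?thesis
  proof cases
    case A
    then show ?thesis
      unfolding b2mat_def Let_def fold by (simp add: xmul_def CA_def \<alpha>_def hh_eq mult.commute)
  next
    case B
    then show ?thesis
      unfolding b2mat_def Let_def fold using assms
      by (auto simp: xmul_def CB_def \<beta>_def hc_eq mult.commute)
  next
    case C
    then show ?thesis
      unfolding b2mat_def Let_def fold using assms
      by (auto simp: xmul_def CB_def \<beta>_def hc_eq mult.commute)
  next
    case D
    then show ?thesis
      unfolding b2mat_def Let_def fold using assms
      by (auto simp: xmul_def CD_def \<delta>_def EE_eq mult.commute)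
  qed
qed

end

section \<open>Degrees and specialization of the Pfaffians\<close>

lemma pf_homog:
  assumes "\<And>i j. i < m \<Longrightarrow> j < m \<Longrightarrow> homog (A $$ (i, j)) 1" "set l \<subseteq> {..<m}" "length l = 2 * d"
  shows "homog (pf A l) (int d)"
  using assms(2,3)
proof (induction d arbitrary: l)
  case 0
  then show ?case by (simp add: homog_def)
next
  case (Suc d)
  then obtain i l' where l: "l = i # l'" "length l' = Suc (2 * d)" by (cases l) auto
  show ?case
    unfolding l(1) pf_Cons
  proof (rule homog_sum)
    fix k assume "k \<in> {..<length l'}"
    then have k: "k < length l'" by simp
    have "set l' \<subseteq> {..<m}" "i < m" using Suc.prems l by auto
    then have "l' ! k < m" "i < m" using nth_mem [OF k] by blast+
    then have "homog (A $$ (i, l' ! k)) 1" by (intro assms(1))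
    moreover have "homog (pf A (del k l')) (int d)"
      using Suc.prems l k set_del [of k l'] by (intro Suc.IH) auto
    moreover have "homog ((- 1) ^ k :: 'a poly3) 0"
      by (cases "even k") (auto simp: homog_def)
    ultimately show "homog ((- 1) ^ k * A $$ (i, l' ! k) * pf A (del k l')) (int (Suc d))"
      by (auto intro: homog_mult [OF homog_mult [OF _ _ refl]])
  qed
qed

text \<open>A functional that is multiplicative on monomials acts like evaluation at a
  point.\<close>

lemma ev_mult_hom:
  assumes "\<And>m m'. w (m + m') = w m * w m'"
  shows "ev w (f * f') = ev w f * ev w f'"
proof -
  have "ev w (f * mono_poly m) = ev w f * w m" for m
  proof -
    have "ev w (f * mono_poly m) = (\<Sum>m'\<in>Poly_Mapping.keys f. coef f m' * ev w (mono_poly m * mono_poly m'))"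
      by (subst mult.commute, subst ev_mult_sum) simp
    then show ?thesis
      by (simp add: mult_single assms ev_def [of w f] sum_distrib_left mult_ac)
  qed
  then show ?thesis
    by (subst ev_mult_sum) (simp add: ev_def [of w f'] sum_distrib_left mult_ac)
qed

lemma sum_blocks:
  fixes f :: "nat \<Rightarrow> 'a::comm_monoid_add"
  shows "(\<Sum>j<2 * n + 1. f j) = (\<Sum>j<n. f j) + (\<Sum>j\<le>n. f (n + j))"
proof -
  have "(\<Sum>j<n + k. f j) = (\<Sum>j<n. f j) + (\<Sum>j<k. f (n + j))" for k
    by (induction k) (simp_all add: add.assoc)
  from this [of "Suc n"] show ?thesis
    by (simp add: mult_2 lessThan_Suc_atMost)
qed

section \<open>The Pfaffian row and the assembled resolution\<close>

context invertible_catalecticant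
begin

abbreviation "b2 \<equiv> b2mat n \<Phi>"
abbreviation "b1 \<equiv> pfaff_row b2"

definition gen :: "nat \<Rightarrow> 'k poly3" where
  "gen j = (if j < n then px * E j else G (j - n))"

lemma homog_C:
  "homog (CA i k) 1" "homog (CB i j) 1" "homog (CD l j) 1"
proof -
  have x: "homog (px * pconst c) 1" for c :: 'k
    by (subst mult.commute) (intro homog_pconst_mult homog_pvar)
  show "homog (CA i k) 1" "homog (CB i j) 1" "homog (CD l j) 1"
    unfolding CA_def CB_def CD_def by (auto intro!: x homog_add homog_diff homog_uminus homog_pvar)
qed

lemma homog_b2: "i < 2 * n + 1 \<Longrightarrow> j < 2 * n + 1 \<Longrightarrow> homog (b2 $$ (i, j)) 1"
  by (simp add: b2mat_entry homog_C homog_uminus)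

lemma alternating_b2: "alternating_on {..<2 * n + 1} b2"
  unfolding alternating_on_def
proof (intro conjI ballI)
  show "b2 $$ (i, i) = 0" if "i \<in> {..<2 * n + 1}" for i
    using that by (simp add: b2mat_entry CA_alt(2) CD_alt(2))
  show "b2 $$ (j, i) = - b2 $$ (i, j)" if "i \<in> {..<2 * n + 1}" "j \<in> {..<2 * n + 1}" for i j
    using that CA_alt(1) [of j i] CD_alt(1) [of "j - n" "i - n"] by (simp add: b2mat_entry)
qed

lemma b2_mult:
  assumes v: "v \<in> carrier_vec (2 * n + 1)"
  shows "i < n \<Longrightarrow> (b2 *\<^sub>v v) $ i = r1 (\<lambda>k. v $ k) (\<lambda>j. v $ (n + j)) i"
    and "j \<le> n \<Longrightarrow> (b2 *\<^sub>v v) $ (n + j) = r2 (\<lambda>k. v $ k) (\<lambda>j. v $ (n + j)) j"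
proof -
  have "(b2 *\<^sub>v v) $ i = (\<Sum>j<2 * n + 1. b2 $$ (i, j) * v $ j)" if "i < 2 * n + 1" for i
    using that v b2mat_carrier by (auto simp: scalar_prod_def atLeast0LessThan intro!: sum.cong)
  then have *: "(b2 *\<^sub>v v) $ i = (\<Sum>k<n. b2 $$ (i, k) * v $ k) + (\<Sum>j\<le>n. b2 $$ (i, n + j) * v $ (n + j))"
    if "i < 2 * n + 1" for i
    using that by (simp only: sum_blocks)
  show "(b2 *\<^sub>v v) $ i = r1 (\<lambda>k. v $ k) (\<lambda>j. v $ (n + j)) i" if "i < n"
    using that by (subst *) (auto simp: r1_def b2mat_entry)
  show "(b2 *\<^sub>v v) $ (n + j) = r2 (\<lambda>k. v $ k) (\<lambda>j. v $ (n + j)) j" if "j \<le> n"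
    using that by (subst *) (auto simp: r2_def b2mat_entry sum_negf)
qed

lemma homog_b1:
  assumes "j < 2 * n + 1"
  shows "homog (b1 $$ (0, j)) (int n)"
proof -
  have dim: "dim_row b2 = 2 * n + 1" using b2mat_carrier by auto
  have len: "length (del j [0..<2 * n + 1]) = 2 * n" using assms by simp
  have "homog (pf b2 (del j [0..<2 * n + 1])) (int n)"
    using set_del [of j "[0..<2 * n + 1]"] len
    by (intro pf_homog [of "2 * n + 1"] homog_b2) auto
  moreover have "homog ((- 1) ^ j :: 'k poly3) 0"
    by (cases "even j") (auto simp: homog_def)
  ultimately have "homog ((- 1) ^ j * pf b2 (del j [0..<2 * n + 1])) (int n)"
    by (auto intro: homog_mult)
  then show ?thesis
    using assms by (simp add: pfaff_row_def dim filter_neq_upt del: upt_Suc)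
qed

text \<open>At the point x = y = 0, z = 1, encoded by \<open>w\<close>, the block \<open>A\<close>
  vanishes and \<open>B\<close> without its last column becomes the identity. So the Pfaffian
  omitting the last index specializes to 1 or -1.\<close>

lemma b1_nonzero: "b1 $$ (0, 2 * n) \<noteq> 0"
proof -
  define w where "w m = (if coef m X = 0 \<and> coef m Y = 0 then 1 else 0 :: 'k)" for m :: mono
  have w: "w (m + m') = w m * w m'" for m m' by (auto simp: w_def lookup_add)
  have hom: "ev w 0 = 0" "ev w 1 = 1" "\<And>a b. ev w (a + b) = ev w a + ev w b"
    "\<And>a b. ev w (a * b) = ev w a * ev w b"
    using ev_mono_poly [of w 0] by (simp_all add: ev_add ev_mult_hom [OF w]) (simp add: w_def)
  have vars: "ev w px = 0" "ev w py = 0" "ev w pz = 1"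
    by (simp_all add: pvar_eq w_def lookup_single)
  let ?A = "map_mat (ev w) b2"
  have "\<exists>s. pf ?A ([0..<n] @ map ((+) n) [0..<n]) = (-1) ^ s"
  proof (rule pf_antidiagonal_blocks)
    show "?A $$ (i, j) = 0" if "i \<in> set [0..<n]" "j \<in> set [0..<n]" for i j
      using that b2mat_carrier by (simp add: b2mat_entry CA_def hom vars)
    show "?A $$ (i, n + j) = (if i = j then 1 else 0)" if "i \<in> set [0..<n]" "j \<in> set [0..<n]" for i j
      using that b2mat_carrier by (auto simp: b2mat_entry CB_def hom vars ev_diff ev_uminus)
  qed simp
  then obtain s where s: "pf ?A ([0..<n] @ map ((+) n) [0..<n]) = (-1) ^ s" ..
  have "[0..<n] @ map ((+) n) [0..<n] = [0..<2 * n]"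
    by (rule nth_equalityI) (auto simp: nth_append)
  moreover have "set [0..<2 * n] \<subseteq> {..<2 * n + 1}" by auto
  ultimately have "ev w (pf b2 [0..<2 * n]) = (-1) ^ s"
    using pf_ring_hom [OF hom b2mat_carrier, of "[0..<2 * n]"] s by simp
  then have "pf b2 [0..<2 * n] \<noteq> 0" using hom(1) by force
  moreover have "dim_row b2 = 2 * n + 1" using b2mat_carrier by auto
  moreover have "del (2 * n) [0..<2 * n + 1] = [0..<2 * n]" by (simp add: del_def)
  ultimately show ?thesis
    by (simp add: pfaff_row_def filter_neq_upt del: upt_Suc)
qed

text \<open>Both the row of Pfaffians and the row of generators span the kernel of the alternating matrix
  \<open>b\<^sub>2\<close>, and their entries have the same degree.\<close>

lemma b1_eq:
  obtains u where "u \<noteq> 0" "\<And>j. j < 2 * n + 1 \<Longrightarrow> b1 $$ (0, j) = pconst u * gen j"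
proof -
  define v where "v = vec (2 * n + 1) (\<lambda>j. b1 $$ (0, j))"
  have v: "v \<in> carrier_vec (2 * n + 1)" by (simp add: v_def)
  have ker: "(b2 *\<^sub>v v) $ i = 0" if "i < 2 * n + 1" for i
  proof -
    have "(b2 *\<^sub>v v) $ i = (\<Sum>j<2 * n + 1. b2 $$ (i, j) * b1 $$ (0, j))"
      using that b2mat_carrier by (auto simp: v_def scalar_prod_def atLeast0LessThan intro!: sum.cong)
    then show ?thesis using pfaff_row_kernel [OF b2mat_carrier alternating_b2 that] by simp
  qed
  then have "r1 (\<lambda>k. v $ k) (\<lambda>j. v $ (n + j)) i = 0" if "i < n" for i
    using that b2_mult(1) [OF v, of i] by simp
  moreover have "r2 (\<lambda>k. v $ k) (\<lambda>j. v $ (n + j)) j = 0" if "j \<le> n" for j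
    using that b2_mult(2) [OF v, of j] ker [of "n + j"] by simp
  moreover have "dle (v $ j) (int (n + 1) - 1)" if "j < 2 * n + 1" for j
    using homog_b1 [OF that] that by (auto simp: v_def homog_def dle_def)
  \<comment> \<open>The Pfaffians have degree \<open>n\<close>, so with \<open>e = n + 1\<close> the
    factor \<open>s\<close> has degree at most 0.\<close>
  ultimately obtain s where s: "dle s (int (n + 1) - 1 - int n)" "\<forall>k<n. v $ k = px * E k * s"
    "\<forall>j\<le>n. v $ (n + j) = G j * s"
    using kernel_r_bounded [of "\<lambda>k. v $ k" "n + 1" "\<lambda>j. v $ (n + j)"] n by auto
  have s0: "s = pconst (coef s 0)"
  proof (rule poly_mapping_eqI)
    fix m show "coef s m = coef (pconst (coef s 0)) m"
      using s(1) by (cases "m = 0") (auto simp: pconst_def lookup_single dle_def mdeg_eq_0_iff in_keys_iff)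
  qed
  have b1: "b1 $$ (0, j) = pconst (coef s 0) * gen j" if j: "j < 2 * n + 1" for j
  proof -
    have "v $ j = gen j * s"
    proof (cases "j < n")
      case False
      then have "v $ (n + (j - n)) = G (j - n) * s" using s(3) [rule_format, of "j - n"] j by simp
      then show ?thesis using False by (simp add: gen_def)
    qed (use s(2) in \<open>simp add: gen_def\<close>)
    then show ?thesis using s0 j by (simp add: v_def mult.commute)
  qed
  moreover have "coef s 0 \<noteq> 0" using b1 [of "2 * n"] b1_nonzero by auto
  ultimately show ?thesis using that by blast
qed

lemma g_gen: "g (\<lambda>k. v $ k) (\<lambda>j. v $ (n + j)) = (\<Sum>j<2 * n + 1. gen j * v $ j)"
  unfolding g_def sum_blocks by (simp add: gen_def)

text \<open>The Pfaffian row is a unit \<open>u\<close> times the row of generators, so exactness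
  proved for \<open>g\<close>, \<open>r1\<close> and \<open>r2\<close> transfers after compensating
  with the inverse of \<open>u\<close>. Minimality holds because all entries are homogeneous of
  positive degree.\<close>

lemma resolution:
  "min_hom_res I [b1, b2, transpose_mat b1]
    [[0], replicate (2 * n + 1) n, replicate (2 * n + 1) (n + 1), [2 * n + 1]]"
proof -
  let ?m = "2 * n + 1"
  have dim: "dim_row b2 = ?m" "dim_col b2 = ?m" using b2mat_carrier by auto
  have b1c: "b1 \<in> carrier_mat 1 ?m" by (simp add: pfaff_row_def dim)
  obtain u where u: "u \<noteq> 0" "\<And>j. j < ?m \<Longrightarrow> b1 $$ (0, j) = pconst u * gen j"
    using b1_eq by blast
  have unit: "pconst (inverse u) * pconst u = 1"
    using u(1) by (simp only: pconst_simps [symmetric]) simp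
  have unit': "pconst u * f = 0 \<longleftrightarrow> f = 0" for f
    using unit by auto
  have unit2: "pconst u * pconst (inverse u) = 1"
    using unit by (simp only: mult.commute)
  have b1v: "(b1 *\<^sub>v v) $ 0 = pconst u * g (\<lambda>k. v $ k) (\<lambda>j. v $ (n + j))" if "v \<in> carrier_vec ?m" for v
  proof -
    have "(b1 *\<^sub>v v) $ 0 = (\<Sum>j<?m. b1 $$ (0, j) * v $ j)"
      using that b1c by (auto simp: scalar_prod_def atLeast0LessThan intro!: sum.cong)
    also have "\<dots> = (\<Sum>j<?m. pconst u * (gen j * v $ j))"
      by (rule sum.cong) (auto simp: u(2) mult.assoc)
    finally show ?thesis by (simp only: g_gen sum_distrib_left)
  qed
  have b3w: "(transpose_mat b1 *\<^sub>v w) $ j = pconst u * gen j * w $ 0" if "w \<in> carrier_vec 1" "j < ?m" for w j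
    using that b1c u(2) [of j] by (simp add: scalar_prod_def)
  have image: "I = {(b1 *\<^sub>v v) $ 0 | v. v \<in> carrier_vec ?m}"
  proof (intro Set.set_eqI iffI)
    fix f assume "f \<in> I"
    then have "pconst (inverse u) * f \<in> I" unfolding I_def by (rule ann_mult_left)
    then obtain a c where ac: "pconst (inverse u) * f = g a c" using image_g by blast
    define v where "v = vec ?m (\<lambda>i. if i < n then a i else c (i - n))"
    have v: "v \<in> carrier_vec ?m" by (simp add: v_def)
    have "g (\<lambda>k. v $ k) (\<lambda>j. v $ (n + j)) = g a c"
      by (rule g_cong) (simp_all add: v_def)
    then have "(b1 *\<^sub>v v) $ 0 = pconst u * (pconst (inverse u) * f)"
      using b1v [OF v] ac by simp
    also have "\<dots> = f" by (simp only: mult.assoc [symmetric] unit2 mult_1)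
    finally show "f \<in> {(b1 *\<^sub>v v) $ 0 | v. v \<in> carrier_vec ?m}" using v by blast
  next
    fix f assume "f \<in> {(b1 *\<^sub>v v) $ 0 | v. v \<in> carrier_vec ?m}"
    then obtain v where "f = pconst u * g (\<lambda>k. v $ k) (\<lambda>j. v $ (n + j))" using b1v by auto
    then show "f \<in> I"
      using ann_mult_left [OF g_in_I [unfolded I_def]] by (simp add: I_def)
  qed
  have eq0: "v = 0\<^sub>v m \<longleftrightarrow> (\<forall>i<m. v $ i = 0)" if "v \<in> carrier_vec m" for v :: "'k poly3 vec" and m
    using that by (auto intro!: eq_vecI)
  have ex0: "b1 *\<^sub>v v = 0\<^sub>v 1 \<longleftrightarrow> (\<exists>w\<in>carrier_vec ?m. v = b2 *\<^sub>v w)" if v: "v \<in> carrier_vec ?m" for v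
  proof -
    have "b1 *\<^sub>v v = 0\<^sub>v 1 \<longleftrightarrow> (b1 *\<^sub>v v) $ 0 = 0"
      using eq0 [OF mult_mat_vec_carrier [OF b1c v]] by (simp only: less_one simp_thms)
    also have "\<dots> \<longleftrightarrow> g (\<lambda>k. v $ k) (\<lambda>j. v $ (n + j)) = 0"
      by (simp only: b1v [OF v] unit')
    also have "\<dots> \<longleftrightarrow> (\<exists>w\<in>carrier_vec ?m. v = b2 *\<^sub>v w)"
    proof
      assume "g (\<lambda>k. v $ k) (\<lambda>j. v $ (n + j)) = 0"
      then obtain p q where pq: "\<And>i. i < n \<Longrightarrow> v $ i = r1 p q i" "\<And>j. j \<le> n \<Longrightarrow> v $ (n + j) = r2 p q j"
        using kernel_g by blast
      define w where "w = vec ?m (\<lambda>i. if i < n then p i else q (i - n))"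
      have w: "w \<in> carrier_vec ?m" by (simp add: w_def)
      have r: "r1 (\<lambda>k. w $ k) (\<lambda>j. w $ (n + j)) = r1 p q" "r2 (\<lambda>k. w $ k) (\<lambda>j. w $ (n + j)) = r2 p q"
        by (simp_all add: r1_def r2_def fun_eq_iff w_def)
      have "v = b2 *\<^sub>v w"
      proof (rule eq_vecI)
        fix i assume "i < dim_vec (b2 *\<^sub>v w)"
        then have i: "i < ?m" by (simp add: dim)
        show "v $ i = (b2 *\<^sub>v w) $ i"
        proof (cases "i < n")
          case True
          then show ?thesis using b2_mult(1) [OF w True] pq(1) r by simp
        next
          case False
          then have "v $ (n + (i - n)) = (b2 *\<^sub>v w) $ (n + (i - n))"
            using i b2_mult(2) [OF w, of "i - n"] pq(2) [of "i - n"] r by simp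
          then show ?thesis using False by simp
        qed
      qed (use v in \<open>simp add: dim\<close>)
      then show "\<exists>w\<in>carrier_vec ?m. v = b2 *\<^sub>v w" using w by blast
    next
      assume "\<exists>w\<in>carrier_vec ?m. v = b2 *\<^sub>v w"
      then obtain w where w: "w \<in> carrier_vec ?m" "v = b2 *\<^sub>v w" by blast
      have "g (\<lambda>k. v $ k) (\<lambda>j. v $ (n + j))
          = g (r1 (\<lambda>k. w $ k) (\<lambda>j. w $ (n + j))) (r2 (\<lambda>k. w $ k) (\<lambda>j. w $ (n + j)))"
        unfolding w(2) by (rule g_cong) (simp_all add: b2_mult [OF w(1)])
      then show "g (\<lambda>k. v $ k) (\<lambda>j. v $ (n + j)) = 0" by (simp add: g_r)
    qed
    finally show ?thesis .
  qed
  have ex1: "b2 *\<^sub>v v = 0\<^sub>v ?m \<longleftrightarrow> (\<exists>w\<in>carrier_vec 1. v = transpose_mat b1 *\<^sub>v w)"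
    if v: "v \<in> carrier_vec ?m" for v
  proof -
    have z: "b2 *\<^sub>v v = 0\<^sub>v ?m \<longleftrightarrow> (\<forall>i<n. r1 (\<lambda>k. v $ k) (\<lambda>j. v $ (n + j)) i = 0) \<and>
        (\<forall>j\<le>n. r2 (\<lambda>k. v $ k) (\<lambda>j. v $ (n + j)) j = 0)"
    proof -
      have "(\<forall>i<?m. (b2 *\<^sub>v v) $ i = 0) \<longleftrightarrow> (\<forall>i<n. (b2 *\<^sub>v v) $ i = 0) \<and> (\<forall>j\<le>n. (b2 *\<^sub>v v) $ (n + j) = 0)"
      proof (intro iffI allI impI)
        fix i assume a: "(\<forall>i<n. (b2 *\<^sub>v v) $ i = 0) \<and> (\<forall>j\<le>n. (b2 *\<^sub>v v) $ (n + j) = 0)" "i < ?m"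
        show "(b2 *\<^sub>v v) $ i = 0"
        proof (cases "i < n")
          case False
          then have "i - n \<le> n" "i = n + (i - n)" using a by auto
          then show ?thesis using a by metis
        qed (use a in blast)
      qed auto
      moreover have "b2 *\<^sub>v v \<in> carrier_vec ?m" using b2mat_carrier v by auto
      ultimately show ?thesis using eq0 [of "b2 *\<^sub>v v" ?m] b2_mult [OF v] by simp
    qed
    show ?thesis
      unfolding z
    proof
      assume "(\<forall>i<n. r1 (\<lambda>k. v $ k) (\<lambda>j. v $ (n + j)) i = 0) \<and> (\<forall>j\<le>n. r2 (\<lambda>k. v $ k) (\<lambda>j. v $ (n + j)) j = 0)"
      then obtain s where s: "\<And>k. k < n \<Longrightarrow> v $ k = px * E k * s" "\<And>j. j \<le> n \<Longrightarrow> v $ (n + j) = G j * s"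
        using kernel_r by blast
      define w where "w = vec 1 (\<lambda>_. pconst (inverse u) * s)"
      have w: "w \<in> carrier_vec 1" by (simp add: w_def)
      have "v = transpose_mat b1 *\<^sub>v w"
      proof (rule eq_vecI)
        fix i assume "i < dim_vec (transpose_mat b1 *\<^sub>v w)"
        then have i: "i < ?m" using b1c by simp
        have "v $ i = gen i * s"
        proof (cases "i < n")
          case False
          then have "v $ (n + (i - n)) = G (i - n) * s" using s(2) [of "i - n"] i by simp
          then show ?thesis using False by (simp add: gen_def)
        qed (simp add: s gen_def)
        also have "\<dots> = (pconst (inverse u) * pconst u) * (gen i * s)" by (simp add: unit)
        also have "\<dots> = (transpose_mat b1 *\<^sub>v w) $ i"
          unfolding b3w [OF w i] by (simp add: w_def mult_ac)
        finally show "v $ i = (transpose_mat b1 *\<^sub>v w) $ i" .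
      qed (use v b1c in simp)
      then show "\<exists>w\<in>carrier_vec 1. v = transpose_mat b1 *\<^sub>v w" using w by blast
    next
      assume "\<exists>w\<in>carrier_vec 1. v = transpose_mat b1 *\<^sub>v w"
      then obtain w where w: "w \<in> carrier_vec 1" "v = transpose_mat b1 *\<^sub>v w" by blast
      let ?s = "pconst u * w $ 0"
      have "v $ i = gen i * ?s" if "i < ?m" for i
        using that w b3w [OF w(1) that] by (simp add: mult_ac)
      then have vs: "k < n \<Longrightarrow> v $ k = px * E k * ?s" "j \<le> n \<Longrightarrow> v $ (n + j) = G j * ?s" for k j
        by (simp_all add: gen_def)
      have "r1 (\<lambda>k. v $ k) (\<lambda>j. v $ (n + j)) i = r1 (\<lambda>k. px * E k * ?s) (\<lambda>j. G j * ?s) i"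
        "r2 (\<lambda>k. v $ k) (\<lambda>j. v $ (n + j)) i = r2 (\<lambda>k. px * E k * ?s) (\<lambda>j. G j * ?s) i" for i
        by (simp_all add: r1_def r2_def vs)
      then show "(\<forall>i<n. r1 (\<lambda>k. v $ k) (\<lambda>j. v $ (n + j)) i = 0) \<and>
          (\<forall>j\<le>n. r2 (\<lambda>k. v $ k) (\<lambda>j. v $ (n + j)) j = 0)"
        by (simp add: r_g)
    qed
  qed
  have inj: "w = 0\<^sub>v 1" if w: "w \<in> carrier_vec 1" "transpose_mat b1 *\<^sub>v w = 0\<^sub>v ?m" for w
  proof -
    have "pconst u * gen (2 * n) * w $ 0 = 0"
      using b3w [OF w(1), of "2 * n"] w(2) by simp
    then have "G n * w $ 0 = 0"
      using unit' [of "gen (2 * n) * w $ 0"] n by (simp add: gen_def mult.assoc)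
    then have "w $ 0 = 0" by (rule G_mult_eq_0)
    then show ?thesis using w(1) by (auto intro!: eq_vecI)
  qed
  have h1: "homog (b1 $$ (0, j)) (int n)" "in_max_ideal (b1 $$ (0, j))" if "j < ?m" for j
    using homog_b1 [OF that] homog_in_max_ideal [OF homog_b1 [OF that]] n by auto
  have h2: "homog (b2 $$ (i, j)) 1" "in_max_ideal (b2 $$ (i, j))" if "i < ?m" "j < ?m" for i j
    using homog_b2 [OF that] homog_in_max_ideal [OF homog_b2 [OF that]] by auto
  have t: "transpose_mat b1 $$ (j, 0) = b1 $$ (0, j)" if "j < ?m" for j
    using b1c that by simp
  have all3: "(\<forall>k<3. P k) \<longleftrightarrow> P 0 \<and> P 1 \<and> P 2" for P :: "nat \<Rightarrow> bool"
    by (simp add: eval_nat_numeral All_less_Suc conj_commute conj_left_commute)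
  have all2: "(\<forall>k. k + 1 < 3 \<longrightarrow> P k) \<longleftrightarrow> P 0 \<and> P 1" for P :: "nat \<Rightarrow> bool"
    by (auto simp: less_Suc_eq eval_nat_numeral)
  have len: "length [b1, b2, transpose_mat b1] = 3" by simp
  define m where "m = 2 * n + 1"
  have h3: "homog (b1 $$ (0, j)) (int m - int (n + 1))" if "j < m" for j
    using h1(1) that by (simp add: m_def)
  show ?thesis
    unfolding min_hom_res_def len all3 all2 m_def [symmetric]
    using b1c [folded m_def] b2mat_carrier [folded m_def] image [folded m_def] ex0 [folded m_def]
      ex1 [folded m_def] inj [folded m_def] h1 [folded m_def] h2 [folded m_def] h3 t [folded m_def]
    by simp
qed

end

subsection \<open>Linear presentation forces the catalecticant to be invertible\<close>

text \<open>Independent rows can be given arbitrary values by one vector. When a row is added, a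
  vector \<open>q0\<close> is needed that is orthogonal to the old rows but not to the new one; a
  multiple of it then corrects the solution for the old rows.\<close>

lemma independent_rows_surjective:
  fixes K :: "'a \<Rightarrow> 'b \<Rightarrow> 'k::field"
  assumes "finite F" "finite T"
    and "\<And>c. (\<And>t. t \<in> T \<Longrightarrow> (\<Sum>m\<in>F. c m * K m t) = 0) \<Longrightarrow> (\<And>m. m \<in> F \<Longrightarrow> c m = 0)"
  shows "\<exists>q. \<forall>m\<in>F. (\<Sum>t\<in>T. q t * K m t) = \<rho> m"
  using assms(1,3)
proof (induction F arbitrary: \<rho> rule: finite_induct)
  case (insert x F)
  let ?b = "\<lambda>q m. \<Sum>t\<in>T. q t * K m t"
  have ind: "c m = 0" if z: "\<And>t. t \<in> T \<Longrightarrow> (\<Sum>m\<in>F. c m * K m t) = 0" and m: "m \<in> F" for c m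
  proof -
    have "(\<Sum>m\<in>insert x F. (if m = x then 0 else c m) * K m t) = (\<Sum>m\<in>F. c m * K m t)" for t
      using insert.hyps by (auto intro!: sum.cong)
    then have "(if m = x then 0 else c m) = 0"
      by (intro insert.prems [of "\<lambda>m. if m = x then 0 else c m"]) (use z m in auto)
    then show ?thesis using m insert.hyps by (auto split: if_splits)
  qed
  have ex: "\<exists>q. \<forall>m\<in>F. ?b q m = \<sigma> m" for \<sigma>
    using insert.IH [of \<sigma>] ind by blast
  obtain q where q: "\<forall>m\<in>F. ?b q m = \<rho> m" using ex by blast
  have "\<forall>m. \<exists>q. \<forall>m'\<in>F. ?b q m' = (if m' = m then 1 else 0)" by (intro allI ex)
  then obtain d where d: "\<And>m m'. m' \<in> F \<Longrightarrow> ?b (d m) m' = (if m' = m then 1 else 0)" by metis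
  \<comment> \<open>The new row minus its combination of old rows obtained by pairing it with the
    dual vectors \<open>d\<close>. Independence provides a nonzero entry \<open>t\<close>, and
    \<open>q0\<close> is the unit vector at \<open>t\<close> made orthogonal to the old
    rows.\<close>
  define c where "c m = (if m = x then 1 else - ?b (d m) x)" for m
  have "\<exists>t\<in>T. (\<Sum>m\<in>insert x F. c m * K m t) \<noteq> 0"
  proof (rule ccontr)
    assume "\<not> ?thesis"
    then have "c x = 0" by (intro insert.prems [of c]) auto
    then show False by (simp add: c_def)
  qed
  then obtain t where t: "t \<in> T" "(\<Sum>m\<in>insert x F. c m * K m t) \<noteq> 0" by blast
  define q0 where "q0 u = (if u = t then 1 else 0) - (\<Sum>m\<in>F. K m t * d m u)" for u
  have q0: "?b q0 m' = K m' t - (\<Sum>m\<in>F. K m t * ?b (d m) m')" for m'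
  proof -
    have "?b q0 m' = (\<Sum>u\<in>T. (if u = t then K m' u else 0)) - (\<Sum>u\<in>T. \<Sum>m\<in>F. K m t * (d m u * K m' u))"
      unfolding sum_subtractf [symmetric]
      by (rule sum.cong) (auto simp: q0_def right_diff_distrib sum_distrib_left mult_ac)
    also have "(\<Sum>u\<in>T. \<Sum>m\<in>F. K m t * (d m u * K m' u)) = (\<Sum>m\<in>F. K m t * ?b (d m) m')"
      by (subst sum.swap) (simp add: sum_distrib_left)
    finally show ?thesis using t(1) assms(2) by simp
  qed
  have q0F: "?b q0 m' = 0" if "m' \<in> F" for m'
    unfolding q0 using that insert.hyps(1)
    by (simp add: d if_distrib [of "\<lambda>x. _ * x"] cong: if_cong)
  have "?b q0 x = (\<Sum>m\<in>insert x F. c m * K m t)"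
  proof -
    have "(\<Sum>m\<in>F. c m * K m t) = (\<Sum>m\<in>F. - (K m t * ?b (d m) x))"
      using insert.hyps by (intro sum.cong) (auto simp: c_def mult_ac)
    then show ?thesis using insert.hyps by (simp add: q0 c_def sum_negf)
  qed
  then have q0x: "?b q0 x \<noteq> 0" using t(2) by simp
  define e where "e = (\<rho> x - ?b q x) / ?b q0 x"
  have b: "?b (\<lambda>u. q u + e * q0 u) m = ?b q m + e * ?b q0 m" for m
    by (simp add: distrib_right sum.distrib sum_distrib_left mult.assoc)
  have "\<forall>m\<in>insert x F. ?b (\<lambda>u. q u + e * q0 u) m = \<rho> m"
    unfolding b using q q0F q0x by (auto simp: e_def)
  then show ?case by (intro exI [of _ "\<lambda>u. q u + e * q0 u"])
qed simp

section \<open>The Koszul complex on x, y, z\<close>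

lemma max_ideal_decomposition:
  fixes f :: "'k::comm_ring_1 poly3"
  assumes "coef f 0 = 0"
  obtains u v w where "f = px * u + py * v + pz * w"
proof -
  define u where "u = mquo (Poly_Mapping.single X 1) f"
  define f1 where "f1 = f - px ^ 1 * u"
  define v where "v = mquo (Poly_Mapping.single Y 1) f1"
  define f2 where "f2 = f1 - py ^ 1 * v"
  have f1: "coef f1 m = (if coef m X = 0 then coef f m else 0)" for m
    by (simp only: f1_def u_def lookup_minus coef_pvar_power_mult_mquo) auto
  have f2: "coef f2 m = (if coef m X = 0 \<and> coef m Y = 0 then coef f m else 0)" for m
    by (simp only: f2_def v_def lookup_minus coef_pvar_power_mult_mquo f1) auto
  have "pz dvd f2"
    unfolding pvar_dvd_iff
  proof (intro allI impI)
    fix m :: mono assume "coef m Z = 0"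
    then have "m = 0" if "coef m X = 0" "coef m Y = 0" using that by (intro mono_eqI) auto
    then show "coef f2 m = 0" using assms by (auto simp: f2)
  qed
  then obtain w where "f2 = pz * w" by blast
  then have "f = px * u + py * v + pz * w" by (simp add: f2_def f1_def algebra_simps)
  then show ?thesis by (rule that)
qed

text \<open>Every relation between x, y, z is a combination of the Koszul ones. Modulo x,
  coprimality of y and z determines \<open>C\<close>; after substitution y can be cancelled modulo x
  to determine \<open>B\<close>, and cancelling x gives \<open>A\<close>.\<close>

lemma koszul_exact:
  fixes A B C :: "'k::field poly3"
  assumes "px * A + py * B + pz * C = 0"
  obtains P Q S where "A = py * S - pz * Q" "B = pz * P - px * S" "C = px * Q - py * P"
proof -
  have "py ^ 1 * B + pz ^ 1 * C = px * (- A)"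
    using assms by (simp add: algebra_simps add_eq_0_iff)
  then have "px dvd py ^ 1 * B + pz ^ 1 * C" by (metis dvd_triv_left)
  then have "px dvd C - py ^ 1 * mquo (Poly_Mapping.single Y 1) C"
    by (rule pvar_dvd_coprime) auto
  then obtain Q where Q: "C - py ^ 1 * mquo (Poly_Mapping.single Y 1) C = px * Q" by blast
  define P where "P = - mquo (Poly_Mapping.single Y 1) C"
  have C: "C = px * Q - py * P" using Q by (simp add: P_def algebra_simps)
  have "py ^ 1 * (B - pz * P) = px * (- (A + pz * Q))"
    using assms unfolding C by (simp add: algebra_simps add_eq_0_iff)
  then have "px dvd py ^ 1 * (B - pz * P)" by (metis dvd_triv_left)
  then have "px dvd B - pz * P" by (rule pvar_dvd_power_mult_cancel) simp
  then obtain S where S: "B - pz * P = px * S" by blast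
  have B: "B = pz * P - px * (- S)" using S by (simp add: algebra_simps)
  have "px * (A - (py * (- S) - pz * Q)) = 0"
    using assms unfolding C B by (simp add: algebra_simps)
  then have "A = py * (- S) - pz * Q" by simp
  then show ?thesis using B C by (rule that)
qed

text \<open>Exactness one step further along: a vector whose cross product with (x, y, z) vanishes
  is a multiple of (x, y, z).\<close>

lemma koszul_cycle:
  fixes p q r :: "'k::field poly3"
  assumes "py * r = pz * q" "pz * p = px * r" "px * q = py * p"
  obtains c where "p = px * c" "q = py * c" "r = pz * c"
proof -
  have "px dvd pz ^ 1 * p" using assms(2) by simp
  then have "px dvd p" by (rule pvar_dvd_power_mult_cancel) simp
  then obtain c where c: "p = px * c" by blast
  have "px * q = px * (py * c)" "px * r = px * (pz * c)" using assms c by (simp_all add: mult_ac)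
  then have "q = py * c" "r = pz * c" by (simp_all only: mult_cancel_left) simp_all
  then show ?thesis using c that by blast
qed

text \<open>\<open>t\<close> and \<open>s\<close> are the twists of \<open>F\<^sub>1\<close> and \<open>F\<^sub>2\<close>; \<open>col l\<close> is column \<open>l\<close> of \<open>d\<^sub>2\<close>.\<close>

locale linear_syzygies =
  fixes I :: "'k::field poly3 set" and r L :: nat and f :: "nat \<Rightarrow> 'k poly3" and t s :: "nat \<Rightarrow> nat"
    and col :: "nat \<Rightarrow> nat \<Rightarrow> 'k poly3"
  assumes homog_f: "j < r \<Longrightarrow> homog (f j) (int (t j))" and f_max: "j < r \<Longrightarrow> coef (f j) 0 = 0"
    and I_gen: "I = {(\<Sum>j<r. f j * v j) | v. True}"
    and col_syz: "l < L \<Longrightarrow> (\<Sum>j<r. f j * col l j) = 0"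
    and syz_gen: "(\<Sum>j<r. f j * v j) = 0 \<Longrightarrow> \<exists>c. \<forall>j<r. v j = (\<Sum>l<L. col l j * c l)"
    and col_linear: "l < L \<Longrightarrow> j < r \<Longrightarrow> homog (col l j) 1"
    and col_homog: "l < L \<Longrightarrow> j < r \<Longrightarrow> homog (col l j) (int (s l) - int (t j))"

section \<open>Consequences of a linear presentation\<close>

lemma linearly_presented_syzygies:
  fixes I :: "'k::field poly3 set"
  assumes "linearly_presented I"
  obtains r L f t s col where "linear_syzygies I r L f t s col"
proof -
  obtain ds tw where res: "min_hom_res I ds tw"
    and lin: "length ds \<ge> 2 \<longrightarrow> (\<forall>i < dim_row (ds ! 1). \<forall>j < dim_col (ds ! 1). homog ((ds ! 1) $$ (i,j)) 1)"
    using assms unfolding linearly_presented_def by blast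
  define r where "r = length (tw ! 1)"
  define f where "f j = (ds ! 0) $$ (0, j)" for j
  define t where "t j = tw ! 1 ! j" for j
  have len: "length ds \<ge> 1" and tw0: "tw ! 0 = [0]"
    and carr: "\<And>k. k < length ds \<Longrightarrow> ds ! k \<in> carrier_mat (length (tw ! k)) (length (tw ! (k+1)))"
    and hom: "\<And>k i j. \<lbrakk>k < length ds; i < length (tw ! k); j < length (tw ! (k+1))\<rbrakk> \<Longrightarrow>
        homog ((ds ! k) $$ (i,j)) (int (tw ! (k+1) ! j) - int (tw ! k ! i)) \<and> in_max_ideal ((ds ! k) $$ (i,j))"
    and im: "I = {(ds ! 0 *\<^sub>v v) $ 0 | v. v \<in> carrier_vec (length (tw ! 1))}"
    and ex: "\<And>k v. \<lbrakk>k + 1 < length ds; v \<in> carrier_vec (length (tw ! (k+1)))\<rbrakk> \<Longrightarrow>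
           ds ! k *\<^sub>v v = 0\<^sub>v (length (tw ! k)) \<longleftrightarrow>
           (\<exists>w \<in> carrier_vec (length (tw ! (k+2))). v = ds ! (k+1) *\<^sub>v w)"
    and inj: "\<And>v. \<lbrakk>v \<in> carrier_vec (length (tw ! length ds));
        ds ! (length ds - 1) *\<^sub>v v = 0\<^sub>v (length (tw ! (length ds - 1)))\<rbrakk> \<Longrightarrow>
        v = 0\<^sub>v (length (tw ! length ds))"
    using res unfolding min_hom_res_def by blast+
  have len0: "0 < length ds" using len by linarith
  have d1: "ds ! 0 \<in> carrier_mat 1 r" using carr [OF len0] tw0 by (simp add: r_def)
  have d1v: "ds ! 0 *\<^sub>v vec r v = vec 1 (\<lambda>_. \<Sum>j<r. f j * v j)" for v
    using d1 by (intro eq_vecI) (auto simp: f_def scalar_prod_def atLeast0LessThan intro!: sum.cong)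
  have hf: "homog (f j) (int (t j)) \<and> coef (f j) 0 = 0" if "j < r" for j
    using hom [OF len0, of 0 j] tw0 that by (simp add: f_def t_def r_def in_max_ideal_def)
  have Ig: "I = {(\<Sum>j<r. f j * v j) | v. True}"
  proof (intro Set.set_eqI iffI)
    fix x assume "x \<in> I"
    then obtain v where v: "v \<in> carrier_vec r" "x = (ds ! 0 *\<^sub>v v) $ 0" using im by (auto simp: r_def)
    then have "vec r (\<lambda>j. v $ j) = v" by (intro eq_vecI) auto
    then have "x = (\<Sum>j<r. f j * v $ j)" using v d1v [of "\<lambda>j. v $ j"] by simp
    then show "x \<in> {(\<Sum>j<r. f j * v j) | v. True}" by blast
  next
    fix x assume "x \<in> {(\<Sum>j<r. f j * v j) | v. True}"
    then obtain v where "x = (\<Sum>j<r. f j * v j)" by blast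
    then have "x = (ds ! 0 *\<^sub>v vec r v) $ 0" by (simp add: d1v)
    then show "x \<in> I" unfolding im r_def [symmetric] by (intro CollectI exI [of _ "vec r v"]) simp
  qed
  show ?thesis
  proof (cases "length ds \<ge> 2")
    case False
    then have l1: "length ds = 1" using len by simp
    \<comment> \<open>Without a second map the first is injective, so there are no syzygies and the
      empty family of columns generates them.\<close>
    have "linear_syzygies I r 0 f t (\<lambda>_. 0) (\<lambda>_ _. 0)"
    proof
      show "\<exists>c. \<forall>j<r. v j = (\<Sum>l<0. 0 * c l)" if z: "(\<Sum>j<r. f j * v j) = 0" for v
      proof -
        have "ds ! 0 *\<^sub>v vec r v = 0\<^sub>v 1" unfolding d1v z by auto
        then have "vec r v = 0\<^sub>v r"
          using inj [of "vec r v"] l1 tw0 by (simp add: r_def)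
        then have "vec r v $ j = 0\<^sub>v r $ j" for j by (simp only:)
        then have "\<forall>j<r. v j = 0" by (metis index_vec index_zero_vec(1))
        then show ?thesis by simp
      qed
    qed (use hf Ig in auto)
    then show ?thesis by (rule that)
  next
    case True
    define L where "L = length (tw ! 2)"
    define col where "col l j = (ds ! 1) $$ (j, l)" for l j
    have d2: "ds ! 1 \<in> carrier_mat r L" using carr [of 1] True by (simp add: r_def L_def numeral_2_eq_2)
    have exact: "ds ! 0 *\<^sub>v v = 0\<^sub>v 1 \<longleftrightarrow> (\<exists>w \<in> carrier_vec L. v = ds ! 1 *\<^sub>v w)" if "v \<in> carrier_vec r" for v
      using ex [of 0 v] True that tw0 by (simp add: r_def L_def numeral_2_eq_2)
    have d2w: "(ds ! 1 *\<^sub>v w) $ j = (\<Sum>l<L. col l j * w $ l)" if "w \<in> carrier_vec L" "j < r" for w j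
      using d2 that by (auto simp: col_def scalar_prod_def atLeast0LessThan intro!: sum.cong)
    have "linear_syzygies I r L f t (\<lambda>l. tw ! 2 ! l) col"
    proof
      show "(\<Sum>j<r. f j * col l j) = 0" if l: "l < L" for l
      proof -
        \<comment> \<open>A column is the image of a unit vector, hence lies in the kernel of the
          first map.\<close>
        have "vec r (col l) = ds ! 1 *\<^sub>v unit_vec L l"
        proof (rule eq_vecI)
          fix j assume "j < dim_vec (ds ! 1 *\<^sub>v unit_vec L l)"
          then have j: "j < r" using d2 by simp
          have "(ds ! 1 *\<^sub>v unit_vec L l) $ j = (\<Sum>l'<L. if l' = l then col l' j else 0)"
            unfolding d2w [OF unit_vec_carrier j] using l
            by (intro sum.cong) (auto simp: unit_vec_def)
          then show "vec r (col l) $ j = (ds ! 1 *\<^sub>v unit_vec L l) $ j" using j l by simp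
        qed (use d2 in simp)
        then have "\<exists>w\<in>carrier_vec L. vec r (col l) = ds ! 1 *\<^sub>v w"
          using unit_vec_carrier by blast
        then have "ds ! 0 *\<^sub>v vec r (col l) = 0\<^sub>v 1"
          using exact [of "vec r (col l)"] vec_carrier by blast
        then have "vec 1 (\<lambda>_. \<Sum>j<r. f j * col l j) $ 0 = 0\<^sub>v 1 $ 0" by (simp only: d1v)
        then show ?thesis by simp
      qed
      show "\<exists>c. \<forall>j<r. v j = (\<Sum>l<L. col l j * c l)" if z: "(\<Sum>j<r. f j * v j) = 0" for v
      proof -
        have "ds ! 0 *\<^sub>v vec r v = 0\<^sub>v 1" unfolding d1v z by auto
        then obtain w where w: "w \<in> carrier_vec L" "vec r v = ds ! 1 *\<^sub>v w" using exact by auto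
        have "v j = (\<Sum>l<L. col l j * w $ l)" if "j < r" for j
          unfolding d2w [OF w(1) that, symmetric] w(2) [symmetric] using that by simp
        then show ?thesis by blast
      qed
      show "homog (col l j) 1" if "l < L" "j < r" for l j
        using lin True d2 that by (simp add: col_def)
      show "homog (col l j) (int (tw ! 2 ! l) - int (t j))" if "l < L" "j < r" for l j
        using hom [of 1 j l] True that by (simp add: col_def L_def r_def t_def numeral_2_eq_2)
    qed (use hf Ig in auto)
    then show ?thesis by (rule that)
  qed
qed

context linear_syzygies
begin

lemma f_in_I: "i < r \<Longrightarrow> f i \<in> I"
  unfolding I_gen
  by (intro CollectI exI [of _ "\<lambda>j. if j = i then 1 else 0"])
    (simp add: if_distrib [of "\<lambda>x. _ * x"] cong: if_cong)

lemma homog_degree_unique: "homog p d \<Longrightarrow> homog p e \<Longrightarrow> p \<noteq> 0 \<Longrightarrow> d = e"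
  by (metis equals0I homog_def keys_eq_empty)

text \<open>A linear syzygy involves generators of one degree only, so the Koszul relation between generators of
  different degrees cannot be a combination of linear syzygies.\<close>

lemma generator_degrees_eq:
  assumes "i < r" "k < r" "f i \<noteq> 0" "f k \<noteq> 0"
  shows "t i = t k"
proof (rule ccontr)
  assume ne: "t i \<noteq> t k"
  \<comment> \<open>The Koszul syzygy between the generators \<open>i\<close> and
    \<open>k\<close>.\<close>
  define v where "v j = (if j = i then f k else 0) - (if j = k then f i else 0)" for j
  have "(\<Sum>j<r. f j * v j) = (\<Sum>j<r. (if j = i then f j * f k else 0) - (if j = k then f j * f i else 0))"
    by (rule sum.cong) (auto simp: v_def right_diff_distrib)
  also have "\<dots> = 0" using assms by (simp add: sum_subtractf mult.commute)
  finally obtain c where c: "\<forall>j<r. v j = (\<Sum>l<L. col l j * c l)" using syz_gen by blast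
  \<comment> \<open>All nonzero entries of a linear column sit at generators of the same degree, so
    restriction to the generators of degree \<open>t i\<close> keeps either the whole syzygy or
    nothing. For \<open>v\<close> the restriction leaves \<open>f i * f k\<close>, which would have
    to vanish.\<close>
  have proj: "(\<Sum>j<r. if t j = t i then f j * col l j else 0) = 0" if l: "l < L" for l
  proof (cases "\<exists>j<r. t j = t i \<and> col l j \<noteq> 0")
    case True
    then obtain j0 where j0: "j0 < r" "t j0 = t i" "col l j0 \<noteq> 0" by blast
    have "int (s l) - int (t j0) = 1"
      using homog_degree_unique [OF col_homog [OF l j0(1)] col_linear [OF l j0(1)] j0(3)] .
    moreover have "int (s l) - int (t j) = 1" if "j < r" "col l j \<noteq> 0" for j
      using homog_degree_unique [OF col_homog [OF l that(1)] col_linear [OF l that(1)] that(2)] .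
    ultimately have "col l j = 0" if "j < r" "t j \<noteq> t i" for j
      using that j0(2) by fastforce
    then have "(\<Sum>j<r. if t j = t i then f j * col l j else 0) = (\<Sum>j<r. f j * col l j)"
      by (intro sum.cong) auto
    then show ?thesis using col_syz [OF l] by simp
  next
    case False
    then show ?thesis by (intro sum.neutral) auto
  qed
  have "f i * f k = (\<Sum>j<r. if j = i then f i * f k else 0)" using assms by simp
  also have "\<dots> = (\<Sum>j<r. if t j = t i then f j * v j else 0)"
    by (rule sum.cong) (use ne in \<open>auto simp: v_def\<close>)
  also have "\<dots> = (\<Sum>j<r. \<Sum>l<L. (if t j = t i then f j * col l j else 0) * c l)"
    by (rule sum.cong) (use c in \<open>auto simp: sum_distrib_left mult.assoc\<close>)
  also have "\<dots> = (\<Sum>l<L. (\<Sum>j<r. if t j = t i then f j * col l j else 0) * c l)"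
    by (subst sum.swap) (simp add: sum_distrib_right)
  also have "\<dots> = 0" by (simp add: proj)
  finally show False using assms by simp
qed

end

section \<open>A common generator degree below \<open>n\<close> is impossible\<close>

text \<open>In its lowest possible degree, a product with a form sees only the constant term of the
  other factor. This serves to remove constant terms from coefficients, once for the generators and
  once for the linear columns.\<close>

lemma coef_homog_mult:
  fixes F V :: "'k::comm_ring_1 poly3"
  assumes F: "homog F (int a)"
  shows "mdeg m < a \<Longrightarrow> coef (F * V) m = 0"
    and "mdeg m = a \<Longrightarrow> coef (F * V) m = coef F m * coef V 0"
proof -
  have key: "\<exists>m1 m2. m = m1 + m2 \<and> mdeg m1 = a \<and> coef W m2 \<noteq> 0" if "coef (F * W) m \<noteq> 0" for W m
  proof -
    have "m \<in> Poly_Mapping.keys (F * W)" using that by (simp add: in_keys_iff)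
    then show ?thesis using keys_mult [of F W] F by (fastforce simp: homog_def in_keys_iff)
  qed
  show "coef (F * V) m = 0" if "mdeg m < a"
    by (rule ccontr) (use key [of V m] that in \<open>auto simp: mdeg_add\<close>)
  show "coef (F * V) m = coef F m * coef V 0" if "mdeg m = a"
  proof -
    let ?W = "V - pconst (coef V 0)"
    have "coef (F * ?W) m = 0"
    proof (rule ccontr)
      assume "coef (F * ?W) m \<noteq> 0"
      from key [OF this] obtain m1 m2 where *: "m = m1 + m2" "mdeg m1 = a" "coef ?W m2 \<noteq> 0" by blast
      then have "m2 = 0" using that by (simp add: mdeg_add mdeg_eq_0_iff)
      then show False using *(3) by (simp add: lookup_minus pconst_def)
    qed
    moreover have "F * V = F * ?W + pconst (coef V 0) * F" by (simp add: algebra_simps)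
    ultimately have "coef (F * V) m = coef V 0 * coef F m" by (simp add: lookup_add)
    then show ?thesis by (simp only: mult.commute)
  qed
qed

lemma coef_sum_mono:
  fixes c :: "mono \<Rightarrow> 'k::comm_ring_1"
  assumes "finite F"
  shows "coef (\<Sum>m\<in>F. pconst (c m) * mono_poly m) m' = (if m' \<in> F then c m' else 0)"
proof -
  have "coef (\<Sum>m\<in>F. pconst (c m) * mono_poly m) m' = (\<Sum>m\<in>F. if m = m' then c m else 0)"
    by (simp add: lookup_sum lookup_single when_def if_distrib [of "\<lambda>x. _ * x"] cong: if_cong)
  then show ?thesis using assms by simp
qed

context linear_syzygies
begin

text \<open>If \<open>I\<close> is generated in degree \<open>a < n\<close>, a functional \<open>\<phi>\<close> on forms of degree \<open>a\<close> that does not vanish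
  on \<open>I\<close> gives forms \<open>P\<^sub>X, P\<^sub>Y, P\<^sub>Z\<close> representing \<open>u \<mapsto> \<phi>(xu), \<phi>(yu), \<phi>(zu)\<close>. They form a Koszul cycle
  modulo \<open>I\<close>, of a degree in which linear syzygies allow to correct it to a Koszul cycle over
  the polynomial ring; hence \<open>\<phi>\<close> is represented by a single form and vanishes on \<open>I\<close> after all.\<close>

lemma ann_degree_bound:
  assumes n: "n \<ge> 1" and D: "in_D (2 * n - 1) \<Phi>" and I: "I = ann (contract px \<Phi>)"
    and p: "homog p (int n - 1)" "p \<in> I"
  shows "p = 0"
proof (rule ccontr)
  assume "p \<noteq> 0"
  have I_iff: "q \<in> I \<longleftrightarrow> (\<forall>g. ev \<Phi> (px * q * g) = 0)" for q
    by (simp add: I ann_contract_iff)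
  have ev0: "ev \<Phi> q = 0" if "homog q e" "e \<noteq> 2 * int n - 1" for q e
    by (rule ev_homog_eq_0 [OF D that(1)]) (use that n in auto)
  obtain m where m: "coef p m \<noteq> 0" using \<open>p \<noteq> 0\<close> by (metis lookup_zero poly_mapping_eqI)
  then have dm: "int (mdeg m) = int n - 1" using homog_coef [OF p(1)] by blast
  obtain v where v: "p = (\<Sum>j<r. f j * v j)" using p(2) I_gen by blast
  have "\<exists>i<r. f i \<noteq> 0"
  proof (rule ccontr)
    assume "\<not> ?thesis"
    then have "p = 0" unfolding v by simp
    then show False using \<open>p \<noteq> 0\<close> by simp
  qed
  then obtain i where i: "i < r" "f i \<noteq> 0" by blast
  define a where "a = t i"
  \<comment> \<open>Zero generators are homogeneous of every degree, so all generators can be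
    treated as having degree \<open>a\<close>.\<close>
  have hf: "homog (f j) (int a)" if "j < r" for j
    using homog_f [OF that] generator_degrees_eq [OF i(1) that i(2)] by (cases "f j = 0") (auto simp: a_def)
  have Imin: "coef q m = 0" if "q \<in> I" "mdeg m < a" for q m
    using that coef_homog_mult(1) [OF hf] unfolding I_gen by (auto simp: lookup_sum)
  have an: "a < n" using Imin [OF p(2), of m] m dm by fastforce
  obtain m0 where m0: "coef (f i) m0 \<noteq> 0" using i(2) by (metis lookup_zero poly_mapping_eqI)
  then have dm0: "mdeg m0 = a" using homog_coef [OF hf [OF i(1)]] by (metis of_nat_eq_iff)
  have a1: "a \<ge> 1"
    using m0 f_max [OF i(1)] dm0 by (cases "a = 0") (auto simp: mdeg_eq_0_iff)
  \<comment> \<open>Picks out a coefficient at which \<open>f i\<close> does not vanish, so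
    \<open>\<phi>\<close> is nonzero on \<open>f i\<close>.\<close>
  define \<phi> where "\<phi> m = (if m = m0 then 1 else 0 :: 'k)" for m
  \<comment> \<open>Complementary degree: x, a form of degree \<open>e\<close> and a form of degree
    \<open>a - 1\<close> multiply to degree \<open>2 * n - 1\<close>.\<close>
  define e where "e = 2 * n - 1 - a"
  have "\<exists>P. homog P (int e) \<and> (\<forall>m. mdeg m = a - 1 \<longrightarrow> ev \<Phi> (px * P * mono_poly m) = \<phi> (Poly_Mapping.single x 1 + m))" for x
  proof -
    let ?F = "set (sym_basis (a - 1))" and ?T = "set (sym_basis e)"
    let ?K = "\<lambda>m u. ev \<Phi> (px * mono_poly m * mono_poly u)"
    \<comment> \<open>A form of degree \<open>a - 1\<close> that pairs to zero with degree
      \<open>e\<close> lies in \<open>I\<close>, which has no terms below degree \<open>a\<close>.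
      Hence the rows are independent and every functional on forms of degree \<open>a - 1\<close> is
      represented.\<close>
    have ind: "c m' = 0" if z: "\<And>u. u \<in> ?T \<Longrightarrow> (\<Sum>m\<in>?F. c m * ?K m u) = 0" and m': "m' \<in> ?F" for c m'
    proof -
      define C where "C = (\<Sum>m\<in>?F. pconst (c m) * mono_poly m)"
      have hC: "homog C (int (a - 1))"
        unfolding C_def by (intro homog_sum homog_pconst_mult homog_single) (auto simp: set_sym_basis)
      have "ev \<Phi> (px * C * mono_poly u) = 0" for u
      proof (cases "mdeg u = e")
        case True
        have "ev \<Phi> (px * C * mono_poly u) = (\<Sum>m\<in>?F. c m * ?K m u)"
        proof -
          have "px * C * mono_poly u = (\<Sum>m\<in>?F. pconst (c m) * (px * mono_poly m * mono_poly u))"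
            by (simp add: C_def sum_distrib_left sum_distrib_right mult_ac)
          then show ?thesis by (simp add: ev_sum ev_pconst_mult)
        qed
        then show ?thesis using z [of u] True by (simp add: set_sym_basis)
      next
        case False
        have "homog (px * C * mono_poly u) (1 + int (a - 1) + int (mdeg u))"
          by (intro homog_mult [OF homog_mult [OF homog_pvar hC refl] homog_single]) auto
        then show ?thesis by (rule ev0) (use False a1 an in \<open>auto simp: e_def\<close>)
      qed
      then have "C \<in> I" unfolding I_iff by (metis ev_mult_eq_0)
      moreover have "mdeg m' < a" using m' a1 by (simp add: set_sym_basis)
      ultimately have "coef C m' = 0" by (rule Imin)
      then show ?thesis using m' by (simp add: C_def coef_sum_mono)
    qed
    have "\<exists>q. \<forall>m\<in>?F. (\<Sum>u\<in>?T. q u * ?K m u) = \<phi> (Poly_Mapping.single x 1 + m)"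
      by (rule independent_rows_surjective [OF finite_set finite_set, where K = ?K]) (rule ind)
    then obtain q where q: "\<forall>m\<in>?F. (\<Sum>u\<in>?T. q u * ?K m u) = \<phi> (Poly_Mapping.single x 1 + m)"
      by blast
    define P where "P = (\<Sum>u\<in>?T. pconst (q u) * mono_poly u)"
    have "homog P (int e)"
      unfolding P_def by (intro homog_sum homog_pconst_mult homog_single) (auto simp: set_sym_basis)
    moreover have "ev \<Phi> (px * P * mono_poly m) = \<phi> (Poly_Mapping.single x 1 + m)" if "mdeg m = a - 1" for m
    proof -
      have "px * P * mono_poly m = (\<Sum>u\<in>?T. pconst (q u) * (px * mono_poly m * mono_poly u))"
        by (simp add: P_def sum_distrib_left sum_distrib_right mult_ac)
      then show ?thesis using q that by (simp add: ev_sum ev_pconst_mult set_sym_basis)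
    qed
    ultimately show ?thesis by blast
  qed
  then obtain P where hP: "\<And>x. homog (P x) (int e)"
    and P: "\<And>x m. mdeg m = a - 1 \<Longrightarrow> ev \<Phi> (px * P x * mono_poly m) = \<phi> (Poly_Mapping.single x 1 + m)"
    by metis
  have evP: "ev \<Phi> (px * P x * g) = ev \<phi> (pvar x * g)" for x g
  proof -
    have "ev \<Phi> (px * P x * mono_poly m) = ev \<phi> (pvar x * mono_poly m)" for m
    proof -
      have rhs: "ev \<phi> (pvar x * mono_poly m) = \<phi> (Poly_Mapping.single x 1 + m)"
        by (simp add: pvar_eq mult_single)
      show ?thesis
      proof (cases "mdeg m = a - 1")
        case False
        have "homog (px * P x * mono_poly m) (1 + int e + int (mdeg m))"
          by (intro homog_mult [OF homog_mult [OF homog_pvar hP refl] homog_single]) auto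
        then have "ev \<Phi> (px * P x * mono_poly m) = 0"
          by (rule ev0) (use False a1 an in \<open>auto simp: e_def\<close>)
        moreover have "Poly_Mapping.single x 1 + m \<noteq> m0"
          using False a1 dm0 by (auto simp: mdeg_add)
        ultimately show ?thesis unfolding rhs by (simp add: \<phi>_def)
      qed (simp add: P rhs)
    qed
    then show ?thesis by (simp add: ev_mult_sum [of _ _ g])
  qed
  \<comment> \<open>Components of the Koszul differential of the triple \<open>P\<close>. They lie
    in \<open>I\<close> because \<open>\<phi>\<close> takes the same value on
    \<open>pvar x * pvar w * g\<close> in either order of the variables.\<close>
  define \<kappa> where "\<kappa> x w = pvar x * P w - pvar w * P x" for x w
  have \<kappa>I: "\<kappa> x w \<in> I" for x w
    unfolding I_iff
  proof
    fix g
    have "px * \<kappa> x w * g = px * P w * (pvar x * g) - px * P x * (pvar w * g)"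
      by (simp add: \<kappa>_def algebra_simps)
    then show "ev \<Phi> (px * \<kappa> x w * g) = 0" by (simp only: ev_diff evP) (simp add: mult_ac)
  qed
  have h\<kappa>: "homog (\<kappa> x w) (int e + 1)" for x w
    unfolding \<kappa>_def using hP by (intro homog_diff homog_pvar_mult) auto
  have lift: "\<exists>A. \<kappa> x w = (\<Sum>j<r. f j * A j) \<and> (\<forall>j. coef (A j) 0 = 0)" for x w
  proof -
    obtain v where v: "\<kappa> x w = (\<Sum>j<r. f j * v j)" using \<kappa>I I_gen by blast
    define D where "D = (\<Sum>j<r. f j * pconst (coef (v j) 0))"
    have hD: "homog D (int a)"
      unfolding D_def using hf
      by (intro homog_sum) (auto simp: mult.commute [of _ "pconst _"] intro!: homog_pconst_mult)
    have "D = 0"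
    proof (rule poly_mapping_eqI)
      fix m
      show "coef D m = coef 0 m"
      proof (cases "mdeg m = a")
        case True
        have "coef D m = (\<Sum>j<r. coef (f j) m * coef (v j) 0)"
          unfolding D_def lookup_sum by (simp add: mult.commute [of _ "pconst _"]) (simp add: mult.commute)
        also have "\<dots> = coef (\<kappa> x w) m"
          unfolding v lookup_sum by (rule sum.cong) (use coef_homog_mult(2) [OF hf True] in auto)
        also have "\<dots> = 0"
          by (rule homog_coef [OF h\<kappa>]) (use True an a1 in \<open>auto simp: e_def\<close>)
        finally show ?thesis by simp
      qed (use homog_coef [OF hD] in auto)
    qed
    then have "\<kappa> x w = (\<Sum>j<r. f j * (v j - pconst (coef (v j) 0)))"
      unfolding D_def v by (simp add: right_diff_distrib sum_subtractf)
    moreover have "coef (v j - pconst (coef (v j) 0)) 0 = 0" for j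
      by (simp add: lookup_minus pconst_def)
    ultimately show ?thesis by (intro exI [of _ "\<lambda>j. v j - pconst (coef (v j) 0)"]) simp
  qed
  obtain A where A: "\<kappa> Y Z = (\<Sum>j<r. f j * A j)" "\<And>j. coef (A j) 0 = 0" using lift by blast
  obtain B where B: "\<kappa> Z X = (\<Sum>j<r. f j * B j)" "\<And>j. coef (B j) 0 = 0" using lift by blast
  obtain C where C: "\<kappa> X Y = (\<Sum>j<r. f j * C j)" "\<And>j. coef (C j) 0 = 0" using lift by blast
  \<comment> \<open>Applying the Koszul differential once more gives zero, so the lifted
    coefficients combine to a syzygy of the generators.\<close>
  define V where "V j = px * A j + py * B j + pz * C j" for j
  have "(\<Sum>j<r. f j * V j) = px * \<kappa> Y Z + py * \<kappa> Z X + pz * \<kappa> X Y"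
    unfolding A(1) B(1) C(1) V_def by (simp add: distrib_left sum.distrib sum_distrib_left mult_ac)
  also have "\<dots> = 0" by (simp add: \<kappa>_def algebra_simps)
  finally obtain c where c: "\<forall>j<r. V j = (\<Sum>l<L. col l j * c l)" using syz_gen by blast
  define c' where "c' l = c l - pconst (coef (c l) 0)" for l
  have Vc': "V j = (\<Sum>l<L. col l j * c' l)" if j: "j < r" for j
  proof -
    define D where "D = (\<Sum>l<L. col l j * pconst (coef (c l) 0))"
    have hD: "homog D (int 1)"
      unfolding D_def using col_linear [OF _ j]
      by (intro homog_sum) (auto simp: mult.commute [of _ "pconst _"] intro!: homog_pconst_mult)
    have "D = 0"
    proof (rule poly_mapping_eqI)
      fix m
      show "coef D m = coef 0 m"
      proof (cases "mdeg m = 1")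
        case True
        have h1: "homog (pvar x :: 'k poly3) (int 1)" for x by (simp add: homog_pvar)
        have hc: "homog (col l j) (int 1)" if "l < L" for l using col_linear [OF that j] by simp
        have "coef D m = (\<Sum>l<L. coef (col l j) m * coef (c l) 0)"
          unfolding D_def lookup_sum by (simp add: mult.commute [of _ "pconst _"]) (simp add: mult.commute)
        also have "\<dots> = coef (V j) m"
          unfolding c [rule_format, OF j] lookup_sum
          by (rule sum.cong) (use coef_homog_mult(2) [OF hc True] in auto)
        also have "\<dots> = 0"
          unfolding V_def lookup_add coef_homog_mult(2) [OF h1 True] by (simp add: A(2) B(2) C(2))
        finally show ?thesis by simp
      next
        case False
        then show ?thesis using homog_coef [OF hD, of m] by simp
      qed
    qed
    then show ?thesis
      unfolding c [rule_format, OF j] D_def c'_def by (simp add: right_diff_distrib sum_subtractf)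
  qed
  have "\<exists>u v w. c' l = px * u + py * v + pz * w" for l
    by (rule max_ideal_decomposition [of "c' l"]) (auto simp: c'_def lookup_minus pconst_def)
  then obtain u v w where uvw: "\<And>l. c' l = px * u l + py * v l + pz * w l" by metis
  \<comment> \<open>Splitting \<open>c'\<close> along x, y, z and subtracting the corresponding
    syzygies leaves the combinations of the generators unchanged and turns each triple into a
    relation between x, y, z, to which \<open>koszul_exact\<close> applies.\<close>
  define A' where "A' j = A j - (\<Sum>l<L. col l j * u l)" for j
  define B' where "B' j = B j - (\<Sum>l<L. col l j * v l)" for j
  define C' where "C' j = C j - (\<Sum>l<L. col l j * w l)" for j
  have cyc: "px * A' j + py * B' j + pz * C' j = 0" if "j < r" for j
  proof -
    have "px * A' j + py * B' j + pz * C' j = V j - (\<Sum>l<L. col l j * c' l)"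
      by (simp add: V_def A'_def B'_def C'_def uvw distrib_left right_diff_distrib sum.distrib
          sum_distrib_left mult_ac)
    then show ?thesis using Vc' [OF that] by simp
  qed
  have "\<exists>P Q S. A' j = py * S - pz * Q \<and> B' j = pz * P - px * S \<and> C' j = px * Q - py * P" if "j < r" for j
    using koszul_exact [OF cyc [OF that]] by metis
  then obtain P' Q' S' where K: "\<And>j. j < r \<Longrightarrow> A' j = py * S' j - pz * Q' j"
    "\<And>j. j < r \<Longrightarrow> B' j = pz * P' j - px * S' j" "\<And>j. j < r \<Longrightarrow> C' j = px * Q' j - py * P' j"
    by metis
  have col0: "(\<Sum>j<r. f j * (\<Sum>l<L. col l j * y l)) = 0" for y
  proof -
    have "(\<Sum>j<r. f j * (\<Sum>l<L. col l j * y l)) = (\<Sum>l<L. (\<Sum>j<r. f j * col l j) * y l)"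
      unfolding sum_distrib_left sum_distrib_right by (subst sum.swap) (simp add: mult.assoc)
    then show ?thesis by (simp add: col_syz)
  qed
  define S where "S = (\<Sum>j<r. f j * S' j)"
  define Q where "Q = (\<Sum>j<r. f j * Q' j)"
  define T where "T = (\<Sum>j<r. f j * P' j)"
  have SI: "S \<in> I" "Q \<in> I" "T \<in> I" unfolding I_gen S_def Q_def T_def by blast+
  have d1: "(\<Sum>j<r. f j * A' j) = \<kappa> Y Z" "(\<Sum>j<r. f j * B' j) = \<kappa> Z X" "(\<Sum>j<r. f j * C' j) = \<kappa> X Y"
    by (simp_all add: A'_def B'_def C'_def right_diff_distrib sum_subtractf col0 A(1) B(1) C(1))
  have d2: "(\<Sum>j<r. f j * A' j) = py * S - pz * Q" "(\<Sum>j<r. f j * B' j) = pz * T - px * S"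
    "(\<Sum>j<r. f j * C' j) = px * Q - py * T"
    by (simp_all add: K S_def Q_def T_def right_diff_distrib sum_subtractf sum_distrib_left mult_ac)
  have swap: "y1 * (q1 - q2) = y2 * (q3 - q4)" if "y1 * q1 - y2 * q3 = y1 * q2 - y2 * q4"
    for y1 y2 q1 q2 q3 q4 :: "'k poly3"
    using that by (simp add: algebra_simps)
  \<comment> \<open>Corrected by elements of \<open>I\<close>, the triple \<open>P\<close> is a
    Koszul cycle over the polynomial ring and not only modulo \<open>I\<close>.\<close>
  have "py * (P Z - S) = pz * (P Y - Q)" "pz * (P X - T) = px * (P Z - S)" "px * (P Y - Q) = py * (P X - T)"
    using swap [OF trans [OF d1(1) [unfolded \<kappa>_def, symmetric] d2(1)]]
      swap [OF trans [OF d1(2) [unfolded \<kappa>_def, symmetric] d2(2)]]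
      swap [OF trans [OF d1(3) [unfolded \<kappa>_def, symmetric] d2(3)]] by simp_all
  then obtain b where b: "P X - T = px * b" "P Y - Q = py * b" "P Z - S = pz * b"
    by (rule koszul_cycle)
  \<comment> \<open>The corrections in \<open>I\<close> are invisible to the pairing, so on
    multiples of each variable \<open>\<phi>\<close> is represented by \<open>b\<close> alone. Since
    \<open>f i\<close> has no constant term, this determines \<open>\<phi>\<close> on it.\<close>
  have red: "ev \<phi> (pvar x * g) = ev \<Phi> (px * (pvar x * b) * g)" if "P x - H = pvar x * b" "H \<in> I" for x g H
  proof -
    have "P x = pvar x * b + H" using that(1) by (simp add: algebra_simps)
    then have "ev \<phi> (pvar x * g) = ev \<Phi> (px * (pvar x * b) * g) + ev \<Phi> (px * H * g)"
      unfolding evP [symmetric] ev_add [symmetric] by (simp add: algebra_simps)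
    then show ?thesis using that(2) by (simp add: I_iff)
  qed
  obtain u1 u2 u3 where fi: "f i = px * u1 + py * u2 + pz * u3"
    by (rule max_ideal_decomposition [OF f_max [OF i(1)]])
  have "ev \<phi> (f i) = ev \<Phi> (px * (px * b) * u1) + ev \<Phi> (px * (py * b) * u2) + ev \<Phi> (px * (pz * b) * u3)"
    unfolding fi ev_add using red [OF b(1) SI(3)] red [OF b(2) SI(2)] red [OF b(3) SI(1)] by simp
  also have "\<dots> = ev \<Phi> (px * f i * b)"
    unfolding fi ev_add [symmetric] by (simp add: algebra_simps)
  also have "\<dots> = 0" using f_in_I [OF i(1)] by (simp add: I_iff)
  finally have "ev \<phi> (f i) = 0" .
  moreover have "ev \<phi> (f i) = (\<Sum>m\<in>Poly_Mapping.keys (f i). if m = m0 then coef (f i) m else 0)"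
    unfolding ev_def by (rule sum.cong) (auto simp: \<phi>_def)
  ultimately show False using m0 by (simp add: in_keys_iff)
qed

end

section \<open>The equivalence\<close>

lemma invertible_if_kernel_trivial:
  fixes A :: "'a::field mat"
  assumes A: "A \<in> carrier_mat N N"
    and ker: "\<And>v. v \<in> carrier_vec N \<Longrightarrow> A *\<^sub>v v = 0\<^sub>v N \<Longrightarrow> v = 0\<^sub>v N"
  shows "invertible_mat A"
proof -
  have "det A \<noteq> 0" using det_0_iff_vec_prod_zero_field [OF A] ker by blast
  from det_non_zero_imp_unit [OF A this, of "()"]
  obtain B where "B \<in> carrier_mat N N" "B * A = 1\<^sub>m N" "A * B = 1\<^sub>m N"
    unfolding Units_def ring_mat_def by auto
  then show ?thesis
    using A unfolding invertible_mat_def inverts_mat_def by auto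
qed

text \<open>A kernel vector of the catalecticant is the coefficient vector of a form of degree
  \<open>n - 1\<close> in the annihilator, and \<open>ann_degree_bound\<close> excludes nonzero
  ones.\<close>

lemma linearly_presented_imp_invertible:
  fixes \<Phi> :: "mono \<Rightarrow> 'k::field"
  assumes n: "n \<ge> 1" and D: "in_D (2 * n - 1) \<Phi>"
    and lin: "linearly_presented (ann (contract px \<Phi>))"
  shows "invertible_mat (Pmat n \<Phi>)"
proof (rule invertible_if_kernel_trivial [OF Pmat_carrier])
  let ?ms = "sym_basis (n - 1)"
  let ?N = "length ?ms"
  obtain r L f t s col where "linear_syzygies (ann (contract px \<Phi>)) r L f t s col"
    using linearly_presented_syzygies [OF lin] by blast
  then interpret linear_syzygies "ann (contract px \<Phi>)" r L f t s col .
  fix v assume v: "v \<in> carrier_vec ?N" "Pmat n \<Phi> *\<^sub>v v = 0\<^sub>v ?N"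
  define p where "p = lincomb (n - 1) (\<lambda>i. v $ i)"
  have hp: "homog p (int n - 1)"
    using homog_lincomb [of "n - 1" "\<lambda>i. v $ i"] n by (simp add: p_def)
  have "ev \<Phi> (px * p * mono_poly m) = 0" for m
  proof (cases "mdeg m = n - 1")
    case True
    then obtain i where i: "i < ?N" "m = ?ms ! i"
      using set_sym_basis [of "n - 1"] by (metis (mono_tags) in_set_conv_nth mem_Collect_eq)
    have "ev \<Phi> (px * p * mono_poly m) = ev \<Phi> (lincomb (n - 1) (\<lambda>i. v $ i) * (px * mono_poly m))"
      by (simp add: p_def mult_ac)
    also have "\<dots> = (\<Sum>l<?N. Pmat n \<Phi> $$ (i, l) * v $ l)"
      unfolding ev_lincomb using i by (intro sum.cong) (auto simp: Pmat_entry mult_ac)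
    also have "\<dots> = (Pmat n \<Phi> *\<^sub>v v) $ i"
      using v(1) i Pmat_carrier [of n \<Phi>] by (auto simp: scalar_prod_def atLeast0LessThan intro!: sum.cong)
    also have "\<dots> = 0" using v(2) i by simp
    finally show ?thesis .
  next
    case False
    have "homog (px * p * mono_poly m) (int n + int (mdeg m))"
      by (rule homog_mult [OF homog_pvar_mult [OF hp] homog_single]) auto
    then show ?thesis
      by (rule ev_homog_eq_0 [OF D]) (use False n in auto)
  qed
  then have "p \<in> ann (contract px \<Phi>)"
    unfolding ann_contract_iff by (metis ev_mult_eq_0)
  then have "p = 0" by (rule ann_degree_bound [OF n D refl hp])
  then have "v $ i = 0" if "i < ?N" for i
    using coef_lincomb [OF that, of "\<lambda>i. v $ i"] by (simp add: p_def)
  then show "v = 0\<^sub>v ?N" using v(1) by (intro eq_vecI) auto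
qed

theorem theorem3p1:
  fixes n :: nat and \<Phi> :: "mono \<Rightarrow> 'k::field"
  assumes "n \<ge> 1" and "in_D (2 * n - 1) \<Phi>"
  defines "I \<equiv> ann (contract (pvar X) \<Phi>)"
  shows "(linearly_presented I \<longleftrightarrow> invertible_mat (Pmat n \<Phi>)) \<and>
         (invertible_mat (Pmat n \<Phi>) \<longrightarrow>
           (let b2 = b2mat n \<Phi>; b1 = pfaff_row b2; b3 = transpose_mat b1 in
            min_hom_res I [b1, b2, b3]
              [[0], replicate (2 * n + 1) n, replicate (2 * n + 1) (n + 1), [2 * n + 1]]))"
proof -
  have res: "min_hom_res I [pfaff_row (b2mat n \<Phi>), b2mat n \<Phi>, transpose_mat (pfaff_row (b2mat n \<Phi>))]
      [[0], replicate (2 * n + 1) n, replicate (2 * n + 1) (n + 1), [2 * n + 1]]"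
    and lin: "linearly_presented I" if inv: "invertible_mat (Pmat n \<Phi>)"
  proof -
    interpret invertible_catalecticant n \<Phi>
      using assms(1,2) inv by unfold_locales
    show res: "min_hom_res I [b1, b2, transpose_mat b1]
        [[0], replicate (2 * n + 1) n, replicate (2 * n + 1) (n + 1), [2 * n + 1]]"
      using resolution by (simp only: I_def assms(3))
    have "\<forall>i<dim_row b2. \<forall>j<dim_col b2. homog (b2 $$ (i, j)) 1"
      using homog_b2 b2mat_carrier by auto
    then have "2 \<le> length [b1, b2, transpose_mat b1] \<longrightarrow>
        (\<forall>i<dim_row ([b1, b2, transpose_mat b1] ! 1). \<forall>j<dim_col ([b1, b2, transpose_mat b1] ! 1).
          homog (([b1, b2, transpose_mat b1] ! 1) $$ (i, j)) 1)"
      by simp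
    then show "linearly_presented I"
      unfolding linearly_presented_def using res by blast
  qed
  moreover have "invertible_mat (Pmat n \<Phi>)" if "linearly_presented I"
    using linearly_presented_imp_invertible [OF assms(1,2)] that unfolding assms(3) .
  ultimately show ?thesis by (auto simp: Let_def)
qed

end
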